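(* In dynamic rings without chirality, with cross detection, and whose size $n$ is known to the agents, Gathering is solvable starting from any initial configuration $C\in\mathcal{C}\setminus\mathcal{P}$. Moreover, there exists an algorithm solving Gathering that terminates in $\mathcal{O}(n)$ rounds for any $C\in\mathcal{C}\setminus\mathcal{P}$ and, if $C\in\mathcal{P}$, the algorithm detects that the configuration is periodic.
   Context: Dynamic ring. $\mathcal{R}=(v_0,\dots,v_{n-1})$ is a ring of $n$ anonymous nodes; $v_i$ is joined to $v_{i-1}$ and $v_{i+1}$ (indices modulo $n$) through two distinctly labeled ports $q_{i-}$, $q_{i+}$; the labeling is arbitrary and need not give a globally consistent orientation. Each port has an incoming and an outgoing buffer. Time proceeds in synchronous rounds; in each round an adversarial scheduler, not restricted by any fairness assumption, chooses which edge (at most one) is missing (1-interval connectivity). Agents. There are $k$ anonymous agents, each with its own memory and computational capability, all executing the same deterministic protocol. They start at distinct nodes, called homebases; homebases are identically marked, so an agent can tell whether its current node is a homebase. Several agents may be in the same node; an agent sees how many other agents are in its node and where (at the node, in which incoming or outgoing buffer). Agents have no explicit communication. Each agent has a private orientation of the ring, consistent over all nodes, designating at each node one port as left and the other as right; different agents may have different orientations. There is chirality if all agents are guaranteed to agree on the orientation; without chirality there is no such guarantee. There is cross detection if, whenever agents move in opposite directions on the same edge in the same round, the involved agents detect this event (not necessarily knowing how many agents are involved). Rounds. In each round each agent, based on the number of agents at its node and in the buffers, its memory and its state, chooses a direction in $\{left,right,nil\}$. With $nil$ it places itself at the node. Otherwise it moves to the outgoing buffer of the chosen port; if the edge is present,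 it arrives in the incoming buffer of the corresponding port of the neighbouring node in the next round; if the edge is missing it stays in the outgoing buffer. There is an initial state and a terminal state. Gathering. Gathering is achieved in a round if all agents are on the same node or on two neighbouring nodes. An algorithm solves Gathering from a configuration if, for every adversarial schedule and every admissible choice of port labels and private orientations, within finite time all agents are in the terminal state, are gathered, and are aware that gathering has been achieved. Configurations. A configuration is the set of locations of the $k$ homebases in the ring; $\mathcal{C}$ is the set of all configurations. Let $h_0,\dots,h_{k-1}$ be the homebases in clockwise order and $d_i$ the number of edges between $h_i$ and $h_{i+1}$ (indices modulo $k$). The configuration is periodic if there is $p$ with $p\mid k$, $p<k$, and $d_i=d_{i+p}$ for all $i$; $\mathcal{P}$ is the set of periodic configurations.
   Formalization: For C in P, each execution ends with all agents detecting periodicity or all terminating correctly gathered; detection in every execution is impossible, as the scheduler can make two mirrored agents at opposite nodes of a 6-ring see exactly what a single agent sees. *)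

theory Defs
  imports Complex_Main "HOL-Library.Landau_Symbols"
begin

text \<open>
  Nodes of a ring of size \<open>n\<close> are the numbers below \<open>n\<close>, in clockwise order, and edge \<open>i\<close>
  joins \<open>i\<close> and \<open>(i + 1) mod n\<close>.  Neither these numbers nor the port labels are visible
  to the agents.  A configuration is the set of homebases; each agent is identified with its
  homebase, which is just a device to quantify over agents.
\<close>

subsection \<open>Configurations\<close>

definition configurations :: "nat \<Rightarrow> nat set set" where
  "configurations n = {C. C \<subseteq> {..<n} \<and> C \<noteq> {}}"

definition homebase_seq :: "nat set \<Rightarrow> nat \<Rightarrow> nat" where
  "homebase_seq C i = sorted_list_of_set C ! i"

definition interdist :: "nat \<Rightarrow> nat set \<Rightarrow> nat \<Rightarrow> nat" where
  "interdist n C i =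
     (if i + 1 < card C then homebase_seq C (i + 1) - homebase_seq C i
      else n - homebase_seq C i + homebase_seq C 0)"

definition periodic_configurations :: "nat \<Rightarrow> nat set set" where
  "periodic_configurations n =
     {C \<in> configurations n. \<exists>p. p dvd card C \<and> p < card C \<and>
        (\<forall>i < card C. interdist n C i = interdist n C ((i + p) mod card C))}"


subsection \<open>Protocols\<close>

datatype side = Left | Right

text \<open>Position of an agent relative to its node; \<open>'p\<close> is how ports are named: by
  their label in the global state, by the private notion of left and right in an observation.\<close>

datatype 'p place = AtNode | Incoming 'p | Outgoing 'p

record observation =
  homebase :: bool
  own_place :: "side place"
  crossing :: bool
  others :: "side place \<Rightarrow> nat"

text \<open>The type \<open>'m\<close> comprises both the state and the memory of an agent. In a
  chosen direction, \<open>None\<close> stands for nil.\<close>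

record 'm protocol =
  initial :: 'm
  terminal :: "'m \<Rightarrow> bool"
  periodic_detected :: "'m \<Rightarrow> bool"
  act :: "observation \<Rightarrow> 'm \<Rightarrow> 'm \<times> side option"


subsection \<open>Environments\<close>

datatype port = Minus | Plus

fun other_port :: "port \<Rightarrow> port" where
  "other_port Minus = Plus"
| "other_port Plus = Minus"

text \<open>\<open>clockwise_port E i\<close> is the label of the port of node \<open>i\<close> leading to its clockwise
  neighbour, \<open>left_port E a i\<close> the port of node \<open>i\<close> that agent \<open>a\<close> calls left, and
  \<open>missing E r\<close> the edge missing in round \<open>r\<close>, if any.\<close>

record environment =
  clockwise_port :: "nat \<Rightarrow> port"
  left_port :: "nat \<Rightarrow> nat \<Rightarrow> port"
  missing :: "nat \<Rightarrow> nat option"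

text \<open>An orientation is consistent if left is the same direction around the ring at every
  node, whatever the labels.  No relation between the orientations of different agents is
  required (no chirality).  Protocols being deterministic, quantifying over all functions
  \<open>missing\<close> also covers adaptive schedulers.\<close>

definition admissible :: "nat \<Rightarrow> nat set \<Rightarrow> environment \<Rightarrow> bool" where
  "admissible n C E \<longleftrightarrow>
     (\<forall>a\<in>C. (\<forall>i<n. left_port E a i = clockwise_port E i) \<or>
             (\<forall>i<n. left_port E a i \<noteq> clockwise_port E i)) \<and>
     (\<forall>r e. missing E r = Some e \<longrightarrow> e < n)"

definition edge_at :: "nat \<Rightarrow> environment \<Rightarrow> nat \<Rightarrow> port \<Rightarrow> nat" where
  "edge_at n E v p = (if p = clockwise_port E v then v else (v + n - 1) mod n)"

definition neighbour :: "nat \<Rightarrow> environment \<Rightarrow> nat \<Rightarrow> port \<Rightarrow> nat" where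
  "neighbour n E v p = (if p = clockwise_port E v then (v + 1) mod n else (v + n - 1) mod n)"

text \<open>The port at the far end of the edge leaving \<open>v\<close> through \<open>p\<close>.\<close>

definition far_port :: "nat \<Rightarrow> environment \<Rightarrow> nat \<Rightarrow> port \<Rightarrow> port" where
  "far_port n E v p =
     (if p = clockwise_port E v then other_port (clockwise_port E (neighbour n E v p))
      else clockwise_port E (neighbour n E v p))"

definition port_on :: "environment \<Rightarrow> nat \<Rightarrow> nat \<Rightarrow> side \<Rightarrow> port" where
  "port_on E a v d = (case d of Left \<Rightarrow> left_port E a v | Right \<Rightarrow> other_port (left_port E a v))"

definition side_of :: "environment \<Rightarrow> nat \<Rightarrow> nat \<Rightarrow> port \<Rightarrow> side" where
  "side_of E a v p = (if p = left_port E a v then Left else Right)"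


subsection \<open>Executions\<close>

text \<open>Agents in a buffer of a node are located at that node.  The flag \<open>crossed\<close> records
  whether the agent, in the previous round, traversed an edge that another agent
  traversed in the opposite direction.\<close>

record 'm agent =
  node :: nat
  place :: "port place"
  crossed :: bool
  mem :: 'm

type_synonym 'm global = "nat \<Rightarrow> 'm agent"

definition observe :: "nat set \<Rightarrow> environment \<Rightarrow> 'm global \<Rightarrow> nat \<Rightarrow> observation" where
  "observe C E s a =
     (let v = node (s a); view = map_place (side_of E a v)
      in \<lparr> homebase = (v \<in> C),
           own_place = view (place (s a)),
           crossing = crossed (s a),
           others = (\<lambda>x. card {b \<in> C. b \<noteq> a \<and> node (s b) = v \<and> view (place (s b)) = x}) \<rparr>)"

text \<open>An agent in a terminal state no longer computes and stays at its node.\<close>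

definition decide ::
  "'m protocol \<Rightarrow> nat set \<Rightarrow> environment \<Rightarrow> 'm global \<Rightarrow> nat \<Rightarrow> 'm \<times> side option" where
  "decide P C E s a =
     (if terminal P (mem (s a)) then (mem (s a), None)
      else act P (observe C E s a) (mem (s a)))"

definition exit_port ::
  "'m protocol \<Rightarrow> nat set \<Rightarrow> environment \<Rightarrow> 'm global \<Rightarrow> nat \<Rightarrow> port option" where
  "exit_port P C E s a = map_option (port_on E a (node (s a))) (snd (decide P C E s a))"

definition step ::
  "'m protocol \<Rightarrow> nat \<Rightarrow> nat set \<Rightarrow> environment \<Rightarrow> nat option \<Rightarrow> 'm global \<Rightarrow> 'm global" where
  "step P n C E absent s a =
     (let v = node (s a); m = fst (decide P C E s a)
      in case exit_port P C E s a of
           None \<Rightarrow> \<lparr> node = v, place = AtNode, crossed = False, mem = m \<rparr>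
         | Some p \<Rightarrow>
             if absent = Some (edge_at n E v p)
             then \<lparr> node = v, place = Outgoing p, crossed = False, mem = m \<rparr>
             else \<lparr> node = neighbour n E v p,
                    place = Incoming (far_port n E v p),
                    crossed = (\<exists>b\<in>C. node (s b) = neighbour n E v p \<and>
                                     exit_port P C E s b = Some (far_port n E v p)),
                    mem = m \<rparr>)"

primrec run :: "'m protocol \<Rightarrow> nat \<Rightarrow> nat set \<Rightarrow> environment \<Rightarrow> nat \<Rightarrow> 'm global" where
  "run P n C E 0 = (\<lambda>a. \<lparr> node = a, place = AtNode, crossed = False, mem = initial P \<rparr>)"
| "run P n C E (Suc r) = step P n C E (missing E r) (run P n C E r)"


subsection \<open>Gathering\<close>

definition gathered :: "nat \<Rightarrow> nat set \<Rightarrow> 'm global \<Rightarrow> bool" where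
  "gathered n C s \<longleftrightarrow> (\<exists>v<n. \<forall>a\<in>C. node (s a) \<in> {v, (v + 1) mod n})"

definition all_terminal :: "'m protocol \<Rightarrow> nat set \<Rightarrow> 'm global \<Rightarrow> bool" where
  "all_terminal P C s \<longleftrightarrow> (\<forall>a\<in>C. terminal P (mem (s a)))"

text \<open>Awareness: the terminal state is a reliable indication that gathering has been achieved.\<close>

definition aware :: "'m protocol \<Rightarrow> nat \<Rightarrow> nat set \<Rightarrow> environment \<Rightarrow> bool" where
  "aware P n C E \<longleftrightarrow>
     (\<forall>r. (\<exists>a\<in>C. terminal P (mem (run P n C E r a))) \<longrightarrow> gathered n C (run P n C E r))"

definition solves_gathering :: "'m protocol \<Rightarrow> nat \<Rightarrow> nat set \<Rightarrow> bool" where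
  "solves_gathering P n C \<longleftrightarrow>
     (\<forall>E. admissible n C E \<longrightarrow>
        (\<exists>r. all_terminal P C (run P n C E r) \<and> gathered n C (run P n C E r)) \<and>
        aware P n C E)"

definition terminates_within :: "'m protocol \<Rightarrow> nat \<Rightarrow> nat set \<Rightarrow> nat \<Rightarrow> bool" where
  "terminates_within P n C t \<longleftrightarrow>
     (\<forall>E. admissible n C E \<longrightarrow> (\<exists>r\<le>t. all_terminal P C (run P n C E r)))"

text \<open>On a periodic configuration the scheduler can, by keeping edges missing, force the
  agents to be gathered before they can know the configuration; such executions may
  end as gathered.  In all others, every agent has to detect periodicity.  For instance,
  let \<open>n = 6\<close>, and let the homebases be 0 and 3 with mirrored orientations; if edges 1 and 4 are
  missing whenever the agents try to use them, then each agent has the view of a single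
  agent with homebase 0 that is kept on the nodes 5, 0, 1, and that agent has to end as gathered.\<close>

definition detects_periodicity :: "'m protocol \<Rightarrow> nat \<Rightarrow> nat set \<Rightarrow> bool" where
  "detects_periodicity P n C \<longleftrightarrow>
     (\<forall>E. admissible n C E \<longrightarrow>
        (\<exists>r. (\<forall>a\<in>C. periodic_detected P (mem (run P n C E r a))) \<or>
             all_terminal P C (run P n C E r) \<and> gathered n C (run P n C E r)) \<and>
        aware P n C E)"

definition never_detects_periodicity :: "'m protocol \<Rightarrow> nat \<Rightarrow> nat set \<Rightarrow> bool" where
  "never_detects_periodicity P n C \<longleftrightarrow>
     (\<forall>E. admissible n C E \<longrightarrow>
        (\<forall>r. \<forall>a\<in>C. \<not> periodic_detected P (mem (run P n C E r a))))"

end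

theory Submission
  imports Defs "HOL-Library.Countable"
begin

text \<open>
  Agents that keep moving in the same direction merge or tour the ring, since an agent blocked
  at an edge waits for all those behind it.  Two merged groups that move towards each other
  meet, cross or are stuck at the two ends of the same missing edge within \<open>n\<close> rounds, and in
  each case they are gathered; a crossing is noticed by everybody.

  All agents first go left.  After \<open>6 n\<close> rounds an orientation class is either a merged group of
  unaware agents or consists of informed ones.  Unaware agents keep going left and informed ones
  turn right.  If both classes are unaware, they are two merged groups facing each other.  Otherwise
  everybody now moves in the same direction, so that all agents merge, which an unaware group
  recognizes by its lack of progress, or all know the configuration.

  An aperiodic configuration has a center (a node or an edge) that does not depend on the frame of
  the agent.  The agents approach it; after \<open>n\<close> rounds those that are late form one group, which waits
  for \<open>n\<close> rounds, while the others search for it, starting in both directions.  If there are two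
  searching groups, at least one of them succeeds.  Two merged groups with different roles are left.
  They march for \<open>2 n\<close> rounds; if they face each other, they gather or are blocked for the last
  \<open>n\<close> rounds, which is impossible if they march in the same direction.  In the latter case one of
  them turns around, and now they face each other.
\<close>

subsection \<open>Periodicity and the center\<close>

text \<open>Only one edge is missing per round, so two blocked agents are at the same end or at
  opposite ends of it. Hence two agents that are apart and do not face each other across it jointly
  gain at least one edge per round. This fixes the phase lengths. Unmerged agents of one class
  progress equally up to less than \<open>n\<close>, so \<open>3 n\<close> rounds take each of them
  round the ring. On the way to the center, two late agents have together less than \<open>n\<close>
  edges to go, and two searching groups at most \<open>n\<close>: hence \<open>n\<close> rounds
  each. Facing groups close their gap in \<open>n\<close> rounds and are seen to be blocked in the
  next \<open>n\<close>, whereas unmerged groups with a common direction both move within any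
  \<open>n\<close> rounds. The obstacle is that without chirality no common direction can be agreed
  on, and a group cannot foresee whether it faces the other one. Hence the center, which splits the
  agents by what happened to them, and the test of round \<open>13 n\<close>. Positions are lifted
  to the integers, where the symmetries of the ring are the maps \<open>s * x + t\<close>.\<close>

definition hset :: "nat \<Rightarrow> nat set \<Rightarrow> int set" where
  "hset n C = {x. nat (x mod int n) \<in> C}"

definition rotation_symmetric :: "nat \<Rightarrow> int set \<Rightarrow> bool" where
  "rotation_symmetric n H \<longleftrightarrow> (\<exists>t. 0 < t \<and> t < int n \<and> (\<forall>x. x + t \<in> H \<longleftrightarrow> x \<in> H))"

definition dihedral :: "int \<Rightarrow> int \<Rightarrow> int set \<Rightarrow> int set" where
  "dihedral s t H = (\<lambda>x. s * x + t) ` H"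

text \<open>Values are in half edges modulo \<open>2 * n\<close>, so that a center may be a node
  (even) or the middle of an edge (odd). This is why a translation by \<open>t\<close> adds
  \<open>2 * t\<close>.\<close>

definition equivariant :: "nat \<Rightarrow> (int set \<Rightarrow> int) \<Rightarrow> bool" where
  "equivariant n F \<longleftrightarrow> (\<forall>H s t. (\<forall>x. x + int n \<in> H \<longleftrightarrow> x \<in> H) \<longrightarrow> \<not> rotation_symmetric n H \<longrightarrow>
     s = 1 \<or> s = - 1 \<longrightarrow> 2 * int n dvd F (dihedral s t H) - (s * F H + 2 * t))"

text \<open>Chosen once for each \<open>n\<close>, so that all agents evaluate the same function,
  each on the homebases as they appear in its own frame.\<close>

definition center :: "nat \<Rightarrow> int set \<Rightarrow> int" where
  "center n = (SOME F. equivariant n F)"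

lemma dihedral_mem:
  assumes "s = 1 \<or> s = - 1"
  shows "x \<in> dihedral s t H \<longleftrightarrow> s * (x - t) \<in> H"
  using assms unfolding dihedral_def
  by (auto simp: image_iff algebra_simps intro: bexI[of _ "s * (x - t)"])

lemma dihedral_comp: "dihedral s t (dihedral s' t' H) = dihedral (s * s') (s * t' + t) H"
  unfolding dihedral_def image_image by (simp add: algebra_simps)

lemma dihedral_id: "dihedral 1 0 H = H"
  unfolding dihedral_def by simp

text \<open>Reduced modulo \<open>n\<close>, the translation would be a forbidden rotation unless
  the residue is 0.\<close>

lemma translation_multiple:
  assumes n: "n > 0" and per: "\<And>x. x + int n \<in> H \<longleftrightarrow> x \<in> H"
    and nr: "\<not> rotation_symmetric n H" and t: "\<And>x. x + t \<in> H \<longleftrightarrow> x \<in> H"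
  shows "int n dvd t"
proof -
  have per': "x + int n * k \<in> H \<longleftrightarrow> x \<in> H" for x k
  proof (induction k rule: int_induct[where k = 0])
    case (step1 i)
    then show ?case using per[of "x + int n * i"] by (simp add: algebra_simps)
  next
    case (step2 i)
    then show ?case using per[of "x + int n * (i - 1)"] by (simp add: algebra_simps)
  qed simp
  have "x + t mod int n \<in> H \<longleftrightarrow> x \<in> H" for x
  proof -
    have "x + t = (x + t mod int n) + int n * (t div int n)" by simp
    then show ?thesis using per' t by metis
  qed
  moreover have "0 \<le> t mod int n" "t mod int n < int n" using n by auto
  ultimately have "t mod int n = 0"
    using nr unfolding rotation_symmetric_def by (metis order_le_less)
  then show ?thesis by auto
qed

text \<open>Two reflections in the stabilizer of \<open>H\<close> differ by a translation, hence
  agree modulo \<open>n\<close>. The reflection \<open>x -> t0 - x\<close> fixes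
  \<open>t0 / 2\<close>, which is \<open>t0\<close> in half edges. Without reflections any value
  does.\<close>

lemma stable_center:
  assumes n: "n > 0" and per: "\<And>x. x + int n \<in> H \<longleftrightarrow> x \<in> H" and nr: "\<not> rotation_symmetric n H"
  shows "\<exists>c. \<forall>s t. s = 1 \<or> s = - 1 \<longrightarrow> dihedral s t H = H \<longrightarrow> 2 * int n dvd c - (s * c + 2 * t)"
proof -
  have trans: "int n dvd t" if "dihedral 1 t H = H" for t
    using translation_multiple[OF n per nr, of "- t"] dihedral_mem[of 1 _ t H] that by simp
  show ?thesis
  proof (cases "\<exists>t. dihedral (- 1) t H = H")
    case True
    then obtain t0 where t0: "dihedral (- 1) t0 H = H" by blast
    have "2 * int n dvd t0 - (s * t0 + 2 * t)" if "s = 1 \<or> s = - 1" "dihedral s t H = H" for s t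
    proof (cases "s = 1")
      case True
      then have "int n dvd t" using trans that by simp
      then show ?thesis using True by (simp add: mult_dvd_mono)
    next
      case False
      then have s: "s = - 1" using that by simp
      have "dihedral 1 (t - t0) H = H"
        using dihedral_comp[of "- 1" t "- 1" t0 H] t0 that s by (simp add: algebra_simps)
      then have "int n dvd t - t0" by (rule trans)
      then have "int n dvd t0 - t" by (simp add: dvd_diff_commute)
      then have "2 * int n dvd 2 * (t0 - t)" by (rule mult_dvd_mono[OF dvd_refl])
      then show ?thesis using s by (simp add: algebra_simps)
    qed
    then show ?thesis by blast
  next
    case False
    have "2 * int n dvd 0 - (s * 0 + 2 * t)" if "s = 1 \<or> s = - 1" "dihedral s t H = H" for s t
    proof -
      have "s = 1" using False that by blast
      then have "int n dvd t" using trans that by simp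
      then show ?thesis by (simp add: mult_dvd_mono)
    qed
    then show ?thesis by blast
  qed
qed

lemma periodic_dihedral:
  assumes s: "s = 1 \<or> s = - 1" and per: "\<And>x. x + int n \<in> H \<longleftrightarrow> x \<in> H"
  shows "x + int n \<in> dihedral s t H \<longleftrightarrow> x \<in> dihedral s t H"
  using s per[of "s * (x - t)"] per[of "s * (x + int n - t)"]
  by (auto simp: dihedral_mem[OF s] algebra_simps)

lemma rotation_symmetric_dihedral_imp:
  assumes s: "s = 1 \<or> s = - 1" and R: "rotation_symmetric n H"
  shows "rotation_symmetric n (dihedral s t H)"
proof -
  obtain u where u: "0 < u" "u < int n" "\<And>x. x + u \<in> H \<longleftrightarrow> x \<in> H"
    using R unfolding rotation_symmetric_def by blast
  have "x + u \<in> dihedral s t H \<longleftrightarrow> x \<in> dihedral s t H" for x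
    using s u(3)[of "s * (x - t)"] u(3)[of "s * (x + u - t)"]
    by (auto simp: dihedral_mem[OF s] algebra_simps)
  then show ?thesis using u unfolding rotation_symmetric_def by blast
qed

lemma dihedral_inverse:
  assumes s: "s = 1 \<or> s = - 1"
  shows "dihedral s (- s * t) (dihedral s t H) = H"
  using s by (auto simp: dihedral_comp dihedral_id)

lemma rotation_symmetric_dihedral:
  assumes s: "s = 1 \<or> s = - 1"
  shows "rotation_symmetric n (dihedral s t H) \<longleftrightarrow> rotation_symmetric n H"
  using rotation_symmetric_dihedral_imp[OF s] dihedral_inverse[OF s] by metis

text \<open>Choose a representative of each orbit of the dihedral group and a center fixed by
  the stabilizer of the representative, and transport it along the orbit.\<close>

lemma ex_equivariant:
  assumes n: "n > 0"
  shows "\<exists>F. equivariant n F"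
proof -
  define rel where "rel H R \<longleftrightarrow> (\<exists>s t. (s = 1 \<or> s = - 1) \<and> H = dihedral s t R)" for H R
  define rep where "rep H = (SOME R. rel H R)" for H
  define tr where "tr H = (SOME st. (fst st = 1 \<or> fst st = - 1) \<and> H = dihedral (fst st) (snd st) (rep H))" for H
  define c where "c R = (SOME c. \<forall>s t. s = 1 \<or> s = - 1 \<longrightarrow> dihedral s t R = R \<longrightarrow>
      2 * int n dvd c - (s * c + 2 * t))" for R
  define F where "F H = fst (tr H) * c (rep H) + 2 * snd (tr H)" for H
  have rel_rep: "rel H (rep H)" for H
  proof -
    have "rel H H" unfolding rel_def by (metis dihedral_id)
    then show ?thesis unfolding rep_def by (rule someI)
  qed
  then have tr: "fst (tr H) = 1 \<or> fst (tr H) = - 1" "H = dihedral (fst (tr H)) (snd (tr H)) (rep H)" for H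
  proof -
    have "\<exists>st. (fst st = 1 \<or> fst st = - 1) \<and> H = dihedral (fst st) (snd st) (rep H)"
      using rel_rep[of H] unfolding rel_def by auto
    from someI_ex[OF this] show "fst (tr H) = 1 \<or> fst (tr H) = - 1"
      "H = dihedral (fst (tr H)) (snd (tr H)) (rep H)" unfolding tr_def by auto
  qed
  have rel_dihedral: "rel (dihedral s t H) R \<longleftrightarrow> rel H R" if s: "s = 1 \<or> s = - 1" for s t H R
  proof
    assume "rel H R"
    then obtain s' t' where "s' = 1 \<or> s' = - 1" "H = dihedral s' t' R" unfolding rel_def by blast
    then have "s * s' = 1 \<or> s * s' = - 1" "dihedral s t H = dihedral (s * s') (s * t' + t) R"
      using s by (auto simp: dihedral_comp)
    then show "rel (dihedral s t H) R" unfolding rel_def by blast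
  next
    assume "rel (dihedral s t H) R"
    then obtain s' t' where "s' = 1 \<or> s' = - 1" "dihedral s t H = dihedral s' t' R" unfolding rel_def by blast
    then have "s * s' = 1 \<or> s * s' = - 1" "H = dihedral (s * s') (s * t' - s * t) R"
      using s dihedral_inverse[OF s, of t H] by (auto simp: dihedral_comp)
    then show "rel H R" unfolding rel_def by blast
  qed
  have "2 * int n dvd F (dihedral s t H) - (s * F H + 2 * t)"
    if per: "\<And>x. x + int n \<in> H \<longleftrightarrow> x \<in> H" and nr: "\<not> rotation_symmetric n H" and s: "s = 1 \<or> s = - 1" for H s t
  proof -
    define H' R where "H' = dihedral s t H" and "R = rep H"
    \<comment> \<open>The predicates themselves are equal, so \<open>SOME\<close> picks the same
      representative for both sets.\<close>
    have "rel H' = rel H" unfolding H'_def by (intro ext rel_dihedral[OF s])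
    then have R': "rep H' = R" unfolding rep_def R_def by simp
    obtain p q where pq: "p = 1 \<or> p = - 1" "H = dihedral p q R" "p = fst (tr H)" "q = snd (tr H)"
      using tr R_def by blast
    obtain p' q' where pq': "p' = 1 \<or> p' = - 1" "H' = dihedral p' q' R" "p' = fst (tr H')" "q' = snd (tr H')"
      using tr R' by blast
    have R_eq: "R = dihedral p (- p * q) H"
      using dihedral_inverse[OF pq(1), of q R] unfolding pq(2)[symmetric] by (rule sym)
    have perR: "\<And>x. x + int n \<in> R \<longleftrightarrow> x \<in> R"
      unfolding R_eq by (rule periodic_dihedral[OF pq(1) per])
    have nrR: "\<not> rotation_symmetric n R"
      unfolding R_eq rotation_symmetric_dihedral[OF pq(1)] by (rule nr)
    have stab: "\<forall>s t. s = 1 \<or> s = - 1 \<longrightarrow> dihedral s t R = R \<longrightarrow> 2 * int n dvd c R - (s * c R + 2 * t)"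
      unfolding c_def by (rule someI_ex[OF stable_center[OF n perR nrR]])
    have "R = dihedral p' (- p' * q') H'"
      using dihedral_inverse[OF pq'(1), of q' R] unfolding pq'(2)[symmetric] by (rule sym)
    also have "\<dots> = dihedral p' (- p' * q') (dihedral s t (dihedral p q R))"
      unfolding H'_def using pq(2) by (rule arg_cong)
    also have "\<dots> = dihedral (p' * s * p) (p' * (s * q + t) - p' * q') R"
      by (simp add: dihedral_comp algebra_simps)
    \<comment> \<open>\<open>R\<close> is carried to \<open>H'\<close> along two routes, directly
      and through \<open>H\<close>. Comparing them gives an element of the stabilizer of
      \<open>R\<close>, and \<open>c R\<close> was chosen to be invariant under it modulo
      \<open>2 * n\<close>.\<close>
    finally have fix1: "dihedral (p' * s * p) (p' * (s * q + t) - p' * q') R = R" by simp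
    have "p' * s * p = 1 \<or> p' * s * p = - 1" using pq(1) pq'(1) s by auto
    then have "2 * int n dvd c R - ((p' * s * p) * c R + 2 * (p' * (s * q + t) - p' * q'))"
      using stab fix1 by blast
    then have "2 * int n dvd p' * (c R - ((p' * s * p) * c R + 2 * (p' * (s * q + t) - p' * q')))"
      by (rule dvd_mult)
    also have "p' * (c R - ((p' * s * p) * c R + 2 * (p' * (s * q + t) - p' * q'))) =
        p' * c R + 2 * q' - (s * (p * c R + 2 * q) + 2 * t)"
      using pq'(1) by (auto simp: algebra_simps)
    also have "\<dots> = F H' - (s * F H + 2 * t)"
      unfolding F_def using R' R_def pq(3,4) pq'(3,4) by simp
    finally show ?thesis unfolding H'_def .
  qed
  then have "equivariant n F" unfolding equivariant_def by blast
  then show ?thesis by blast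
qed

lemma center_dihedral:
  assumes "n > 0" "\<And>x. x + int n \<in> H \<longleftrightarrow> x \<in> H" "\<not> rotation_symmetric n H" "s = 1 \<or> s = - 1"
  shows "2 * int n dvd center n (dihedral s t H) - (s * center n H + 2 * t)"
  using someI_ex[OF ex_equivariant[OF assms(1)]] assms(2-) unfolding center_def equivariant_def by blast

section \<open>Periodic interdistances and rotational symmetry\<close>

text \<open>The \<open>i\<close>-th value of one enumeration occurs in the other, and at no earlier
  index because the earlier values agree. This later turns a translation that preserves the
  homebases into an index shift.\<close>

lemma strict_enumerations_eq:
  fixes f g :: "nat \<Rightarrow> int"
  assumes f: "strict_mono f" and g: "strict_mono g" and r: "range f = range g"
  shows "f = g"
proof
  fix i
  show "f i = g i"
  proof (induction i rule: less_induct)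
    case (less i)
    have aux: "a i \<le> b i" if ab: "strict_mono a" "strict_mono b" "range a = range b"
      "\<And>j. j < i \<Longrightarrow> a j = b j" for a b :: "nat \<Rightarrow> int"
    proof -
      obtain j where j: "b i = a j" using ab(3) by blast
      have "\<not> j < i"
      proof
        assume "j < i"
        then have "b i = b j" using j ab(4) by simp
        then show False using strict_monoD[OF ab(2) \<open>j < i\<close>] by simp
      qed
      then show ?thesis using j strict_mono_less_eq[OF ab(1)] by simp
    qed
    show ?case
    proof (rule antisym)
      show "f i \<le> g i" by (rule aux[OF f g r less])
      show "g i \<le> f i" by (rule aux[OF g f r[symmetric] less[symmetric]])
    qed
  qed
qed

text \<open>Bezout. It is needed because the index shift obtained from a rotation need not divide
  \<open>card C\<close>, as the definition of periodicity demands.\<close>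

lemma gcd_period:
  fixes e :: "nat \<Rightarrow> 'a"
  assumes p: "p > 0" "\<And>i. e (i + p) = e i" and k: "\<And>i. e (i + k) = e i"
  shows "e (i + gcd p k) = e i"
proof -
  have mult: "e (i + m * q) = e i" if "\<And>i. e (i + q) = e i" for i m q
  proof (induction m)
    case (Suc m)
    then show ?case using that[of "i + m * q"] by (simp add: algebra_simps)
  qed simp
  obtain x y where xy: "p * x = k * y + gcd p k" using bezout_nat[of p k] p(1) by auto
  have "e (i + gcd p k) = e (i + gcd p k + y * k)" using mult[OF k] by simp
  also have "i + gcd p k + y * k = i + x * p" using xy by (simp add: algebra_simps)
  also have "e (i + x * p) = e i" using mult[OF p(2)] by simp
  finally show ?thesis .
qed

locale configuration =
  fixes n :: nat and C :: "nat set"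
  assumes n: "n > 0" and C: "C \<in> configurations n"
begin

abbreviation "k \<equiv> card C"
abbreviation "L \<equiv> sorted_list_of_set C"

text \<open>Lists the nonnegative homebases of the covering line in increasing order. The
  interdistances become differences of consecutive terms, without a special case at the
  wrap-around.\<close>

definition unrolled :: "nat \<Rightarrow> int" where
  "unrolled i = int (L ! (i mod k)) + int n * int (i div k)"

lemma C_sub: "c \<in> C \<Longrightarrow> c < n" and C_ne: "C \<noteq> {}" and C_fin: "finite C" and k_pos: "k > 0"
proof -
  show sub: "c \<in> C \<Longrightarrow> c < n" for c using C unfolding configurations_def by blast
  show ne: "C \<noteq> {}" using C unfolding configurations_def by blast
  show fin: "finite C" using sub by (meson bounded_nat_set_is_finite)
  show "k > 0" using ne fin by (simp add: card_gt_0_iff)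
qed

lemma L_nth: "i < k \<Longrightarrow> L ! i \<in> C"
  using C_fin by (metis nth_mem set_sorted_list_of_set length_sorted_list_of_set)

lemma L_less: "i < j \<Longrightarrow> j < k \<Longrightarrow> L ! i < L ! j"
  using sorted_wrt_nth_less[OF strict_sorted_list_of_set[of C], of i j] by simp

lemma unrolled_add_k: "unrolled (i + k) = unrolled i + int n"
  unfolding unrolled_def using k_pos by (simp add: algebra_simps)

lemma unrolled_step_eq: "unrolled (Suc i) - unrolled i = int (interdist n C (i mod k))"
proof (cases "i mod k + 1 < k")
  case True
  then have "Suc i mod k = Suc (i mod k)" "Suc i div k = i div k"
    by (auto simp: mod_Suc div_Suc)
  then show ?thesis
    using True L_less[of "i mod k" "Suc (i mod k)"]
    by (simp add: unrolled_def interdist_def homebase_seq_def of_nat_diff)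
next
  case False
  then have e: "Suc (i mod k) = k" using k_pos mod_less_divisor[of k i] by linarith
  then have "Suc i mod k = 0" "Suc i div k = Suc (i div k)"
    by (auto simp: mod_Suc div_Suc)
  moreover have "L ! (i mod k) < n" using C_sub L_nth k_pos by simp
  ultimately show ?thesis
    using e by (simp add: unrolled_def interdist_def homebase_seq_def of_nat_diff algebra_simps)
qed

lemma interdist_pos: "i < k \<Longrightarrow> interdist n C i > 0"
  using L_less[of i "Suc i"] C_sub[OF L_nth, of i]
  unfolding interdist_def homebase_seq_def by auto

lemma unrolled_strict_mono: "strict_mono unrolled"
proof -
  have "unrolled i < unrolled (Suc i)" for i
    using unrolled_step_eq[of i] interdist_pos[of "i mod k"] k_pos by simp
  then show ?thesis by (simp add: strict_mono_Suc_iff)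
qed

lemma unrolled_mod: "unrolled i mod int n = int (L ! (i mod k))"
  unfolding unrolled_def using C_sub[OF L_nth, of "i mod k"] k_pos by simp

lemma range_unrolled: "range unrolled = hset n C \<inter> {0..}"
proof
  show "range unrolled \<subseteq> hset n C \<inter> {0..}"
    using unrolled_mod L_nth k_pos by (auto simp: hset_def) (simp add: unrolled_def)
  show "hset n C \<inter> {0..} \<subseteq> range unrolled"
  proof
    fix x assume x: "x \<in> hset n C \<inter> {0..}"
    then have "nat (x mod int n) \<in> set L" using C_fin by (simp add: hset_def)
    then obtain j where j: "j < k" "L ! j = nat (x mod int n)"
      by (metis in_set_conv_nth length_sorted_list_of_set)
    have "x = unrolled (j + nat (x div int n) * k)"
      using j x n by (simp add: unrolled_def pos_imp_zdiv_nonneg_iff mult.commute)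
    then show "x \<in> range unrolled" by blast
  qed
qed

lemma hset_add: "x + int n * m \<in> hset n C \<longleftrightarrow> x \<in> hset n C"
  by (simp add: hset_def)

lemma unrolled_diff_period:
  assumes "\<And>i. unrolled (Suc (i + p)) - unrolled (i + p) = unrolled (Suc i) - unrolled i"
  shows "unrolled (i + p) = unrolled i + (unrolled p - unrolled 0)"
proof (induction i)
  case (Suc i)
  then show ?case using assms[of i] by simp
qed simp

text \<open>A shift of the indices by \<open>p\<close> adds the constant \<open>t\<close>, the sum
  of one period of interdistances. As \<open>q\<close> periods make up the ring,
  \<open>int n = int q * t\<close>.\<close>

lemma periodic_imp_rotation_symmetric:
  assumes "C \<in> periodic_configurations n"
  shows "rotation_symmetric n (hset n C)"
proof -
  obtain p where p: "p dvd k" "p < k" "\<And>i. i < k \<Longrightarrow> interdist n C i = interdist n C ((i + p) mod k)"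
    using assms unfolding periodic_configurations_def by blast
  have p0: "p > 0" using p(1,2) by (metis dvd_0_left_iff gr0I not_less0)
  obtain q where q: "k = p * q" using p(1) by blast
  have q0: "q > 0" using q k_pos by (metis gr0I mult_0_right less_numeral_extra(3))
  define t where "t = unrolled p - unrolled 0"
  have shift: "unrolled (i + p) = unrolled i + t" for i
  proof -
    have "unrolled (Suc (i + p)) - unrolled (i + p) = unrolled (Suc i) - unrolled i" for i
      using unrolled_step_eq[of i] unrolled_step_eq[of "i + p"] p(3)[of "i mod k"] k_pos
      by (simp add: mod_add_left_eq)
    then show ?thesis unfolding t_def by (rule unrolled_diff_period)
  qed
  have "unrolled (m * p) = unrolled 0 + int m * t" for m
  proof (induction m)
    case (Suc m)
    then show ?case using shift[of "m * p"] by (simp add: algebra_simps)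
  qed simp
  from this[of q] have qt: "int n = int q * t" using unrolled_add_k[of 0] q by (simp add: mult.commute)
  have "0 < t" using strict_monoD[OF unrolled_strict_mono p0] t_def by simp
  moreover have "t < int n"
    using strict_monoD[OF unrolled_strict_mono p(2)] unrolled_add_k[of 0] t_def by simp
  moreover have fwd: "x + t \<in> hset n C" if x: "x \<in> hset n C" for x
  proof -
    \<comment> \<open>\<open>unrolled\<close> reaches nonnegative points only, so \<open>x\<close>
      is first moved up by whole turns.\<close>
    have "x + int n * \<bar>x\<bar> \<ge> 0"
      using n by (smt (verit) mult_le_cancel_right1 of_nat_0_less_iff)
    then have "x + int n * \<bar>x\<bar> \<in> range unrolled"
      using x unfolding range_unrolled by (simp add: hset_add)
    then obtain i where i: "x + int n * \<bar>x\<bar> = unrolled i" by blast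
    have "unrolled (i + p) \<in> hset n C" using range_unrolled by blast
    then show ?thesis using hset_add[of "x + t" "\<bar>x\<bar>"] i shift[of i] by (simp add: algebra_simps)
  qed
  moreover have "x \<in> hset n C" if x: "x + t \<in> hset n C" for x
  proof -
    have "x + t + int m * t \<in> hset n C" for m
    proof (induction m)
      case (Suc m)
      then show ?case using fwd by (fastforce simp: algebra_simps)
    qed (use x in simp)
    \<comment> \<open>Going back by \<open>t\<close> amounts to going forward \<open>q - 1\<close>
      times and then back one whole turn.\<close>
    from this[of "q - 1"] have "x + int q * t \<in> hset n C"
      using q0 by (simp add: of_nat_diff algebra_simps)
    then show ?thesis using hset_add[of x 1] qt by simp
  qed
  ultimately show ?thesis unfolding rotation_symmetric_def by blast
qed

text \<open>The translation maps the increasing enumeration onto one of its tails, so it is an index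
  shift by some \<open>p\<close>, with \<open>p < k\<close> because \<open>t < int n\<close>.
  Passing to \<open>gcd p k\<close> makes the shift a divisor of \<open>k\<close>.\<close>

lemma rotation_symmetric_imp_periodic:
  assumes "rotation_symmetric n (hset n C)"
  shows "C \<in> periodic_configurations n"
proof -
  obtain t where t: "0 < t" "t < int n" and inv: "\<And>x. x + t \<in> hset n C \<longleftrightarrow> x \<in> hset n C"
    using assms unfolding rotation_symmetric_def by blast
  have r: "unrolled i \<in> hset n C" "unrolled i \<ge> unrolled 0" "unrolled i \<ge> 0" for i
    using range_unrolled strict_mono_less_eq[OF unrolled_strict_mono] by blast+
  have least: "unrolled 0 \<le> x" if x: "x \<in> hset n C" "x \<ge> 0" for x
  proof -
    have "x \<in> range unrolled" using x unfolding range_unrolled by simp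
    then show ?thesis using r(2) by blast
  qed
  have "unrolled 0 + t \<in> range unrolled"
    unfolding range_unrolled using r[of 0] inv t by simp
  then obtain p where p: "unrolled p = unrolled 0 + t" by (metis imageE)
  have p0: "p > 0" using p t by (cases p) auto
  have pk: "p < k"
    using p t unrolled_add_k[of 0] strict_mono_less[OF unrolled_strict_mono, of p k] by simp
  have "(\<lambda>i. unrolled (i + p)) = (\<lambda>i. unrolled i + t)"
  proof (rule strict_enumerations_eq)
    show "strict_mono (\<lambda>i. unrolled (i + p))" "strict_mono (\<lambda>i. unrolled i + t)"
      using unrolled_strict_mono by (auto simp: strict_mono_def)
    show "range (\<lambda>i. unrolled (i + p)) = range (\<lambda>i. unrolled i + t)"
    proof
      show "range (\<lambda>i. unrolled (i + p)) \<subseteq> range (\<lambda>i. unrolled i + t)"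
      proof
        fix x assume "x \<in> range (\<lambda>i. unrolled (i + p))"
        then obtain i where i: "x = unrolled (i + p)" by blast
        have "x \<ge> unrolled p" using i strict_mono_less_eq[OF unrolled_strict_mono] by simp
        then have "x - t \<ge> 0" using p r(3)[of 0] by simp
        moreover have "x - t \<in> hset n C" using r(1) i inv[of "x - t"] by simp
        ultimately have "x - t \<in> range unrolled" unfolding range_unrolled by simp
        then obtain j where "x - t = unrolled j" by blast
        then have "x = unrolled j + t" by simp
        then show "x \<in> range (\<lambda>i. unrolled i + t)" by blast
      qed
      show "range (\<lambda>i. unrolled i + t) \<subseteq> range (\<lambda>i. unrolled (i + p))"
      proof
        fix x assume "x \<in> range (\<lambda>i. unrolled i + t)"
        then obtain i where i: "x = unrolled i + t" by blast
        have "x \<in> hset n C" "x \<ge> 0" using inv[of "unrolled i"] r[of i] i t by auto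
        then have "x \<in> range unrolled" unfolding range_unrolled by simp
        then obtain j where j: "x = unrolled j" by blast
        have "unrolled p \<le> unrolled j" using p i j r(2)[of i] by simp
        then have "p \<le> j" using strict_mono_less_eq[OF unrolled_strict_mono] by simp
        then have "x = unrolled ((j - p) + p)" using j by simp
        then show "x \<in> range (\<lambda>i. unrolled (i + p))" by blast
      qed
    qed
  qed
  then have shift: "unrolled (i + p) = unrolled i + t" for i by (rule fun_cong)
  define e where "e i = interdist n C (i mod k)" for i
  have e: "int (e i) = unrolled (Suc i) - unrolled i" for i using unrolled_step_eq e_def by simp
  have "int (e (i + p)) = int (e i)" for i
    using e[of i] e[of "i + p"] shift[of i] shift[of "Suc i"] by simp
  then have "e (i + p) = e i" for i by simp
  moreover have "e (i + k) = e i" for i unfolding e_def by simp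
  ultimately have "e (i + gcd p k) = e i" for i using gcd_period[OF p0] by blast
  then have "\<forall>i<k. interdist n C i = interdist n C ((i + gcd p k) mod k)"
    unfolding e_def by (metis mod_less)
  moreover have "gcd p k < k" using dvd_imp_le[OF gcd_dvd1 p0, of k] pk by simp
  ultimately show ?thesis
    unfolding periodic_configurations_def using C by blast
qed

lemma periodic_iff: "C \<in> periodic_configurations n \<longleftrightarrow> rotation_symmetric n (hset n C)"
  using periodic_imp_rotation_symmetric rotation_symmetric_imp_periodic by blast

end

subsection \<open>The protocol\<close>

text \<open>Offsets are measured from the homebase of the agent, with left as the positive direction;
  \<open>sightings\<close> are the offsets at which homebases were seen.  The counters \<open>along\<close> and \<open>against\<close> refer to
  the agents at the same node whose last choice was what the observer calls left and right.\<close>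

datatype mode = Walking | Unaware | Informed | Approaching | Mover | Waiter | Finished | Symmetric

datatype state = State (clock: nat) (offset: int) (sightings: "int list") (mark: int)
  (crowd: nat) (heading: int) (mode: mode)

instance mode :: countable by countable_datatype
instance state :: countable by countable_datatype

datatype view = View (home: bool) (shift: int) (crosses: bool) (along: nat) (against: nat) (idle: nat)

text \<open>An agent in the incoming buffer of a right port has just moved left, and one in the
  outgoing buffer of a left port has tried to. The buffers thus reveal the last choice of every
  agent present, whether or not it was blocked.\<close>

definition digest :: "observation \<Rightarrow> view" where
  "digest ob = View (homebase ob)
     (case own_place ob of Incoming Right \<Rightarrow> 1 | Incoming Left \<Rightarrow> - 1 | _ \<Rightarrow> 0)
     (crossing ob)
     (others ob (Incoming Right) + others ob (Outgoing Left))
     (others ob (Incoming Left) + others ob (Outgoing Right))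
     (others ob AtNode)"

definition known :: "nat \<Rightarrow> int list \<Rightarrow> int set" where
  "known n hs = {x. \<exists>h\<in>set hs. int n dvd x - h}"

definition homes :: "nat \<Rightarrow> int list \<Rightarrow> nat" where
  "homes n hs = card (known n hs \<inter> {0..<int n})"

text \<open>\<open>y\<close> is the displacement from the center in half edges modulo
  \<open>2 * n\<close>, positive to the agent's left. The residues 0, 1 and \<open>2 * n - 1\<close>
  are a central node and the two ends of a central edge, where the agent rests. At the antipode,
  \<open>y = n\<close>, the tie is broken to the left.\<close>

definition approach :: "nat \<Rightarrow> int \<Rightarrow> int" where
  "approach n y = (if y \<le> 1 \<or> y = 2 * int n - 1 then 0 else if y < int n then - 1 else 1)"

text \<open>An agent at the center leaves it: from an end of a central edge away from that edge,
  from a central node to its own left. Thus central agents that leave in the same direction start at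
  the same node.\<close>

definition departure :: "nat \<Rightarrow> int \<Rightarrow> int" where
  "departure n y = (if y = 2 * int n - 1 then - 1 else if y \<le> 1 then 1 else approach n y)"

definition next_offset :: "view \<Rightarrow> state \<Rightarrow> int" where
  "next_offset v s = offset s + shift v"

definition next_sightings :: "view \<Rightarrow> state \<Rightarrow> int list" where
  "next_sightings v s = (if home v then [next_offset v s] else []) @ sightings s"

definition bearing :: "nat \<Rightarrow> view \<Rightarrow> state \<Rightarrow> int" where
  "bearing n v s = (2 * next_offset v s - center n (known n (next_sightings v s))) mod (2 * int n)"

text \<open>
  The test in round \<open>6 n\<close> has the same outcome for all agents of an orientation class: if the class
  was merged in round \<open>3 n\<close>, then its members progress alike and see a constant crowd; if it merged
  later, then all of them see the crowd grow; if it is not merged, then all of them made a tour.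
  In round \<open>13 n\<close>, the equation \<open>p = mark s\<close> means that the agent was blocked for \<open>n\<close> rounds.
\<close>

definition next_mode :: "nat \<Rightarrow> view \<Rightarrow> state \<Rightarrow> mode" where
  "next_mode n v s =
    (let r = clock s; p = next_offset v s; hs = next_sightings v s in
     if r < 6 * n then Walking
     else if r = 6 * n then (if p - mark s < int n \<and> along v = crowd s then Unaware else Informed)
     else if r \<le> 9 * n \<and> mode s = Unaware \<and> (crosses v \<or> against v > 0) then Finished
     else if r < 9 * n then mode s
     else if r = 9 * n \<and> mode s = Unaware \<and> p - mark s < int n then Finished
     else if mode s = Symmetric then Symmetric
     else if along v + against v + idle v + 1 = homes n hs then Finished
     else if r = 9 * n \<and> rotation_symmetric n (known n hs) then Symmetric
     else if r < 10 * n then Approaching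
     else if r = 10 * n then (if approach n (bearing n v s) = 0 then Mover else Waiter)
     else if crosses v \<or> r = 13 * n \<and> p = mark s \<or> r = 15 * n then Finished
     else if r \<le> 11 * n \<and> idle v > 0 then Waiter
     else mode s)"

text \<open>A newcomer keeps its direction and the waiters that see it arrive adopt it, so the
  enlarged waiting group again has one direction, although the orientations of its members may
  differ.\<close>

definition next_heading :: "nat \<Rightarrow> view \<Rightarrow> state \<Rightarrow> int" where
  "next_heading n v s =
    (let r = clock s in
     if r < 6 * n then 1
     else if r < 9 * n then (if next_mode n v s = Informed then - 1 else 1)
     else if r < 10 * n then approach n (bearing n v s)
     else if r = 10 * n then departure n (bearing n v s)
     else if r \<le> 11 * n \<and> mode s = Waiter \<and> along v > 0 then 1
     else if r \<le> 11 * n \<and> mode s = Waiter \<and> against v > 0 then - 1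
     else if r = 13 * n \<and> mode s = Mover then - heading s
     else heading s)"

text \<open>The rounds \<open>3 n\<close>, \<open>6 n\<close> and \<open>12 n\<close> open the
  intervals over which progress is tested in rounds \<open>6 n\<close>, \<open>9 n\<close> and
  \<open>13 n\<close>.\<close>

definition next_mark :: "nat \<Rightarrow> view \<Rightarrow> state \<Rightarrow> int" where
  "next_mark n v s = (if clock s \<in> {3 * n, 6 * n, 12 * n} then next_offset v s else mark s)"

definition next_crowd :: "nat \<Rightarrow> view \<Rightarrow> state \<Rightarrow> nat" where
  "next_crowd n v s = (if clock s = 3 * n then along v else crowd s)"

definition update :: "nat \<Rightarrow> view \<Rightarrow> state \<Rightarrow> state" where
  "update n v s = State (Suc (clock s)) (next_offset v s) (next_sightings v s)
     (next_mark n v s) (next_crowd n v s) (next_heading n v s) (next_mode n v s)"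

text \<open>Applied to the updated state, whose clock is already one ahead: a waiter rests in the
  rounds below \<open>11 n\<close> and moves from round \<open>11 n\<close> on.\<close>

definition go :: "nat \<Rightarrow> state \<Rightarrow> int" where
  "go n s = (if mode s = Finished \<or> mode s = Symmetric \<or> mode s = Waiter \<and> clock s \<le> 11 * n
             then 0 else sgn (heading s))"

definition to_side :: "int \<Rightarrow> side option" where
  "to_side d = (if d = 0 then None else if d > 0 then Some Left else Some Right)"

definition start :: state where
  "start = State 0 0 [] 0 0 0 Walking"

definition gathering :: "nat \<Rightarrow> state protocol" where
  "gathering n = \<lparr>initial = start, terminal = (\<lambda>s. mode s = Finished),
     periodic_detected = (\<lambda>s. mode s = Symmetric),
     act = (\<lambda>ob s. let s' = update n (digest ob) s in (s', to_side (go n s')))\<rparr>"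

text \<open>The final theorem asks for protocols with memory \<open>nat\<close>; a countable state
  type is carried over by \<open>to_nat\<close>, which leaves the motion unchanged.\<close>

definition encode :: "'m::countable protocol \<Rightarrow> nat protocol" where
  "encode A = \<lparr>initial = to_nat (initial A), terminal = (\<lambda>m. terminal A (from_nat m)),
     periodic_detected = (\<lambda>m. periodic_detected A (from_nat m)),
     act = (\<lambda>ob m. let x = act A ob (from_nat m) in (to_nat (fst x), snd x))\<rparr>"

definition encode_agent :: "'m::countable agent \<Rightarrow> nat agent" where
  "encode_agent g = \<lparr>node = node g, place = place g, crossed = crossed g, mem = to_nat (mem g)\<rparr>"

lemma encode_agent_simps [simp]:
  "node (encode_agent g) = node g" "place (encode_agent g) = place g"
  "crossed (encode_agent g) = crossed g" "mem (encode_agent g) = to_nat (mem g)"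
  by (simp_all add: encode_agent_def)

lemma decide_encode:
  "decide (encode A) C E (\<lambda>a. encode_agent (s a)) a =
     (to_nat (fst (decide A C E s a)), snd (decide A C E s a))"
proof -
  have "observe C E (\<lambda>a. encode_agent (s a)) a = observe C E s a"
    unfolding observe_def by simp
  then show ?thesis unfolding decide_def by (simp add: encode_def Let_def)
qed

lemma run_encode: "run (encode A) n C E r = (\<lambda>a. encode_agent (run A n C E r a))"
proof (induction r)
  case 0
  then show ?case by (simp add: encode_agent_def encode_def)
next
  case (Suc r)
  have "exit_port (encode A) C E (\<lambda>a. encode_agent (s a)) b = exit_port A C E s b" for s b
    unfolding exit_port_def decide_encode by simp
  then show ?case
    unfolding run.simps Suc step_def decide_encode
    by (auto simp: encode_agent_def Let_def split: option.split)
qed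

lemma other_port_neq [simp]: "other_port p \<noteq> p" "p \<noteq> other_port p"
  by (cases p; simp)+

lemma other_port_invol [simp]: "other_port (other_port p) = p"
  by (cases p) auto

lemma port_neq_iff: "p \<noteq> q \<longleftrightarrow> p = other_port q"
  by (cases p; cases q) auto

subsection \<open>Executions on the line covering the ring\<close>

locale execution =
  fixes n :: nat and C :: "nat set" and E :: environment
  assumes n3: "n \<ge> 3" and conf: "C \<in> configurations n" and adm: "admissible n C E"
begin

sublocale configuration n C
  using n3 conf by unfold_locales auto

definition glob :: "nat \<Rightarrow> state global" where
  "glob r = run (gathering n) n C E r"

definition st :: "nat \<Rightarrow> nat \<Rightarrow> state" where
  "st r a = mem (glob r a)"

definition vw :: "nat \<Rightarrow> nat \<Rightarrow> view" where
  "vw r a = digest (observe C E (glob r) a)"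

text \<open>\<open>sg a\<close> is the clockwise sense of the left of \<open>a\<close>, \<open>D r a\<close> the direction (clockwise
  positive) that \<open>a\<close> chooses in round \<open>r\<close>, \<open>V r a\<close> the step it makes, and \<open>P r a\<close> its
  position on the line that covers the ring.\<close>

definition sg :: "nat \<Rightarrow> int" where
  "sg a = (if left_port E a 0 = clockwise_port E 0 then 1 else - 1)"

definition D :: "nat \<Rightarrow> nat \<Rightarrow> int" where
  "D r a = sg a * go n (st (Suc r) a)"

definition port_towards :: "nat \<Rightarrow> int \<Rightarrow> port" where
  "port_towards v d = (if d = 1 then clockwise_port E v else other_port (clockwise_port E v))"

definition V :: "nat \<Rightarrow> nat \<Rightarrow> int" where
  "V r a = (let v = node (glob r a) in
     if missing E r = Some (edge_at n E v (port_towards v (D r a))) then 0 else D r a)"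

definition P :: "nat \<Rightarrow> nat \<Rightarrow> int" where
  "P r a = int a + (\<Sum>i<r. V i a)"

lemma sg: "sg a = 1 \<or> sg a = - 1"
  by (simp add: sg_def)

lemma sg_sq [simp]: "sg a * sg a = 1" "sg a * (sg a * x) = x" "sg a \<noteq> 0"
  using sg[of a] by auto

lemma left_port_eq: "a \<in> C \<Longrightarrow> v < n \<Longrightarrow> left_port E a v = port_towards v (sg a)"
proof -
  assume a: "a \<in> C" and v: "v < n"
  have "(\<forall>i<n. left_port E a i = clockwise_port E i) \<or> (\<forall>i<n. left_port E a i \<noteq> clockwise_port E i)"
    using adm a unfolding admissible_def by blast
  then show ?thesis
    using v n by (auto simp: port_towards_def sg_def port_neq_iff)
qed

lemma go_cases: "go n s = 0 \<or> go n s = 1 \<or> go n s = - 1"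
  by (simp add: go_def sgn_if)

lemma D_cases: "D r a = 0 \<or> D r a = 1 \<or> D r a = - 1"
  using go_cases[of "st (Suc r) a"] sg[of a] by (auto simp: D_def)

lemma st_0: "st 0 a = start"
  by (simp add: st_def glob_def gathering_def)

lemma glob_Suc: "glob (Suc r) = step (gathering n) n C E (missing E r) (glob r)"
  by (simp add: glob_def)

lemma st_Suc_decide: "st (Suc r) a = fst (decide (gathering n) C E (glob r) a)"
  unfolding st_def glob_Suc step_def Let_def by (simp split: option.split)

lemma st_Suc: "st (Suc r) a = (if mode (st r a) = Finished then st r a else update n (vw r a) (st r a))"
  unfolding st_Suc_decide by (simp add: decide_def gathering_def Let_def st_def vw_def)

text \<open>A terminated agent keeps its state, for which \<open>go\<close> is 0, so the direction
  can be read off the next state in all cases.\<close>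

lemma snd_decide: "snd (decide (gathering n) C E (glob r) a) = to_side (go n (st (Suc r) a))"
  unfolding st_Suc_decide
  by (simp add: decide_def gathering_def Let_def st_def go_def to_side_def sgn_if)

lemma exit_port_eq:
  assumes a: "a \<in> C" and v: "node (glob r a) < n"
  shows "exit_port (gathering n) C E (glob r) a =
    (if D r a = 0 then None else Some (port_towards (node (glob r a)) (D r a)))"
  using go_cases[of "st (Suc r) a"] sg[of a] left_port_eq[OF a v]
  unfolding exit_port_def snd_decide
  by (auto simp: to_side_def D_def port_on_def port_towards_def)

lemma neighbour_eq:
  assumes "d = 1 \<or> d = - 1"
  shows "int (neighbour n E v (port_towards v d)) = (int v + d) mod int n"
proof -
  have "int ((v + n - Suc 0) mod n) = (int v + int n - 1) mod int n"
    using n by (simp add: of_nat_mod of_nat_diff)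
  also have "\<dots> = (int v - 1) mod int n"
    by (metis add_diff_eq diff_add_eq mod_add_self2)
  finally show ?thesis
    using assms by (auto simp: neighbour_def port_towards_def of_nat_mod add.commute)
qed

lemma edge_eq:
  assumes "d = 1 \<or> d = - 1" and v: "v < n"
  shows "int (edge_at n E v (port_towards v d)) = (int v + (if d = 1 then 0 else - 1)) mod int n"
  using neighbour_eq[of "- 1" v] assms
  by (auto simp: edge_at_def neighbour_def port_towards_def)

lemma far_port_eq:
  assumes "d = 1 \<or> d = - 1"
  shows "far_port n E v (port_towards v d) = port_towards (neighbour n E v (port_towards v d)) (- d)"
  using assms by (auto simp: far_port_def port_towards_def)

lemma port_towards_inj:
  "d = 1 \<or> d = - 1 \<Longrightarrow> d' = 1 \<or> d' = - 1 \<Longrightarrow> port_towards v d = port_towards v d' \<longleftrightarrow> d = d'"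
  by (auto simp: port_towards_def)

lemma P_0 [simp]: "P 0 a = int a"
  by (simp add: P_def)

lemma P_Suc: "P (Suc r) a = P r a + V r a"
  by (simp add: P_def)

lemma V_cases: "V r a = 0 \<or> V r a = D r a"
  by (simp add: V_def Let_def)

lemma agent_Suc:
  assumes a: "a \<in> C" and v: "int (node (glob r a)) = P r a mod int n"
  shows "int (node (glob (Suc r) a)) = P (Suc r) a mod int n"
    "place (glob (Suc r) a) = (if D r a = 0 then AtNode
        else if V r a = 0 then Outgoing (port_towards (node (glob (Suc r) a)) (D r a))
        else Incoming (port_towards (node (glob (Suc r) a)) (- D r a)))"
    "crossed (glob (Suc r) a) \<longleftrightarrow> V r a \<noteq> 0 \<and> (\<exists>b\<in>C. int (node (glob r b)) = (P r a + V r a) mod int n \<and>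
        exit_port (gathering n) C E (glob r) b = Some (port_towards (node (glob r b)) (- D r a)))"
proof -
  have vn: "node (glob r a) < n" using v n
    by (metis of_nat_0_less_iff of_nat_less_iff pos_mod_bound)
  note ep = exit_port_eq[OF a vn]
  note D = D_cases[of r a]
  have nb: "int (neighbour n E (node (glob r a)) (port_towards (node (glob r a)) (D r a))) = (P r a + D r a) mod int n"
    if "D r a \<noteq> 0"
    using neighbour_eq[of "D r a" "node (glob r a)"] D that v by (auto simp: mod_simps)
  show "int (node (glob (Suc r) a)) = P (Suc r) a mod int n"
    unfolding glob_Suc step_def Let_def ep
    using v nb by (auto simp: P_Suc V_def Let_def)
  show "place (glob (Suc r) a) = (if D r a = 0 then AtNode
        else if V r a = 0 then Outgoing (port_towards (node (glob (Suc r) a)) (D r a))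
        else Incoming (port_towards (node (glob (Suc r) a)) (- D r a)))"
    unfolding glob_Suc step_def Let_def ep
    using far_port_eq[of "D r a" "node (glob r a)"] D by (auto simp: V_def Let_def)
  show "crossed (glob (Suc r) a) \<longleftrightarrow> V r a \<noteq> 0 \<and> (\<exists>b\<in>C. int (node (glob r b)) = (P r a + V r a) mod int n \<and>
        exit_port (gathering n) C E (glob r) b = Some (port_towards (node (glob r b)) (- D r a)))"
  proof (cases "V r a = 0")
    case True
    then show ?thesis unfolding glob_Suc step_def Let_def ep by (auto simp: V_def Let_def)
  next
    case False
    then have D0: "D r a \<noteq> 0" and VD: "V r a = D r a" using V_cases[of r a] by auto
    let ?u = "neighbour n E (node (glob r a)) (port_towards (node (glob r a)) (D r a))"
    have e: "crossed (glob (Suc r) a) \<longleftrightarrow> (\<exists>b\<in>C. node (glob r b) = ?u \<and>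
        exit_port (gathering n) C E (glob r) b = Some (port_towards ?u (- D r a)))"
      unfolding glob_Suc step_def Let_def ep
      using far_port_eq[of "D r a" "node (glob r a)"] D D0 False by (auto simp: V_def Let_def)
    have "node (glob r b) = ?u \<longleftrightarrow> int (node (glob r b)) = (P r a + V r a) mod int n" for b
      using nb[OF D0] VD by (metis of_nat_eq_iff)
    then show ?thesis using e False by metis
  qed
qed

lemma node_eq: "a \<in> C \<Longrightarrow> int (node (glob r a)) = P r a mod int n"
proof (induction r)
  case 0
  then show ?case using C_sub by (simp add: glob_def)
next
  case (Suc r)
  then show ?case using agent_Suc(1) by blast
qed

lemma node_less: "a \<in> C \<Longrightarrow> node (glob r a) < n"
  using node_eq n by (metis of_nat_0_less_iff of_nat_less_iff pos_mod_bound)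

lemma same_node: "a \<in> C \<Longrightarrow> b \<in> C \<Longrightarrow> node (glob r b) = node (glob r a) \<longleftrightarrow> int n dvd P r b - P r a"
  using node_eq[of a r] node_eq[of b r] by (metis mod_eq_dvd_iff of_nat_eq_iff)

text \<open>The edge used from position \<open>p\<close> is \<open>p\<close> when going clockwise
  and \<open>p - 1\<close> when going counterclockwise, modulo \<open>n\<close>.\<close>

lemma V_zero_iff:
  assumes a: "a \<in> C" and D: "D r a \<noteq> 0"
  shows "V r a = 0 \<longleftrightarrow> (\<exists>e. missing E r = Some e \<and> e < n \<and>
     int n dvd P r a + (if D r a = 1 then 0 else - 1) - int e)"
proof -
  have e: "int (edge_at n E (node (glob r a)) (port_towards (node (glob r a)) (D r a))) =
      (P r a + (if D r a = 1 then 0 else - 1)) mod int n" (is "int ?e = ?x mod _")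
    using edge_eq[OF _ node_less[OF a], of "D r a" r] D D_cases[of r a] node_eq[OF a, of r]
    by (auto simp: mod_simps)
  have le: "missing E r = Some e \<Longrightarrow> e < n" for e using adm unfolding admissible_def by blast
  have "e = ?e \<longleftrightarrow> int n dvd ?x - int e" if "e < n" for e
  proof -
    have "e = ?e \<longleftrightarrow> int e mod int n = ?x mod int n"
      using that e by (metis mod_pos_pos_trivial of_nat_0_le_iff of_nat_eq_iff of_nat_less_iff)
    then show ?thesis by (metis mod_eq_dvd_iff)
  qed
  then have "missing E r = Some ?e \<longleftrightarrow> (\<exists>e. missing E r = Some e \<and> e < n \<and> int n dvd ?x - int e)"
    using le by blast
  then show ?thesis using D by (simp add: V_def Let_def)
qed

text \<open>Both agents need the one missing edge, from the same end or from opposite ends.\<close>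

lemma both_blocked:
  assumes "a \<in> C" "b \<in> C" "D r a \<noteq> 0" "D r b \<noteq> 0" "V r a = 0" "V r b = 0"
  shows "D r a = D r b \<and> int n dvd P r b - P r a \<or>
    D r b = - D r a \<and> int n dvd P r b - P r a - D r a"
proof -
  obtain e where e: "int n dvd P r a + (if D r a = 1 then 0 else - 1) - int e"
    "int n dvd P r b + (if D r b = 1 then 0 else - 1) - int e"
    using V_zero_iff[of a r] V_zero_iff[of b r] assms by auto
  have "int n dvd (P r b + (if D r b = 1 then 0 else - 1) - int e) -
      (P r a + (if D r a = 1 then 0 else - 1) - int e)"
    using e by (rule dvd_diff[rotated])
  then show ?thesis
    using D_cases[of r a] D_cases[of r b] assms(3,4) by (auto simp: algebra_simps)
qed

lemma same_V:
  assumes "a \<in> C" "b \<in> C" "D r a = D r b" "int n dvd P r b - P r a"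
  shows "V r a = V r b"
proof -
  have "node (glob r b) = node (glob r a)" using assms same_node by blast
  then show ?thesis using assms(3) by (simp add: V_def Let_def)
qed

text \<open>Both agents want the same edge, which is missing for both or for neither.\<close>

lemma facing_V:
  assumes a: "a \<in> C" and b: "b \<in> C" and D: "D r b = - D r a" and f: "int n dvd P r b - P r a - D r a"
  shows "V r b = - V r a"
proof (cases "D r a = 0")
  case True
  then show ?thesis using V_cases[of r a] V_cases[of r b] D by auto
next
  case False
  have "int n dvd P r a + (if D r a = 1 then 0 else - 1) - x \<longleftrightarrow>
      int n dvd P r b + (if D r b = 1 then 0 else - 1) - x" for x
  proof -
    have e: "P r b + (if D r b = 1 then 0 else - 1) - x =
        (P r b - P r a - D r a) + (P r a + (if D r a = 1 then 0 else - 1) - x)"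
      using D D_cases[of r a] False by auto
    show ?thesis unfolding e by (rule dvd_add_right_iff[OF f, symmetric])
  qed
  then have "V r a = 0 \<longleftrightarrow> V r b = 0"
    unfolding V_zero_iff[OF a False] using V_zero_iff[OF b, of r] D False by simp
  then show ?thesis using V_cases[of r a] V_cases[of r b] D by auto
qed

lemma home_vw: "a \<in> C \<Longrightarrow> home (vw r a) \<longleftrightarrow> P r a \<in> hset n C"
  using node_eq[of a r] by (simp add: vw_def digest_def observe_def Let_def hset_def) (metis nat_int)

lemma side_of_towards:
  "a \<in> C \<Longrightarrow> v < n \<Longrightarrow> d = 1 \<or> d = - 1 \<Longrightarrow>
    side_of E a v (port_towards v d) = (if d = sg a then Left else Right)"
  using left_port_eq[of a v] sg[of a] by (auto simp: side_of_def port_towards_def)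

lemma view_place:
  assumes a: "a \<in> C" and b: "b \<in> C" and v: "node (glob (Suc r) b) = v"
  shows "map_place (side_of E a v) (place (glob (Suc r) b)) =
    (if D r b = 0 then AtNode
     else if V r b = 0 then Outgoing (if D r b = sg a then Left else Right)
     else Incoming (if D r b = sg a then Right else Left))"
proof -
  have "v < n" using node_less[OF b] v by blast
  then show ?thesis
    using agent_Suc(2)[OF b node_eq[OF b]] side_of_towards[OF a] D_cases[of r b] sg[of a] v
    by auto
qed

lemma shift_vw_0: "shift (vw 0 a) = 0"
  by (simp add: vw_def digest_def observe_def Let_def glob_def)

lemma shift_vw:
  assumes a: "a \<in> C"
  shows "shift (vw (Suc r) a) = sg a * V r a"
  using view_place[OF a a refl, of r] V_cases[of r a] D_cases[of r a] sg[of a]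
  by (auto simp: vw_def digest_def observe_def Let_def)

text \<open>\<open>step\<close> only records that another agent chose the edge in the opposite
  direction; since the edge was present, that agent did traverse it.\<close>

lemma crosses_vw:
  assumes a: "a \<in> C"
  shows "crosses (vw (Suc r) a) \<longleftrightarrow> V r a \<noteq> 0 \<and> (\<exists>b\<in>C. V r b = - V r a \<and> int n dvd P r b - P r a - V r a)"
proof -
  have "int (node (glob r b)) = (P r a + V r a) mod int n \<longleftrightarrow> int n dvd P r b - P r a - V r a"
    if "b \<in> C" for b
    using node_eq[OF that] by (simp add: mod_eq_dvd_iff diff_diff_eq)
  moreover have "exit_port (gathering n) C E (glob r) b = Some (port_towards (node (glob r b)) (- D r a))
      \<longleftrightarrow> V r b = - V r a" 
    if b: "b \<in> C" "V r a \<noteq> 0" "int n dvd P r b - P r a - V r a" for b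
  proof -
    have VD: "V r a = D r a" "D r a \<noteq> 0" using that V_cases[of r a] by auto
    have "exit_port (gathering n) C E (glob r) b = Some (port_towards (node (glob r b)) (- D r a))
        \<longleftrightarrow> D r b = - D r a"
      unfolding exit_port_eq[OF b(1) node_less[OF b(1)]]
      using port_towards_inj[of "D r b" "- D r a"] VD D_cases[of r a] D_cases[of r b] by auto
    then show ?thesis using facing_V[OF a b(1)] b(3) VD V_cases[of r b] by auto
  qed
  ultimately show ?thesis
    using agent_Suc(3)[OF a node_eq[OF a], of r]
    by (auto simp: vw_def digest_def observe_def Let_def)
qed

definition mates :: "nat \<Rightarrow> nat \<Rightarrow> nat set" where
  "mates r a = {b \<in> C. b \<noteq> a \<and> int n dvd P r b - P r a}"

lemma finite_mates [simp]: "finite (mates r a)"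
  using C_fin by (simp add: mates_def)

lemma others_vw:
  assumes a: "a \<in> C"
  shows "others (observe C E (glob (Suc r)) a) x = card {b \<in> mates (Suc r) a.
    (if D r b = 0 then AtNode
     else if V r b = 0 then Outgoing (if D r b = sg a then Left else Right)
     else Incoming (if D r b = sg a then Right else Left)) = x}"
proof -
  have "{b \<in> C. b \<noteq> a \<and> node (glob (Suc r) b) = node (glob (Suc r) a) \<and>
      map_place (side_of E a (node (glob (Suc r) a))) (place (glob (Suc r) b)) = x} =
      {b \<in> mates (Suc r) a. (if D r b = 0 then AtNode
       else if V r b = 0 then Outgoing (if D r b = sg a then Left else Right)
       else Incoming (if D r b = sg a then Right else Left)) = x}"
    unfolding mates_def using same_node[OF a] view_place[OF a] by auto
  then show ?thesis by (simp add: observe_def Let_def)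
qed

lemma
  assumes a: "a \<in> C"
  shows along_vw: "along (vw (Suc r) a) = card {b \<in> mates (Suc r) a. D r b = sg a}"
    and against_vw: "against (vw (Suc r) a) = card {b \<in> mates (Suc r) a. D r b = - sg a}"
    and idle_vw: "idle (vw (Suc r) a) = card {b \<in> mates (Suc r) a. D r b = 0}"
proof -
  let ?pl = "\<lambda>b. if D r b = 0 then AtNode
     else if V r b = 0 then Outgoing (if D r b = sg a then Left else Right)
     else Incoming (if D r b = sg a then Right else Left)"
  have pl: "?pl b = Incoming Right \<longleftrightarrow> D r b = sg a \<and> V r b \<noteq> 0"
    "?pl b = Outgoing Left \<longleftrightarrow> D r b = sg a \<and> V r b = 0"
    "?pl b = Incoming Left \<longleftrightarrow> D r b = - sg a \<and> V r b \<noteq> 0"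
    "?pl b = Outgoing Right \<longleftrightarrow> D r b = - sg a \<and> V r b = 0"
    "?pl b = AtNode \<longleftrightarrow> D r b = 0" for b
    using D_cases[of r b] sg[of a] by auto
  have split: "card {b \<in> mates (Suc r) a. D r b = d \<and> V r b \<noteq> 0} +
      card {b \<in> mates (Suc r) a. D r b = d \<and> V r b = 0} = card {b \<in> mates (Suc r) a. D r b = d}" for d
    by (subst card_Un_disjoint[symmetric]) (auto intro!: arg_cong[where f = card])
  show "along (vw (Suc r) a) = card {b \<in> mates (Suc r) a. D r b = sg a}"
    unfolding vw_def digest_def view.sel others_vw[OF a] pl by (rule split)
  show "against (vw (Suc r) a) = card {b \<in> mates (Suc r) a. D r b = - sg a}"
    unfolding vw_def digest_def view.sel others_vw[OF a] pl by (rule split)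
  show "idle (vw (Suc r) a) = card {b \<in> mates (Suc r) a. D r b = 0}"
    unfolding vw_def digest_def view.sel others_vw[OF a] pl by (rule refl)
qed

lemma total_vw:
  assumes a: "a \<in> C"
  shows "along (vw (Suc r) a) + against (vw (Suc r) a) + idle (vw (Suc r) a) + 1 = k \<longleftrightarrow>
    (\<forall>b\<in>C. int n dvd P (Suc r) b - P (Suc r) a)"
proof -
  let ?M = "mates (Suc r) a"
  have U: "?M = {b \<in> ?M. D r b = sg a} \<union> {b \<in> ?M. D r b = - sg a} \<union> {b \<in> ?M. D r b = 0}"
    using D_cases[of r] sg[of a] by fastforce
  have M: "card ?M = along (vw (Suc r) a) + against (vw (Suc r) a) + idle (vw (Suc r) a)"
    unfolding along_vw[OF a] against_vw[OF a] idle_vw[OF a]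
    apply (subst U)
    using sg[of a] by (subst card_Un_disjoint; (auto intro!: card_Un_disjoint)?)+
  have sub: "?M \<subseteq> C - {a}" by (auto simp: mates_def)
  have "card ?M + 1 = k \<longleftrightarrow> card ?M = card (C - {a})"
    using card_Suc_Diff1[OF C_fin a] by linarith
  also have "\<dots> \<longleftrightarrow> ?M = C - {a}"
  proof
    assume "card ?M = card (C - {a})"
    then show "?M = C - {a}" using card_subset_eq[OF _ sub] C_fin by blast
  qed simp
  also have "\<dots> \<longleftrightarrow> (\<forall>b\<in>C. int n dvd P (Suc r) b - P (Suc r) a)"
  proof
    assume "?M = C - {a}"
    then have "b \<in> C \<Longrightarrow> b \<noteq> a \<Longrightarrow> int n dvd P (Suc r) b - P (Suc r) a" for b
      unfolding mates_def by blast
    then show "\<forall>b\<in>C. int n dvd P (Suc r) b - P (Suc r) a" by (metis cancel_comm_monoid_add_class.diff_cancel dvd_0_right)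
  next
    assume "\<forall>b\<in>C. int n dvd P (Suc r) b - P (Suc r) a"
    then show "?M = C - {a}" unfolding mates_def by blast
  qed
  finally show ?thesis using M by simp
qed

end

section \<open>Relative motion of two agents\<close>

text \<open>To change its quotient by \<open>N\<close>, a unit step has to enter or leave a multiple
  of \<open>N\<close>. Applied to the distance of two agents, these multiples are the
  meetings.\<close>

lemma div_stable:
  fixes x y N :: int
  assumes N: "N > 0" and xy: "\<bar>x - y\<bar> \<le> 1" and x: "\<not> N dvd x" and y: "\<not> N dvd y"
  shows "x div N = y div N"
proof -
  have aux: "(x + 1) div N = x div N" if "\<not> N dvd x + 1" for x :: int
  proof (rule int_div_pos_eq)
    show e: "x + 1 = N * (x div N) + (x mod N + 1)" by simp
    have "x mod N + 1 \<noteq> N"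
    proof
      assume "x mod N + 1 = N"
      then have "x + 1 = N * (x div N) + N" using e by linarith
      then have "N dvd x + 1" by (metis dvd_add_triv_right_iff dvd_triv_left)
      then show False using that by simp
    qed
    then show "x mod N + 1 < N" using pos_mod_bound[OF N, of x] by linarith
    show "0 \<le> x mod N + 1" using N by (simp add: add_increasing2)
  qed
  consider "x = y" | "x = y + 1" | "y = x + 1" using xy by linarith
  then show ?thesis using aux[of x] aux[of y] x y by cases auto
qed

context execution
begin

abbreviation "N \<equiv> int n"

lemma V_bound: "\<bar>V r a\<bar> \<le> 1"
  using V_cases[of r a] D_cases[of r a] by auto

lemma merged_stays:
  assumes "a \<in> C" "b \<in> C" "t \<le> u" "\<And>r. t \<le> r \<Longrightarrow> r < u \<Longrightarrow> D r a = D r b" "N dvd P t b - P t a"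
  shows "P u b - P u a = P t b - P t a"
  using assms(3,4)
proof (induction u rule: dec_induct)
  case (step u)
  then have "P u b - P u a = P t b - P t a" by simp
  then have "V u a = V u b" using same_V[OF assms(1,2)] step assms(5) by simp
  then show ?case using step by (simp add: P_Suc)
qed simp

text \<open>In each round at least one of the two agents makes a step in its direction.\<close>

lemma joint_progress:
  assumes a: "a \<in> C" and b: "b \<in> C" and tu: "t \<le> u" and d: "d = 1 \<or> d = - 1" and e: "e = 1 \<or> e = - 1"
    and Da: "\<And>r. t \<le> r \<Longrightarrow> r < u \<Longrightarrow> D r a = d" and Db: "\<And>r. t \<le> r \<Longrightarrow> r < u \<Longrightarrow> D r b = e"
    and free: "\<And>r. t \<le> r \<Longrightarrow> r < u \<Longrightarrow> \<not> (V r a = 0 \<and> V r b = 0)"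
  shows "d * (P u a - P t a) + e * (P u b - P t b) \<ge> int (u - t)"
  using tu Da Db free
proof (induction u rule: dec_induct)
  case (step u)
  have "d * V u a + e * V u b \<ge> 1"
    using V_cases[of u a] V_cases[of u b] step(4)[of u] step(5)[of u] step(6)[of u] step(1) d e by auto
  moreover have "d * (P u a - P t a) + e * (P u b - P t b) \<ge> int (u - t)"
    using step by simp
  ultimately show ?case using step(1) by (simp add: P_Suc algebra_simps Suc_diff_le)
qed simp

text \<open>Agents blocked together in the same direction are at the same node, so unmerged ones
  jointly gain at least \<open>u - t\<close>. Their distance never meets a multiple of
  \<open>N\<close>: its residue stays in \<open>1 .. N - 1\<close>, so the gains of the two differ
  by at most \<open>N - 2\<close>, and each has about half of the joint gain.\<close>

lemma one_direction:
  assumes a: "a \<in> C" and b: "b \<in> C" and tu: "t \<le> u" and d: "d = 1 \<or> d = - 1"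
    and Da: "\<And>r. t \<le> r \<Longrightarrow> r < u \<Longrightarrow> D r a = d" and Db: "\<And>r. t \<le> r \<Longrightarrow> r < u \<Longrightarrow> D r b = d"
    and apart: "\<not> N dvd P u b - P u a"
  shows "2 * (d * (P u a - P t a)) \<ge> int (u - t) - N + 2"
proof -
  define f where "f r = P r b - P r a" for r
  have apart': "\<not> N dvd f r" if "t \<le> r" "r \<le> u" for r
  proof
    assume "N dvd f r"
    then have "f u = f r"
      unfolding f_def using merged_stays[OF a b that(2)] Da Db that by simp
    then show False using apart \<open>N dvd f r\<close> unfolding f_def by simp
  qed
  have V: "V r a = 0 \<or> V r a = d" "V r b = 0 \<or> V r b = d" if "t \<le> r" "r < u" for r
    using V_cases[of r a] V_cases[of r b] Da Db that by auto
  have "r \<le> u \<longrightarrow> f r div N = f t div N" if "t \<le> r" for r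
    using that
  proof (induction rule: dec_induct)
    case (step r)
    show ?case
    proof
    assume r: "Suc r \<le> u"
    have "f (Suc r) div N = f r div N"
    proof (rule div_stable)
      show "\<bar>f (Suc r) - f r\<bar> \<le> 1" using V[of r] step r d by (auto simp: f_def P_Suc)
    qed (use n apart' step r in auto)
    then show "f (Suc r) div N = f t div N" using step r by simp
    qed
  qed simp
  then have div: "f u div N = f t div N" using tu by blast
  have progress: "d * (P u a - P t a) + d * (P u b - P t b) \<ge> int (u - t)"
  proof (rule joint_progress[OF a b tu d d Da Db])
    show "\<not> (V r a = 0 \<and> V r b = 0)" if "t \<le> r" "r < u" for r
      using both_blocked[OF a b, of r] Da[of r] Db[of r] d apart'[of r] that by (auto simp: f_def)
  qed
  have "f u mod N \<noteq> 0" "f t mod N \<noteq> 0" using apart' tu by auto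
  moreover have "0 \<le> f u mod N" "f u mod N < N" "0 \<le> f t mod N" "f t mod N < N" using n by auto
  moreover have "f u - f t = f u mod N - f t mod N"
    using div minus_div_mult_eq_mod[of "f u" N] minus_div_mult_eq_mod[of "f t" N] by simp
  ultimately have "\<bar>f u - f t\<bar> \<le> N - 2" by linarith
  then have "\<bar>d * (P u b - P t b) - d * (P u a - P t a)\<bar> \<le> N - 2"
    using d by (auto simp: f_def)
  then show ?thesis using progress by linarith
qed

text \<open>\<open>G\<close> is the clockwise distance from \<open>a\<close> to \<open>b\<close>,
  lifted to the integers. While it exceeds 1, the agents are not at the two ends of one edge, so at
  least one of them moves. A step from 2 to 0 would be a meeting, and leaving 1 would be a
  crossing.\<close>

lemma facing:
  assumes a: "a \<in> C" and b: "b \<in> C"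
    and Da: "\<And>r. t \<le> r \<Longrightarrow> r < u \<Longrightarrow> D r a = 1" and Db: "\<And>r. t \<le> r \<Longrightarrow> r < u \<Longrightarrow> D r b = - 1"
    and no_meet: "\<And>r. t < r \<Longrightarrow> r \<le> u \<Longrightarrow> \<not> N dvd P r b - P r a"
    and no_cross: "\<And>r. t \<le> r \<Longrightarrow> r < u \<Longrightarrow> V r a = 1 \<Longrightarrow> V r b = - 1 \<Longrightarrow> \<not> N dvd P r b - P r a - 1"
    and g: "1 \<le> g" "g \<le> N" "N dvd P t b - P t a - g"
    and r: "t \<le> r" "r \<le> u"
  defines "G \<equiv> \<lambda>r. g + (P r b - P t b) - (P r a - P t a)"
  shows "1 \<le> G r \<and> (G r = 1 \<or> G r \<le> N - int (r - t)) \<and> N dvd P r b - P r a - G r"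
  using r
proof (induction rule: dec_induct)
  case base
  then show ?case using g by (simp add: G_def)
next
  case (step r)
  then have IH: "1 \<le> G r" "G r = 1 \<or> G r \<le> N - int (r - t)" "N dvd P r b - P r a - G r" by auto
  have V: "V r a = 0 \<or> V r a = 1" "V r b = 0 \<or> V r b = - 1"
    using V_cases[of r a] V_cases[of r b] Da[of r] Db[of r] step by auto
  have S: "G (Suc r) = G r + V r b - V r a" by (simp add: G_def P_Suc)
  have "P (Suc r) b - P (Suc r) a - G (Suc r) = P r b - P r a - G r" by (simp add: S P_Suc)
  then have dv: "N dvd P (Suc r) b - P (Suc r) a - G (Suc r)" using IH(3) by simp
  show ?case
  proof (cases "G r = 1")
    case True
    then have "N dvd P r b - P r a - 1" using IH by simp
    then have "V r b = - V r a" using facing_V[OF a b] Da[of r] Db[of r] step by simp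
    then have "V r a = 0 \<and> V r b = 0"
      using no_cross[of r] V \<open>N dvd P r b - P r a - 1\<close> step by auto
    then show ?thesis using S dv True by simp
  next
    case False
    then have G: "2 \<le> G r" "G r \<le> N - int (r - t)" using IH by auto
    have "\<not> (V r a = 0 \<and> V r b = 0)"
    proof
      assume "V r a = 0 \<and> V r b = 0"
      then have "N dvd P r b - P r a - 1"
        using both_blocked[OF a b, of r] Da[of r] Db[of r] step by auto
      then have "N dvd (P r b - P r a - 1) - (P r b - P r a - G r)" using IH(3) by (rule dvd_diff)
      then have "N dvd G r - 1" by simp
      then show False using zdvd_imp_le[of N "G r - 1"] G by simp
    qed
    moreover have "G (Suc r) \<noteq> 0"
      using dv no_meet[of "Suc r"] step by auto
    ultimately show ?thesis using S V G dv by (auto simp: Suc_diff_le step)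
  qed
qed

section \<open>What an agent knows after a tour, and success\<close>

text \<open>Every residue has been visited, so the sightings are complete.\<close>

definition knows :: "nat \<Rightarrow> nat \<Rightarrow> bool" where
  "knows r a \<longleftrightarrow> (\<forall>x. \<exists>i\<le>r. N dvd P i a - x)"

lemma knows_mono: "knows r a \<Longrightarrow> r \<le> r' \<Longrightarrow> knows r' a"
  unfolding knows_def by (meson order_trans)

text \<open>Positions change by at most 1 per round, so a net displacement of \<open>N\<close>
  passes every residue.\<close>

lemma tour_knows:
  assumes tu: "t \<le> u" and d: "d = 1 \<or> d = - 1" and far: "d * (P u a - P t a) \<ge> N"
  shows "knows u a"
  unfolding knows_def
proof
  fix x
  define m where "m = (d * (x - P t a)) mod N"
  have m: "0 \<le> m" "m < N" using n by (auto simp: m_def)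
  have "\<exists>i. t \<le> i \<and> i \<le> u \<and> d * (P i a - P t a) = m"
  proof (rule nat_intermed_int_val)
    show "\<forall>i. t \<le> i \<and> i < u \<longrightarrow> \<bar>d * (P (Suc i) a - P t a) - d * (P i a - P t a)\<bar> \<le> 1"
      using V_bound d by (auto simp: P_Suc algebra_simps)
  qed (use tu m far in auto)
  then obtain i where i: "i \<le> u" "d * (P i a - P t a) = m" by blast
  have "N dvd d * (x - P t a) - m" unfolding m_def by (rule dvd_minus_mod)
  then have "N dvd d * (x - P i a)" using i(2) by (simp add: algebra_simps)
  then have "N dvd P i a - x" using d by (auto simp: dvd_diff_commute)
  then show "\<exists>i\<le>u. N dvd P i a - x" using i by blast
qed

definition alive :: "nat \<Rightarrow> bool" where
  "alive r \<longleftrightarrow> (\<forall>a\<in>C. mode (st r a) \<noteq> Finished)"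

lemma alive_0: "alive 0"
  by (simp add: alive_def st_0 start_def)

lemma alive_Suc: "alive (Suc r) \<Longrightarrow> alive r"
  by (auto simp: alive_def st_Suc split: if_splits)

lemma alive_mono: "alive r \<Longrightarrow> r' \<le> r \<Longrightarrow> alive r'"
proof (induction r)
  case (Suc r)
  then show ?case using alive_Suc by (cases "r' = Suc r") auto
qed simp

lemma st_alive: "alive r \<Longrightarrow> a \<in> C \<Longrightarrow> st (Suc r) a = update n (vw r a) (st r a)"
  by (simp add: st_Suc alive_def)

lemma clock_st: "alive r \<Longrightarrow> a \<in> C \<Longrightarrow> clock (st r a) = r"
proof (induction r)
  case 0
  then show ?case by (simp add: st_0 start_def)
next
  case (Suc r)
  then show ?case using alive_Suc by (simp add: st_alive update_def)
qed

lemma next_offset_st: "alive r \<Longrightarrow> a \<in> C \<Longrightarrow> next_offset (vw r a) (st r a) = sg a * (P r a - int a)"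
proof (induction r)
  case 0
  then show ?case by (simp add: next_offset_def st_0 start_def shift_vw_0)
next
  case (Suc r)
  then have "offset (st (Suc r) a) = sg a * (P r a - int a)"
    using alive_Suc by (simp add: st_alive update_def)
  then show ?case
    using Suc.prems by (simp add: next_offset_def shift_vw P_Suc algebra_simps)
qed

lemma next_sightings_st:
  "alive r \<Longrightarrow> a \<in> C \<Longrightarrow> set (next_sightings (vw r a) (st r a)) =
     (\<lambda>i. sg a * (P i a - int a)) ` {i. i \<le> r \<and> P i a \<in> hset n C}"
proof (induction r)
  case 0
  have "{i. i \<le> 0 \<and> P i a \<in> hset n C} = (if P 0 a \<in> hset n C then {0} else {})" by auto
  then show ?case
    using 0 next_offset_st[OF 0] by (simp add: next_sightings_def st_0 start_def home_vw)
next
  case (Suc r)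
  then have "set (sightings (st (Suc r) a)) = (\<lambda>i. sg a * (P i a - int a)) ` {i. i \<le> r \<and> P i a \<in> hset n C}"
    using alive_Suc by (simp add: st_alive update_def)
  moreover have "{i. i \<le> Suc r \<and> P i a \<in> hset n C} = {i. i \<le> r \<and> P i a \<in> hset n C} \<union>
      (if P (Suc r) a \<in> hset n C then {Suc r} else {})"
    by (auto simp: le_Suc_eq)
  ultimately show ?case
    using Suc.prems next_offset_st[OF Suc.prems]
    by (auto simp: next_sightings_def home_vw)
qed

lemma hset_cong: "N dvd x - y \<Longrightarrow> x \<in> hset n C \<longleftrightarrow> y \<in> hset n C"
  by (simp add: hset_def mod_eq_dvd_iff[symmetric])

text \<open>Position \<open>p\<close> has offset \<open>sg a * (p - a)\<close> in the frame of
  \<open>a\<close>. So the complete records of different agents are images of one set under dihedral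
  maps, as \<open>equivariant\<close> requires.\<close>

lemma known_st:
  assumes "alive r" "a \<in> C" "knows r a"
  shows "known n (next_sightings (vw r a) (st r a)) = dihedral (sg a) (- sg a * int a) (hset n C)"
proof (rule set_eqI)
  fix x
  have r: "N dvd x - sg a * (P i a - int a) \<longleftrightarrow> N dvd P i a - (sg a * x + int a)" for i
    using sg[of a] by (auto simp: algebra_simps)
  have "x \<in> known n (next_sightings (vw r a) (st r a)) \<longleftrightarrow>
      (\<exists>i\<le>r. P i a \<in> hset n C \<and> N dvd P i a - (sg a * x + int a))"
    unfolding known_def next_sightings_st[OF assms(1,2)] using r by auto
  also have "\<dots> \<longleftrightarrow> sg a * x + int a \<in> hset n C"
    using assms(3) hset_cong unfolding knows_def by blast
  also have "\<dots> \<longleftrightarrow> x \<in> dihedral (sg a) (- sg a * int a) (hset n C)"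
    unfolding dihedral_mem[OF sg] by (simp add: algebra_simps)
  finally show "x \<in> known n (next_sightings (vw r a) (st r a)) \<longleftrightarrow>
    x \<in> dihedral (sg a) (- sg a * int a) (hset n C)" .
qed

lemma card_residues_dihedral:
  assumes s: "s = 1 \<or> s = - 1"
  shows "card (dihedral s t (hset n C) \<inter> {0..<N}) = k"
proof -
  let ?f = "\<lambda>c::nat. (s * int c + t) mod N"
  have "bij_betw ?f C (dihedral s t (hset n C) \<inter> {0..<N})"
    unfolding bij_betw_def
  proof
    show "inj_on ?f C"
    proof (rule inj_onI)
      fix x y assume xy: "x \<in> C" "y \<in> C" "?f x = ?f y"
      then have "N dvd s * int x + t - (s * int y + t)" by (simp add: mod_eq_dvd_iff)
      then have "N dvd int x - int y" using s by (auto simp: dvd_diff_commute)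
      then have "int x mod N = int y mod N" by (simp add: mod_eq_dvd_iff)
      then show "x = y" using C_sub xy by simp
    qed
    show "?f ` C = dihedral s t (hset n C) \<inter> {0..<N}"
    proof
      show "?f ` C \<subseteq> dihedral s t (hset n C) \<inter> {0..<N}"
      proof
        fix y assume "y \<in> ?f ` C"
        then obtain c where c: "c \<in> C" "y = ?f c" by blast
        have "N dvd (s * int c + t) - y" unfolding c(2) by (rule dvd_minus_mod)
        then have "N dvd s * (y - t) - int c"
          using s by (auto simp: algebra_simps dvd_diff_commute)
        then have "s * (y - t) \<in> hset n C"
          using hset_cong[of "s * (y - t)" "int c"] c C_sub by (simp add: hset_def)
        then show "y \<in> dihedral s t (hset n C) \<inter> {0..<N}"
          using c n by (simp add: dihedral_mem[OF s])
      qed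
      show "dihedral s t (hset n C) \<inter> {0..<N} \<subseteq> ?f ` C"
      proof
        fix y assume y: "y \<in> dihedral s t (hset n C) \<inter> {0..<N}"
        then have h: "s * (y - t) \<in> hset n C" by (simp add: dihedral_mem[OF s])
        define c where "c = nat ((s * (y - t)) mod N)"
        have "c \<in> C" using h by (simp add: hset_def c_def)
        moreover have "?f c = y"
        proof -
          have "int c = (s * (y - t)) mod N" using n by (simp add: c_def)
          then have "?f c = (s * (s * (y - t)) + t) mod N" by (metis mod_add_left_eq mod_mult_right_eq)
          then show ?thesis using s y by auto
        qed
        ultimately show "y \<in> ?f ` C" by blast
      qed
    qed
  qed
  then show ?thesis by (simp add: bij_betw_same_card)
qed

lemma homes_st:
  "alive r \<Longrightarrow> a \<in> C \<Longrightarrow> knows r a \<Longrightarrow> homes n (next_sightings (vw r a) (st r a)) = k"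
  unfolding homes_def known_st by (rule card_residues_dihedral[OF sg])

lemma rotation_symmetric_st:
  "alive r \<Longrightarrow> a \<in> C \<Longrightarrow> knows r a \<Longrightarrow>
    rotation_symmetric n (known n (next_sightings (vw r a) (st r a))) \<longleftrightarrow> C \<in> periodic_configurations n"
  unfolding known_st periodic_iff by (rule rotation_symmetric_dihedral[OF sg])

definition mid :: int where
  "mid = center n (hset n C)"

text \<open>Equivariance of the center cancels the unknown position of the homebase; only the sign
  of the frame remains.\<close>

lemma bearing_st:
  assumes "alive r" "a \<in> C" "knows r a" "C \<notin> periodic_configurations n"
  shows "bearing n (vw r a) (st r a) = (sg a * (2 * P r a - mid)) mod (2 * N)"
proof -
  let ?c = "center n (known n (next_sightings (vw r a) (st r a)))"
  have "2 * N dvd ?c - (sg a * mid + 2 * (- sg a * int a))"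
    unfolding known_st[OF assms(1-3)] mid_def
    by (rule center_dihedral[OF n _ _ sg]) (use hset_add[of _ 1] assms(4) periodic_iff in auto)
  then have "2 * N dvd 2 * (sg a * (P r a - int a)) - ?c - sg a * (2 * P r a - mid)"
    by (subst dvd_diff_commute) (simp add: algebra_simps)
  then show ?thesis
    unfolding bearing_def next_offset_st[OF assms(1,2)] by (simp add: mod_eq_dvd_iff)
qed

definition united :: "nat \<Rightarrow> bool" where
  "united r \<longleftrightarrow> (\<forall>a\<in>C. \<forall>b\<in>C. N dvd P r b - P r a)"

definition close :: "nat \<Rightarrow> bool" where
  "close r \<longleftrightarrow> (\<exists>v. \<forall>a\<in>C. N dvd P r a - v \<or> N dvd P r a - v - 1)"

text \<open>Nobody has finished before, and the decision taken in round \<open>r\<close> finishes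
  everybody at once. This simultaneity gives awareness, and since finished agents rest, being close
  in round \<open>r\<close> is enough.\<close>

definition success :: "nat \<Rightarrow> bool" where
  "success r \<longleftrightarrow> alive r \<and> (\<forall>a\<in>C. mode (st (Suc r) a) = Finished) \<and> close r"

lemma united_close: "united r \<Longrightarrow> close r"
  unfolding united_def close_def using C_ne by blast

lemma dvd_P_trans: "N dvd P r b - P r a \<Longrightarrow> N dvd P r c - P r b \<Longrightarrow> N dvd P r c - P r a"
  using dvd_add[of N "P r b - P r a" "P r c - P r b"] by simp

lemma unitedI:
  assumes "\<And>c. c \<in> C \<Longrightarrow> N dvd P r c - P r a"
  shows "united r"
  unfolding united_def
proof (intro ballI)
  fix b c assume bc: "b \<in> C" "c \<in> C"
  have "N dvd (P r c - P r a) - (P r b - P r a)"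
    by (rule dvd_diff[OF assms[OF bc(2)] assms[OF bc(1)]])
  then show "N dvd P r c - P r b" by simp
qed

lemma united_total:
  assumes "a \<in> C" "0 < r"
  shows "along (vw r a) + against (vw r a) + idle (vw r a) + 1 = k \<longleftrightarrow> united r"
proof -
  obtain q where q: "r = Suc q" using assms(2) gr0_implies_Suc by blast
  show ?thesis unfolding q total_vw[OF assms(1)] united_def
    using assms(1) unitedI[of "Suc q" a] unfolding united_def by blast
qed

lemma
  assumes "alive r" "a \<in> C"
  shows mode_Suc: "mode (st (Suc r) a) = next_mode n (vw r a) (st r a)"
    and heading_Suc: "heading (st (Suc r) a) = next_heading n (vw r a) (st r a)"
    and mark_Suc: "mark (st (Suc r) a) = next_mark n (vw r a) (st r a)"
    and crowd_Suc: "crowd (st (Suc r) a) = next_crowd n (vw r a) (st r a)"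
  using st_alive[OF assms] by (simp_all add: update_def)

subsection \<open>Exploration\<close>

lemma walking: "r \<le> 6 * n \<Longrightarrow> alive r \<and> (\<forall>a\<in>C. mode (st r a) = Walking)"
proof (induction r)
  case 0
  then show ?case using alive_0 by (simp add: st_0 start_def)
next
  case (Suc r)
  then have "mode (st (Suc r) a) = Walking" if "a \<in> C" for a
    using mode_Suc[of r a] clock_st[of r a] that by (simp add: next_mode_def Let_def)
  then show ?case by (simp add: alive_def)
qed

lemma D_walking:
  assumes "r < 6 * n" "a \<in> C"
  shows "D r a = sg a"
proof -
  have "alive r" "mode (st (Suc r) a) = Walking" using walking[of r] walking[of "Suc r"] assms by auto
  moreover have "heading (st (Suc r) a) = 1"
    using heading_Suc[of r a] clock_st[of r a] assms \<open>alive r\<close> by (simp add: next_heading_def Let_def)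
  ultimately show ?thesis by (simp add: D_def go_def)
qed

lemma record_walking:
  assumes a: "a \<in> C" and r: "Suc (3 * n) \<le> r"
  shows "r \<le> 6 * n \<longrightarrow> mark (st r a) = sg a * (P (3 * n) a - int a) \<and> crowd (st r a) = along (vw (3 * n) a)"
  using r
proof (induction r rule: dec_induct)
  case base
  have "alive (3 * n)" using walking[of "3 * n"] by simp
  then show ?case
    using mark_Suc[of "3 * n" a] crowd_Suc[of "3 * n" a] clock_st[of "3 * n" a] next_offset_st[of "3 * n" a] a
    by (simp add: next_mark_def next_crowd_def)
next
  case (step r)
  show ?case
  proof
    assume r: "Suc r \<le> 6 * n"
    then have "alive r" using walking[of r] by simp
    then show "mark (st (Suc r) a) = sg a * (P (3 * n) a - int a) \<and> crowd (st (Suc r) a) = along (vw (3 * n) a)"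
      using mark_Suc[of r a] crowd_Suc[of r a] clock_st[of r a] a step r
      by (simp add: next_mark_def next_crowd_def)
  qed
qed

definition class_of :: "nat \<Rightarrow> nat set" where
  "class_of a = {b \<in> C. sg b = sg a}"

lemma along_walking:
  assumes a: "a \<in> C" and r: "0 < r" "r \<le> 6 * n"
  shows "along (vw r a) = card {b \<in> class_of a - {a}. N dvd P r b - P r a}"
proof -
  obtain q where q: "r = Suc q" using r gr0_implies_Suc by blast
  have "{b \<in> mates (Suc q) a. D q b = sg a} = {b \<in> class_of a - {a}. N dvd P r b - P r a}"
    using D_walking[of q] r q by (auto simp: mates_def class_of_def)
  then show ?thesis using along_vw[OF a, of q] q by simp
qed

definition unaware :: "nat \<Rightarrow> bool" where
  "unaware a \<longleftrightarrow> mode (st (Suc (6 * n)) a) = Unaware"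

lemma
  assumes a: "a \<in> C"
  shows unaware_iff: "unaware a \<longleftrightarrow> sg a * (P (6 * n) a - P (3 * n) a) < N \<and> along (vw (6 * n) a) = along (vw (3 * n) a)"
    and not_unaware: "\<not> unaware a \<Longrightarrow> mode (st (Suc (6 * n)) a) = Informed"
proof -
  have al: "alive (6 * n)" using walking by blast
  have "sg a * (P (6 * n) a - int a) - sg a * (P (3 * n) a - int a) = sg a * (P (6 * n) a - P (3 * n) a)"
    by (simp add: algebra_simps)
  then have "mode (st (Suc (6 * n)) a) =
      (if sg a * (P (6 * n) a - P (3 * n) a) < N \<and> along (vw (6 * n) a) = along (vw (3 * n) a) then Unaware else Informed)"
    using mode_Suc[OF al a] clock_st[OF al a] next_offset_st[OF al a] record_walking[OF a, of "6 * n"] n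
    by (simp add: next_mode_def Let_def)
  then show "unaware a \<longleftrightarrow> sg a * (P (6 * n) a - P (3 * n) a) < N \<and> along (vw (6 * n) a) = along (vw (3 * n) a)"
    "\<not> unaware a \<Longrightarrow> mode (st (Suc (6 * n)) a) = Informed"
    by (auto simp: unaware_def)
qed

text \<open>By \<open>one_direction\<close>, twice the progress in \<open>3 n\<close> rounds is at
  least \<open>3 n - n + 2\<close>, which exceeds two tours.\<close>

lemma class_walk:
  assumes a: "a \<in> C" and b: "b \<in> class_of a" and tu: "t + 3 * n = u" "u \<le> 6 * n"
    and apart: "\<not> N dvd P u b - P u a"
  shows "sg a * (P u a - P t a) \<ge> N"
proof -
  have "b \<in> C" "sg b = sg a" using b by (auto simp: class_of_def)
  then have "2 * (sg a * (P u a - P t a)) \<ge> int (u - t) - N + 2"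
    using one_direction[OF a \<open>b \<in> C\<close> _ sg _ _ apart, of t a] D_walking tu a by simp
  moreover have "int (u - t) = 3 * N" using tu by auto
  ultimately show ?thesis by linarith
qed

lemma class_together:
  assumes a: "a \<in> C" and b: "b \<in> class_of a" and tu: "t \<le> u" "u \<le> 6 * n" and m: "N dvd P t b - P t a"
  shows "P u b - P u a = P t b - P t a"
  using merged_stays[OF a _ tu(1) _ m] D_walking b tu a by (auto simp: class_of_def)

lemma finite_class [simp]: "finite (class_of a)"
  using C_fin by (simp add: class_of_def)

text \<open>Less than a tour since round \<open>3 n\<close> forces the whole class to be together in
  round \<open>6 n\<close>. The unchanged crowd then shows that it was already together in round
  \<open>3 n\<close>, so all members have the same progress and the same crowd.\<close>

lemma unaware_class:
  assumes a: "a \<in> C" and ua: "unaware a" and b: "b \<in> class_of a"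
  shows "unaware b" "N dvd P (6 * n) b - P (6 * n) a"
proof -
  note u = ua[unfolded unaware_iff[OF a]]
  have m6: "N dvd P (6 * n) c - P (6 * n) a" if "c \<in> class_of a" for c
    using class_walk[OF a that, of "3 * n" "6 * n"] u by fastforce
  then have "{c \<in> class_of a - {a}. N dvd P (6 * n) c - P (6 * n) a} = class_of a - {a}" by blast
  then have "card {c \<in> class_of a - {a}. N dvd P (3 * n) c - P (3 * n) a} = card (class_of a - {a})"
    using u along_walking[OF a, of "3 * n"] along_walking[OF a, of "6 * n"] n by simp
  then have "{c \<in> class_of a - {a}. N dvd P (3 * n) c - P (3 * n) a} = class_of a - {a}"
    by (intro card_subset_eq) auto
  then have m3: "N dvd P (3 * n) c - P (3 * n) a" if "c \<in> class_of a" for c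
    using that by (cases "c = a") auto
  have bC: "b \<in> C" "sg b = sg a" "class_of b = class_of a" using b by (auto simp: class_of_def)
  have "P (6 * n) b - P (6 * n) a = P (3 * n) b - P (3 * n) a"
    using class_together[OF a b _ _ m3[OF b], of "6 * n"] by simp
  then have mv: "P (6 * n) b - P (3 * n) b = P (6 * n) a - P (3 * n) a" by simp
  have all: "{c \<in> class_of b - {b}. N dvd P t c - P t b} = class_of b - {b}" if "t = 3 * n \<or> t = 6 * n" for t
  proof -
    have "N dvd P t c - P t b" if "c \<in> class_of b" for c
    proof -
      have "N dvd P t c - P t a" "N dvd P t b - P t a"
        using m3 m6 \<open>t = 3 * n \<or> t = 6 * n\<close> bC b that by auto
      then have "N dvd (P t c - P t a) - (P t b - P t a)" by (rule dvd_diff)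
      then show ?thesis by simp
    qed
    then show ?thesis by blast
  qed
  have "along (vw (6 * n) b) = along (vw (3 * n) b)"
    using along_walking[OF bC(1), of "3 * n"] along_walking[OF bC(1), of "6 * n"] all n by simp
  then show "unaware b" using u mv bC by (simp add: unaware_iff)
  show "N dvd P (6 * n) b - P (6 * n) a" by (rule m6[OF b])
qed

text \<open>Either the agent made a tour between the two tests, or the crowd changed. In the latter
  case the class was not yet merged in round \<open>3 n\<close>, as merged agents stay together, so
  the first \<open>3 n\<close> rounds contain a tour.\<close>

lemma informed_knows:
  assumes a: "a \<in> C" and na: "\<not> unaware a"
  shows "knows (6 * n) a"
proof (cases "sg a * (P (6 * n) a - P (3 * n) a) < N")
  case False
  then show ?thesis using tour_knows[OF _ sg, of "3 * n" "6 * n" a a] by simp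
next
  case True
  then have ne: "along (vw (6 * n) a) \<noteq> along (vw (3 * n) a)" using na unaware_iff[OF a] by blast
  have "\<exists>b\<in>class_of a. \<not> N dvd P (3 * n) b - P (3 * n) a"
  proof (rule ccontr)
    assume "\<not> ?thesis"
    then have m3: "N dvd P (3 * n) b - P (3 * n) a" if "b \<in> class_of a" for b using that by blast
    then have "N dvd P (6 * n) b - P (6 * n) a" if "b \<in> class_of a" for b
      using class_together[OF a that _ _ m3[OF that], of "6 * n"] that by simp
    then have "{b \<in> class_of a - {a}. N dvd P (6 * n) b - P (6 * n) a} =
        {b \<in> class_of a - {a}. N dvd P (3 * n) b - P (3 * n) a}" using m3 by blast
    then show False
      using ne along_walking[OF a, of "3 * n"] along_walking[OF a, of "6 * n"] n by simp
  qed
  then obtain b where "b \<in> class_of a" "\<not> N dvd P (3 * n) b - P (3 * n) a" by blast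
  then have "sg a * (P (3 * n) a - P 0 a) \<ge> N" using class_walk[OF a, of b 0 "3 * n"] by simp
  then have "knows (3 * n) a" using tour_knows[OF _ sg, of 0 "3 * n" a a] by simp
  then show ?thesis by (rule knows_mono) simp
qed

subsection \<open>Two groups marching towards each other\<close>

text \<open>Each group moves as one, so a crossing of two agents is a crossing of their groups and
  is seen by all. It leaves the groups at the two ends of the traversed edge.\<close>

lemma two_step:
  assumes D: "\<And>a. a \<in> C \<Longrightarrow> D r a = \<delta> a" and \<delta>: "\<And>a. a \<in> C \<Longrightarrow> \<delta> a = 1 \<or> \<delta> a = - 1"
    and m: "\<And>a b. a \<in> C \<Longrightarrow> b \<in> C \<Longrightarrow> \<delta> a = \<delta> b \<Longrightarrow> N dvd P r b - P r a"
    and a: "a \<in> C" "crosses (vw (Suc r) a)"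
  shows "\<forall>c\<in>C. crosses (vw (Suc r) c)" "close (Suc r)"
proof -
  obtain b where b: "b \<in> C" "V r a \<noteq> 0" "V r b = - V r a" "N dvd P r b - P r a - V r a"
    using a crosses_vw by blast
  have da: "\<delta> a = V r a" "\<delta> b = - V r a"
    using V_cases[of r a] V_cases[of r b] b D a by auto
  have c: "\<delta> c = \<delta> a \<and> V r c = V r a \<and> N dvd P r c - P r a \<or>
      \<delta> c = \<delta> b \<and> V r c = V r b \<and> N dvd P r c - P r b" if "c \<in> C" for c
  proof -
    have "\<delta> c = \<delta> a \<or> \<delta> c = \<delta> b" using \<delta>[OF that] \<delta>[OF a(1)] da by auto
    then show ?thesis
    proof
      assume e: "\<delta> c = \<delta> a"
      then have "N dvd P r c - P r a" using m[OF a(1) that] by simp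
      then show ?thesis using same_V[OF a(1) that] D that a(1) e by auto
    next
      assume e: "\<delta> c = \<delta> b"
      then have "N dvd P r c - P r b" using m[OF b(1) that] by simp
      then show ?thesis using same_V[OF b(1) that] D that b(1) e by auto
    qed
  qed
  show "\<forall>c\<in>C. crosses (vw (Suc r) c)"
  proof
    fix c assume cC: "c \<in> C"
    from c[OF cC] show "crosses (vw (Suc r) c)"
    proof
      assume h: "\<delta> c = \<delta> a \<and> V r c = V r a \<and> N dvd P r c - P r a"
      have "N dvd (P r b - P r a - V r a) - (P r c - P r a)" by (rule dvd_diff[OF b(4)]) (use h in blast)
      then have "N dvd P r b - P r c - V r c" using h by (simp add: algebra_simps)
      then show ?thesis using crosses_vw[OF cC] b h by auto
    next
      assume h: "\<delta> c = \<delta> b \<and> V r c = V r b \<and> N dvd P r c - P r b"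
      have "N dvd - ((P r b - P r a - V r a) + (P r c - P r b))"
        unfolding dvd_minus_iff by (rule dvd_add[OF b(4)]) (use h in blast)
      moreover have "P r a - P r c - V r c = - ((P r b - P r a - V r a) + (P r c - P r b))"
        using h b(3) by simp
      ultimately have "N dvd P r a - P r c - V r c" by metis
      then show ?thesis using crosses_vw[OF cC] b h a(1) by auto
    qed
  qed
  have e: "N dvd P (Suc r) c - (P r a + V r a) \<or> N dvd P (Suc r) c - P r a" if "c \<in> C" for c
    using c[OF that]
  proof
    assume h: "\<delta> c = \<delta> a \<and> V r c = V r a \<and> N dvd P r c - P r a"
    then show ?thesis by (simp add: P_Suc)
  next
    assume h: "\<delta> c = \<delta> b \<and> V r c = V r b \<and> N dvd P r c - P r b"
    have "N dvd (P r b - P r a - V r a) + (P r c - P r b)"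
      by (rule dvd_add[OF b(4)]) (use h in blast)
    moreover have "(P r b - P r a - V r a) + (P r c - P r b) = P (Suc r) c - P r a"
      using h b(3) by (simp add: P_Suc)
    ultimately have "N dvd P (Suc r) c - P r a" by metis
    then show ?thesis ..
  qed
  have "V r a = 1 \<or> V r a = - 1" using \<delta>[OF a(1)] da by simp
  then show "close (Suc r)"
  proof
    assume v: "V r a = 1"
    show ?thesis unfolding close_def
      by (rule exI[of _ "P r a"]) (use e v in \<open>fastforce simp: algebra_simps\<close>)
  next
    assume v: "V r a = - 1"
    show ?thesis unfolding close_def
      by (rule exI[of _ "P r a - 1"]) (use e v in \<open>fastforce simp: algebra_simps\<close>)
  qed
qed

lemma merged_classes:
  assumes "t \<le> u" and D: "\<And>r a. t \<le> r \<Longrightarrow> r < u \<Longrightarrow> a \<in> C \<Longrightarrow> D r a = \<delta> a"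
    and m: "\<And>a b. a \<in> C \<Longrightarrow> b \<in> C \<Longrightarrow> \<delta> a = \<delta> b \<Longrightarrow> N dvd P t b - P t a"
    and "a \<in> C" "b \<in> C" "\<delta> a = \<delta> b"
  shows "N dvd P u b - P u a"
  using merged_stays[of a b t u] assms by auto

text \<open>By \<open>facing\<close>, the gap is 1 after \<open>n\<close> rounds. From then on it is
  constant while each agent can only make it smaller, so neither moves.\<close>

lemma pair_stuck:
  assumes a: "a \<in> C" and b: "b \<in> C" and tu: "t + n \<le> u"
    and Da: "\<And>r. t \<le> r \<Longrightarrow> r < u \<Longrightarrow> D r a = 1" and Db: "\<And>r. t \<le> r \<Longrightarrow> r < u \<Longrightarrow> D r b = - 1"
    and no_meet: "\<And>r. t < r \<Longrightarrow> r \<le> u \<Longrightarrow> \<not> N dvd P r b - P r a"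
    and no_cross: "\<And>r. t < r \<Longrightarrow> r \<le> u \<Longrightarrow> \<not> crosses (vw r a)"
  shows "N dvd P u b - P u a - 1" "P u a - P t a < N" "P t b - P u b < N"
    "t + n \<le> r \<Longrightarrow> r \<le> u \<Longrightarrow> P r a = P u a \<and> P r b = P u b"
proof -
  \<comment> \<open>The gap is taken in \<open>1 .. N\<close>: agents that start at the same node
    and part have the whole ring between them.\<close>
  define g where "g = (P t b - P t a - 1) mod N + 1"
  have "0 \<le> (P t b - P t a - 1) mod N" "(P t b - P t a - 1) mod N < N" using n by auto
  then have g: "1 \<le> g" "g \<le> N" unfolding g_def by linarith+
  have "N dvd P t b - P t a - 1 - (P t b - P t a - 1) mod N" by (rule dvd_minus_mod)
  then have g3: "N dvd P t b - P t a - g" by (simp add: g_def algebra_simps)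
  define G where "G r = g + (P r b - P t b) - (P r a - P t a)" for r
  have no_cross': "\<not> N dvd P r b - P r a - 1" if "t \<le> r" "r < u" "V r a = 1" "V r b = - 1" for r
    using no_cross[of "Suc r"] crosses_vw[OF a, of r] that b by auto
  have G: "1 \<le> G r \<and> (G r = 1 \<or> G r \<le> N - int (r - t)) \<and> N dvd P r b - P r a - G r"
    if "t \<le> r" "r \<le> u" for r
    unfolding G_def by (rule facing[OF a b Da Db no_meet no_cross' g g3 that])
  have mono: "P r a \<le> P r' a \<and> P r' b \<le> P r b" if "t \<le> r" "r \<le> r'" "r' \<le> u" for r r'
    using that(2,3)
  proof (induction r' rule: dec_induct)
    case (step q)
    then have "V q a = 0 \<or> V q a = 1" "V q b = 0 \<or> V q b = - 1"
      using V_cases[of q a] V_cases[of q b] Da[of q] Db[of q] that(1) by auto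
    then show ?case using step by (auto simp: P_Suc)
  qed simp
  have G1: "G r = 1" if "t + n \<le> r" "r \<le> u" for r
  proof -
    have "N - int (r - t) \<le> 0" using that by linarith
    then show ?thesis using G[of r] that by linarith
  qed
  show "N dvd P u b - P u a - 1" using G[of u] G1[of u] tu by simp
  have "G u = 1" "G t = g" using G1 tu by (auto simp: G_def)
  then show "P u a - P t a < N" "P t b - P u b < N"
    using g mono[of t u] tu by (auto simp: G_def)
  show "P r a = P u a \<and> P r b = P u b" if "t + n \<le> r" "r \<le> u"
    using G1[OF that] G1[of u] mono[of r u] that tu by (simp add: G_def)
qed

text \<open>Both directions occur, since otherwise all agents would be united; so each agent has an
  opponent for \<open>pair_stuck\<close>. The bound on the progress serves the test of round
  \<open>9 n\<close>, the standstill that of round \<open>13 n\<close>.\<close>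

lemma two_groups_stuck:
  assumes tu: "t + n \<le> u" and D: "\<And>r a. t \<le> r \<Longrightarrow> r < u \<Longrightarrow> a \<in> C \<Longrightarrow> D r a = \<delta> a"
    and \<delta>: "\<And>a. a \<in> C \<Longrightarrow> \<delta> a = 1 \<or> \<delta> a = - 1"
    and m: "\<And>a b. a \<in> C \<Longrightarrow> b \<in> C \<Longrightarrow> \<delta> a = \<delta> b \<Longrightarrow> N dvd P t b - P t a"
    and no_meet: "\<And>r. t < r \<Longrightarrow> r \<le> u \<Longrightarrow> \<not> united r"
    and no_cross: "\<And>r a. t < r \<Longrightarrow> r \<le> u \<Longrightarrow> a \<in> C \<Longrightarrow> \<not> crosses (vw r a)"
  shows "close u" "a \<in> C \<Longrightarrow> \<delta> a * (P u a - P t a) < N"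
    "a \<in> C \<Longrightarrow> t + n \<le> r \<Longrightarrow> r \<le> u \<Longrightarrow> P r a = P u a"
proof -
  have m': "N dvd P r b - P r a" if "t \<le> r" "r \<le> u" "a \<in> C" "b \<in> C" "\<delta> a = \<delta> b" for r a b
  proof (rule merged_classes[where \<delta> = \<delta>, OF that(1) _ m that(3-5)])
    show "D q c = \<delta> c" if "t \<le> q" "q < r" "c \<in> C" for q c
      by (rule D) (use that \<open>r \<le> u\<close> in auto)
  qed
  have apart: "\<not> N dvd P r b - P r a" if "t < r" "r \<le> u" "a \<in> C" "b \<in> C" "\<delta> a \<noteq> \<delta> b" for r a b
  proof
    assume h: "N dvd P r b - P r a"
    have "N dvd P r c - P r a" if "c \<in> C" for c
    proof -
      have "\<delta> c = \<delta> a \<or> \<delta> c = \<delta> b"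
        using \<delta>[OF that] \<delta>[OF \<open>a \<in> C\<close>] \<delta>[OF \<open>b \<in> C\<close>] \<open>\<delta> a \<noteq> \<delta> b\<close> by auto
      then show ?thesis
      proof
        assume "\<delta> c = \<delta> a"
        then show ?thesis using m'[of r a c] that \<open>t < r\<close> \<open>r \<le> u\<close> \<open>a \<in> C\<close> by simp
      next
        assume "\<delta> c = \<delta> b"
        then have "N dvd P r c - P r b" using m'[of r b c] that \<open>t < r\<close> \<open>r \<le> u\<close> \<open>b \<in> C\<close> by simp
        then show ?thesis by (rule dvd_P_trans[OF h])
      qed
    qed
    then have "united r" by (rule unitedI)
    then show False using no_meet that by blast
  qed
  have "\<exists>a\<in>C. \<exists>b\<in>C. \<delta> a \<noteq> \<delta> b"
  proof (rule ccontr)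
    assume "\<not> ?thesis"
    then have "\<delta> a = \<delta> b" if "a \<in> C" "b \<in> C" for a b using that by blast
    then have "N dvd P u b - P u a" if "a \<in> C" "b \<in> C" for a b
      using m'[OF _ order_refl that] that tu by (meson add_leD1)
    then have "united u" by (simp add: united_def)
    then show False using no_meet[of u] tu n by simp
  qed
  then obtain a0 b0 where a0: "a0 \<in> C" "\<delta> a0 = 1" and b0: "b0 \<in> C" "\<delta> b0 = - 1"
    using \<delta> by metis
  have ex: "\<exists>b\<in>C. \<delta> b = - \<delta> a" if "a \<in> C" for a
    using \<delta>[OF that] a0 b0 by auto
  have pair: "N dvd P u b - P u a - 1 \<and> P u a - P t a < N \<and> P t b - P u b < N \<and>
      (\<forall>r. t + n \<le> r \<longrightarrow> r \<le> u \<longrightarrow> P r a = P u a \<and> P r b = P u b)"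
    if ab: "a \<in> C" "b \<in> C" "\<delta> a = 1" "\<delta> b = - 1" for a b
  proof -
    have "D r a = 1" "D r b = - 1" if "t \<le> r" "r < u" for r
      using D[OF that ab(1)] D[OF that ab(2)] ab by simp_all
    moreover have "\<not> N dvd P r b - P r a" "\<not> crosses (vw r a)" if "t < r" "r \<le> u" for r
      using apart[OF that ab(1,2)] no_cross[OF that ab(1)] ab by simp_all
    ultimately show ?thesis using pair_stuck[OF ab(1,2) tu] by blast
  qed
  have each: "\<delta> a * (P u a - P t a) < N \<and> (t + n \<le> r \<longrightarrow> r \<le> u \<longrightarrow> P r a = P u a)" if aC: "a \<in> C" for a r
  proof -
    obtain b where b: "b \<in> C" "\<delta> b = - \<delta> a" using ex aC by blast
    show ?thesis
    proof (cases "\<delta> a = 1")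
      case True
      have pr: "P u a - P t a < N" "t + n \<le> r \<longrightarrow> r \<le> u \<longrightarrow> P r a = P u a"
        using pair[OF aC b(1) True b(2)[unfolded True]] by blast+
      then show ?thesis unfolding True mult_1 by blast
    next
      case False
      then have da: "\<delta> a = - 1" using \<delta>[OF aC] by blast
      then have db: "\<delta> b = 1" using b(2) by simp
      have pr: "P t a - P u a < N" "t + n \<le> r \<longrightarrow> r \<le> u \<longrightarrow> P r a = P u a"
        using pair[OF b(1) aC db da] by blast+
      have "\<delta> a * (P u a - P t a) < N" unfolding da using pr(1) by simp
      then show ?thesis using pr(2) by blast
    qed
  qed
  then show "a \<in> C \<Longrightarrow> \<delta> a * (P u a - P t a) < N"
    "a \<in> C \<Longrightarrow> t + n \<le> r \<Longrightarrow> r \<le> u \<Longrightarrow> P r a = P u a" by blast+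
  have ab: "N dvd P u b0 - P u a0 - 1" using pair[OF a0(1) b0(1) a0(2) b0(2)] by blast
  have "N dvd P u c - P u a0 \<or> N dvd P u c - P u a0 - 1" if c: "c \<in> C" for c
  proof (cases "\<delta> c = 1")
    case True
    have "N dvd P u c - P u a0" by (rule m') (use a0 c tu True in auto)
    then show ?thesis ..
  next
    case False
    then have "\<delta> b0 = \<delta> c" using \<delta>[OF c] b0 by auto
    then have "N dvd P u c - P u b0" by (intro m') (use b0 c tu in auto)
    then have "N dvd (P u c - P u b0) + (P u b0 - P u a0 - 1)" using ab by (rule dvd_add)
    moreover have "(P u c - P u b0) + (P u b0 - P u a0 - 1) = P u c - P u a0 - 1" by simp
    ultimately show ?thesis by metis
  qed
  then show "close u" unfolding close_def by blast
qed

section \<open>The end of the exploration, rounds \<open>6 n\<close> to \<open>9 n\<close>\<close>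

lemma exploring:
  assumes a: "a \<in> C" and r: "Suc (6 * n) \<le> r"
  shows "r \<le> 9 * n \<longrightarrow> alive r \<longrightarrow> mode (st r a) = (if unaware a then Unaware else Informed) \<and>
    mark (st r a) = sg a * (P (6 * n) a - int a)"
  using r
proof (induction r rule: dec_induct)
  case base
  have al: "alive (6 * n)" using walking by blast
  show ?case
    using mark_Suc[OF al a] clock_st[OF al a] next_offset_st[OF al a] not_unaware[OF a]
    by (auto simp: unaware_def next_mark_def)
next
  case (step r)
  show ?case
  proof (intro impI)
    assume r: "Suc r \<le> 9 * n" and al: "alive (Suc r)"
    then have al': "alive r" using alive_Suc by blast
    have c: "clock (st r a) = r" by (rule clock_st[OF al' a])
    have "mode (st (Suc r) a) \<noteq> Finished" using al a by (simp add: alive_def)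
    then show "mode (st (Suc r) a) = (if unaware a then Unaware else Informed) \<and>
        mark (st (Suc r) a) = sg a * (P (6 * n) a - int a)"
      using mode_Suc[OF al' a] mark_Suc[OF al' a] c r step al'
      by (auto simp: next_mode_def next_mark_def Let_def split: if_splits)
  qed
qed

lemma D_exploring:
  assumes r: "6 * n \<le> r" "r < 9 * n" and al: "alive (Suc r)" and a: "a \<in> C"
  shows "D r a = (if unaware a then sg a else - sg a)"
proof -
  have al': "alive r" using al alive_Suc by blast
  have m: "mode (st (Suc r) a) = (if unaware a then Unaware else Informed)"
    using exploring[OF a, of "Suc r"] r al by simp
  then have "next_mode n (vw r a) (st r a) = (if unaware a then Unaware else Informed)"
    using mode_Suc[OF al' a] by simp
  then have "heading (st (Suc r) a) = (if unaware a then 1 else - 1)"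
    using heading_Suc[OF al' a] clock_st[OF al' a] r by (simp add: next_heading_def Let_def)
  then show ?thesis using m by (simp add: D_def go_def)
qed

lemma exploring_mode:
  assumes r: "6 * n < r" "r \<le> 9 * n" and al: "alive r" and a: "a \<in> C"
  shows "unaware a \<Longrightarrow> crosses (vw r a) \<or> against (vw r a) > 0 \<Longrightarrow> mode (st (Suc r) a) = Finished"
    "r < 9 * n \<Longrightarrow> \<not> unaware a \<or> \<not> crosses (vw r a) \<and> against (vw r a) = 0 \<Longrightarrow>
      mode (st (Suc r) a) \<noteq> Finished"
  using exploring[OF a, of r] mode_Suc[OF al a] clock_st[OF al a] r al
  by (auto simp: next_mode_def Let_def)

lemma last_exploring_mode:
  assumes al: "alive (9 * n)" and a: "a \<in> C" and u: "unaware a"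
    and slow: "sg a * (P (9 * n) a - P (6 * n) a) < N"
  shows "mode (st (Suc (9 * n)) a) = Finished"
proof -
  have "mode (st (9 * n) a) = Unaware" "mark (st (9 * n) a) = sg a * (P (6 * n) a - int a)"
    using exploring[OF a, of "9 * n"] al u n by auto
  moreover have "sg a * (P (9 * n) a - int a) - sg a * (P (6 * n) a - int a) < N"
    using slow by (simp add: algebra_simps)
  ultimately show ?thesis
    using mode_Suc[OF al a] clock_st[OF al a] next_offset_st[OF al a] n
    by (simp add: next_mode_def Let_def)
qed

text \<open>A meeting shows in \<open>against\<close>, a crossing in \<open>crosses\<close>, and
  groups stuck at one edge progress by less than \<open>N\<close> until round \<open>9 n\<close>. In
  each case both classes finish in the same round.\<close>

lemma two_unaware_groups:
  assumes a: "a \<in> C" "unaware a" and b: "b \<in> C" "unaware b" and ab: "sg a \<noteq> sg b"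
  shows "\<exists>r\<le>9 * n. success r"
proof (rule ccontr)
  assume "\<not> ?thesis"
  then have NS: "\<not> success r" if "r \<le> 9 * n" for r using that by blast
  have ab': "sg c = sg a \<or> sg c = sg b" for c using sg[of a] sg[of b] sg[of c] ab by auto
  have u: "unaware c" if "c \<in> C" for c
    using ab'[of c] unaware_class(1)[OF a, of c] unaware_class(1)[OF b, of c] that
    by (auto simp: class_of_def)
  have m: "N dvd P (6 * n) d - P (6 * n) c" if "c \<in> C" "d \<in> C" "sg c = sg d" for c d
    using unaware_class(2)[OF that(1) u[OF that(1)], of d] that by (simp add: class_of_def)
  \<comment> \<open>Stated for a single round, because the induction for \<open>alive\<close> below
    uses it to pass from \<open>r\<close> to \<open>Suc r\<close>.\<close>
  have noev: "\<not> united r \<and> (\<forall>c\<in>C. \<not> crosses (vw r c) \<and> against (vw r c) = 0)"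
    if r: "6 * n < r" "r \<le> 9 * n" and al: "alive r"
      and D: "\<And>q c. 6 * n \<le> q \<Longrightarrow> q < r \<Longrightarrow> c \<in> C \<Longrightarrow> D q c = sg c" for r
  proof -
    obtain q where q: "r = Suc q" "6 * n \<le> q" using r by (metis less_imp_Suc_add le_add1)
    have merged: "N dvd P t d - P t c" if "6 * n \<le> t" "t \<le> r" "c \<in> C" "d \<in> C" "sg c = sg d" for c d t
    proof (rule merged_classes[where \<delta> = sg, OF that(1) _ m that(3-5)])
      show "D q c = sg c" if "6 * n \<le> q" "q < t" "c \<in> C" for q c
        by (rule D) (use that \<open>t \<le> r\<close> in auto)
    qed
    have nc: "\<not> crosses (vw r c)" if c: "c \<in> C" for c
    proof
      assume "crosses (vw r c)"
      then have "\<forall>c\<in>C. crosses (vw r c)" "close r"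
        using two_step[where \<delta> = sg and r = q and a = c] D[of q] sg merged[of q] q c by auto
      then have "success r"
        unfolding success_def using exploring_mode(1)[OF r al] al u by blast
      then show False using NS r by blast
    qed
    have nu: "\<not> united r"
    proof
      assume U: "united r"
      have "against (vw r c) > 0" if c: "c \<in> C" for c
      proof -
        have "sg a = - sg c \<or> sg b = - sg c" using ab sg[of a] sg[of b] sg[of c] by auto
        then obtain d where d: "d \<in> C" "sg d = - sg c" using a(1) b(1) by blast
        have "d \<in> mates r c" using U c d sg[of c] by (auto simp: mates_def united_def)
        then have "{b \<in> mates (Suc q) c. D q b = - sg c} \<noteq> {}" using D[of q d] d q by auto
        then show ?thesis unfolding q(1) against_vw[OF c] by (simp add: card_gt_0_iff)
      qed
      then have "success r"
        unfolding success_def using exploring_mode(1)[OF r al] al u united_close[OF U] by blast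
      then show False using NS r by blast
    qed
    have "against (vw r c) = 0" if c: "c \<in> C" for c
    proof (rule ccontr)
      assume "against (vw r c) \<noteq> 0"
      then have "{b \<in> mates (Suc q) c. D q b = - sg c} \<noteq> {}"
        unfolding q(1) against_vw[OF c] by (metis card.empty)
      then obtain d where d: "d \<in> mates r c" "D q d = - sg c" using q by auto
      then have dC: "d \<in> C" "N dvd P r d - P r c" "sg d = - sg c"
        using D[of q d] q by (auto simp: mates_def)
      have "N dvd P r e - P r c" if e: "e \<in> C" for e
      proof (cases "sg e = sg c")
        case True
        then show ?thesis using merged[of r c e] c e r by simp
      next
        case False
        then have "sg d = sg e" using sg[of c] sg[of e] dC by auto
        then have "N dvd P r e - P r d" using merged[of r d e] dC e r by simp
        then show ?thesis by (rule dvd_P_trans[OF dC(2)])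
      qed
      then have "united r" by (rule unitedI)
      then show False using nu by blast
    qed
    then show ?thesis using nc nu by blast
  qed
  have al: "r \<le> 9 * n \<longrightarrow> alive r" if "Suc (6 * n) \<le> r" for r
    using that
  proof (induction r rule: dec_induct)
    case base
    show ?case using u by (simp add: alive_def unaware_def)
  next
    case (step r)
    show ?case
    proof
      assume r: "Suc r \<le> 9 * n"
      then have al: "alive r" using step by simp
      have "D q c = sg c" if "6 * n \<le> q" "q < r" "c \<in> C" for q c
        using D_exploring[of q c] alive_mono[OF al, of "Suc q"] u that r by simp
      then have "\<forall>c\<in>C. \<not> crosses (vw r c) \<and> against (vw r c) = 0"
        using noev[of r] al r step(1) by simp
      then show "alive (Suc r)"
        using exploring_mode(2)[of r] step(1) r al by (auto simp: alive_def)
    qed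
  qed
  have al9: "alive (9 * n)" using al[of "9 * n"] n by simp
  have D: "D q c = sg c" if "6 * n \<le> q" "q < 9 * n" "c \<in> C" for q c
    using D_exploring[of q c] alive_mono[OF al9, of "Suc q"] u that by simp
  have no: "\<not> united r \<and> (\<forall>c\<in>C. \<not> crosses (vw r c) \<and> against (vw r c) = 0)" if "6 * n < r" "r \<le> 9 * n" for r
    using noev[OF that alive_mono[OF al9 that(2)]] D that by simp
  have st: "close (9 * n)" "c \<in> C \<Longrightarrow> sg c * (P (9 * n) c - P (6 * n) c) < N" for c
    by (rule two_groups_stuck[where \<delta> = sg and t = "6 * n" and u = "9 * n"]; use D sg m no in auto)+
  then have "success (9 * n)"
    unfolding success_def using al9 last_exploring_mode[OF al9] u by blast
  then show False using NS by blast
qed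

text \<open>Informed agents outside an unaware class have the opposite orientation, so by turning
  right they fall in with it. If the unaware class progresses by less than \<open>N\<close>,
  everybody has merged: it concludes this from its progress, the informed agents by counting.
  Otherwise it has made a tour.\<close>

lemma one_unaware_group:
  assumes one: "\<And>a b. a \<in> C \<Longrightarrow> b \<in> C \<Longrightarrow> unaware a \<Longrightarrow> unaware b \<Longrightarrow> sg a = sg b"
  shows "alive (9 * n)"
    "success (9 * n) \<or> \<not> united (9 * n) \<and> (\<forall>a\<in>C. knows (9 * n) a \<and>
      mode (st (Suc (9 * n)) a) = (if C \<in> periodic_configurations n then Symmetric else Approaching))"
proof -
  have D: "D q b = sg a" if "6 * n \<le> q" "q < 9 * n" "alive (Suc q)" "a \<in> C" "unaware a" "b \<in> C" for q a b
  proof (cases "unaware b")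
    case True
    then have "sg b = sg a" using one that by blast
    then show ?thesis using D_exploring[OF that(1,2,3,6)] True by simp
  next
    case False
    then have "sg b \<noteq> sg a" using unaware_class(1)[OF that(4,5), of b] that(6) by (auto simp: class_of_def)
    then have "sg a = - sg b" using sg[of a] sg[of b] by auto
    then show ?thesis using D_exploring[of q b] False that by simp
  qed
  have quiet: "\<not> crosses (vw r a) \<and> against (vw r a) = 0"
    if r: "6 * n < r" "r \<le> 9 * n" and al: "alive r" and a: "a \<in> C" "unaware a" for r a
  proof -
    obtain q where q: "r = Suc q" "6 * n \<le> q" using r by (metis less_imp_Suc_add le_add1)
    have Dq: "D q b = sg a" if "b \<in> C" for b using D[OF q(2) _ _ a that] q r al by simp
    have "\<not> crosses (vw r a)"
    proof
      assume "crosses (vw r a)"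
      then obtain b where "b \<in> C" "V q a \<noteq> 0" "V q b = - V q a" using crosses_vw[OF a(1)] q by blast
      then show False
        using V_cases[of q a] V_cases[of q b] Dq[of b] Dq[OF a(1)] sg[of a] by auto
    qed
    moreover have "{b \<in> mates (Suc q) a. D q b = - sg a} = {}"
      using Dq sg[of a] by (auto simp: mates_def)
    ultimately show ?thesis unfolding q(1) against_vw[OF a(1)] by simp
  qed
  have "r \<le> 9 * n \<longrightarrow> alive r" if "Suc (6 * n) \<le> r" for r
    using that
  proof (induction r rule: dec_induct)
    case base
    have "mode (st (Suc (6 * n)) a) \<noteq> Finished" if "a \<in> C" for a
      using not_unaware[OF that] by (cases "unaware a") (auto simp: unaware_def)
    then show ?case by (simp add: alive_def)
  next
    case (step r)
    show ?case
    proof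
      assume r: "Suc r \<le> 9 * n"
      then have al: "alive r" using step by simp
      then have "mode (st (Suc r) a) \<noteq> Finished" if "a \<in> C" for a
        using exploring_mode(2)[of r a] quiet[of r a] step(1) r that by auto
      then show "alive (Suc r)" by (simp add: alive_def)
    qed
  qed
  then show al: "alive (9 * n)" using n by simp
  have q9: "\<not> crosses (vw (9 * n) a) \<and> against (vw (9 * n) a) = 0" if "a \<in> C" "unaware a" for a
    using quiet[OF _ _ al that] n by simp
  have inf: "mode (st (Suc (9 * n)) a) = (if united (9 * n) then Finished
      else if C \<in> periodic_configurations n then Symmetric else Approaching)"
    if a: "a \<in> C" and kn: "knows (9 * n) a"
      and fast: "unaware a \<Longrightarrow> sg a * (P (9 * n) a - P (6 * n) a) \<ge> N" for a
  proof -
    have "mark (st (9 * n) a) = sg a * (P (6 * n) a - int a)"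
      "mode (st (9 * n) a) = (if unaware a then Unaware else Informed)"
      using exploring[OF a, of "9 * n"] al n by auto
    moreover have "next_offset (vw (9 * n) a) (st (9 * n) a) - mark (st (9 * n) a) =
        sg a * (P (9 * n) a - P (6 * n) a)"
      using next_offset_st[OF al a] calculation by (simp add: algebra_simps)
    ultimately show ?thesis
      using mode_Suc[OF al a] clock_st[OF al a] n homes_st[OF al a kn] rotation_symmetric_st[OF al a kn]
        united_total[OF a, of "9 * n"] q9[OF a] fast
      by (cases "unaware a") (simp_all add: next_mode_def Let_def)
  qed
  show "success (9 * n) \<or> \<not> united (9 * n) \<and> (\<forall>a\<in>C. knows (9 * n) a \<and>
      mode (st (Suc (9 * n)) a) = (if C \<in> periodic_configurations n then Symmetric else Approaching))"
  proof (cases "\<exists>a\<in>C. unaware a \<and> sg a * (P (9 * n) a - P (6 * n) a) < N")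
    case True
    then obtain a where a: "a \<in> C" "unaware a" "sg a * (P (9 * n) a - P (6 * n) a) < N" by blast
    have Da: "D q b = sg a" if "6 * n \<le> q" "q < 9 * n" "b \<in> C" for q b
      using D[OF that(1,2) alive_mono[OF al] a(1,2) that(3)] that by simp
    have "N dvd P (9 * n) b - P (9 * n) a" if b: "b \<in> C" for b
    proof (rule ccontr)
      assume "\<not> ?thesis"
      \<comment> \<open>An agent apart from \<open>a\<close> would give \<open>a\<close> more than
        \<open>N\<close> steps in these \<open>3 n\<close> rounds.\<close>
      then have "2 * (sg a * (P (9 * n) a - P (6 * n) a)) \<ge> int (9 * n - 6 * n) - N + 2"
        by (intro one_direction[OF a(1) b _ sg]) (use Da a b in auto)
      then show False using a(3) by simp
    qed
    then have U: "united (9 * n)" by (rule unitedI)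
    have "mode (st (Suc (9 * n)) c) = Finished" if c: "c \<in> C" for c
    proof (cases "unaware c")
      case True
      then have e: "sg c = sg a" using one a c by blast
      then have "N dvd P (6 * n) c - P (6 * n) a"
        using unaware_class(2)[OF a(1,2), of c] c by (simp add: class_of_def)
      then have "P (9 * n) c - P (9 * n) a = P (6 * n) c - P (6 * n) a"
        by (intro merged_stays[OF a(1) c]) (use Da a c in auto)
      then have "P (9 * n) c - P (6 * n) c = P (9 * n) a - P (6 * n) a" by simp
      then show ?thesis using last_exploring_mode[OF al c True] a(3) e by simp
    next
      case False
      have "knows (9 * n) c" by (rule knows_mono[OF informed_knows[OF c False]]) simp
      then show ?thesis using inf[OF c] False U by simp
    qed
    then have "success (9 * n)" unfolding success_def using al united_close[OF U] by blast
    then show ?thesis ..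
  next
    case False
    then have fast: "sg a * (P (9 * n) a - P (6 * n) a) \<ge> N" if "a \<in> C" "unaware a" for a
      using that by force
    have kn: "knows (9 * n) a" if a: "a \<in> C" for a
    proof (cases "unaware a")
      case True
      show ?thesis by (rule tour_knows[OF _ sg fast[OF a True]]) simp
    next
      case False
      show ?thesis by (rule knows_mono[OF informed_knows[OF a False]]) simp
    qed
    show ?thesis
    proof (cases "united (9 * n)")
      case True
      then have "success (9 * n)" unfolding success_def using al united_close inf kn fast by auto
      then show ?thesis ..
    next
      case False
      then show ?thesis using inf kn fast by auto
    qed
  qed
qed

lemma exploration_outcome:
  "(\<exists>r\<le>9 * n. success r) \<or> alive (9 * n) \<and> \<not> united (9 * n) \<and> (\<forall>a\<in>C. knows (9 * n) a \<and>
      mode (st (Suc (9 * n)) a) = (if C \<in> periodic_configurations n then Symmetric else Approaching))"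
proof (cases "\<exists>a\<in>C. \<exists>b\<in>C. unaware a \<and> unaware b \<and> sg a \<noteq> sg b")
  case True
  then show ?thesis using two_unaware_groups by blast
next
  case False
  then show ?thesis using one_unaware_group by blast
qed

end

lemma small_multiple:
  fixes M x :: int
  assumes "M dvd x" "\<bar>x\<bar> < M"
  shows "x = 0"
  using dvd_imp_le_int[of x M] assms by force

text \<open>Setting of a proof by contradiction: any event upon which all agents finish together in
  a gathered position is excluded, so only the uneventful continuation has to be followed.\<close>

locale pursuit = execution +
  assumes unsuccessful: "\<And>r. r \<le> 15 * n \<Longrightarrow> \<not> success r"
    and aperiodic: "C \<notin> periodic_configurations n"
begin

lemma alive_9: "alive (9 * n)" and knows_9: "a \<in> C \<Longrightarrow> knows (9 * n) a"
  and mode_9: "a \<in> C \<Longrightarrow> mode (st (Suc (9 * n)) a) = Approaching"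
proof -
  have "\<not> (\<exists>r\<le>9 * n. success r)"
  proof
    assume "\<exists>r\<le>9 * n. success r"
    then obtain r where "r \<le> 9 * n" "success r" by blast
    then show False using unsuccessful[of r] by simp
  qed
  then show "alive (9 * n)" "a \<in> C \<Longrightarrow> knows (9 * n) a"
    "a \<in> C \<Longrightarrow> mode (st (Suc (9 * n)) a) = Approaching"
    using exploration_outcome aperiodic by auto
qed

lemma knows_late: "a \<in> C \<Longrightarrow> 9 * n \<le> r \<Longrightarrow> knows r a"
  using knows_9 knows_mono by blast

text \<open>Once an agent has visited all nodes, \<open>homes\<close> is \<open>k\<close>, so
  counting its company decides \<open>united\<close>.\<close>

lemma late_mode:
  assumes r: "9 * n < r" and al: "alive r" and a: "a \<in> C" and s: "mode (st r a) \<noteq> Symmetric"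
  shows "mode (st (Suc r) a) =
    (if united r then Finished
     else if r < 10 * n then Approaching
     else if r = 10 * n then (if approach n (bearing n (vw r a) (st r a)) = 0 then Mover else Waiter)
     else if crosses (vw r a) \<or> r = 13 * n \<and> sg a * (P r a - int a) = mark (st r a) \<or> r = 15 * n then Finished
     else if r \<le> 11 * n \<and> idle (vw r a) > 0 then Waiter
     else mode (st r a))"
proof -
  have kn: "knows r a" using knows_late[OF a] r by simp
  show ?thesis
    using mode_Suc[OF al a] clock_st[OF al a] homes_st[OF al a kn] united_total[OF a, of r]
      next_offset_st[OF al a] r s
    by (simp add: next_mode_def Let_def)
qed

lemma not_united:
  assumes r: "9 * n < r" "r \<le> 15 * n" and al: "alive r" and s: "\<And>a. a \<in> C \<Longrightarrow> mode (st r a) \<noteq> Symmetric"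
  shows "\<not> united r"
proof
  assume u: "united r"
  then have "success r"
    unfolding success_def using late_mode[OF r(1) al _ s] united_close[OF u] al by auto
  then show False using unsuccessful r by blast
qed

subsection \<open>Approaching the center\<close>

text \<open>In units of half an edge, \<open>W r a\<close> is the displacement of \<open>a\<close> from the center in its own
  frame, and \<open>Z r a\<close> below is the same in the clockwise frame.\<close>

definition W :: "nat \<Rightarrow> nat \<Rightarrow> int" where
  "W r a = (sg a * (2 * P r a - mid) + N) mod (2 * N) - N"

lemma W_range: "- N \<le> W r a" "W r a < N"
proof -
  have "0 \<le> (sg a * (2 * P r a - mid) + N) mod (2 * N)" "(sg a * (2 * P r a - mid) + N) mod (2 * N) < 2 * N"
    using n by auto
  then show "- N \<le> W r a" "W r a < N" unfolding W_def by linarith+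
qed

lemma W_dvd: "2 * N dvd sg a * (2 * P r a - mid) - W r a"
proof -
  have "2 * N dvd (sg a * (2 * P r a - mid) + N) - (sg a * (2 * P r a - mid) + N) mod (2 * N)"
    by (rule dvd_minus_mod)
  then show ?thesis unfolding W_def by (simp add: algebra_simps)
qed

lemma W_unique:
  assumes "- N \<le> w" "w < N" "2 * N dvd sg a * (2 * P r a - mid) - w"
  shows "W r a = w"
proof -
  have "2 * N dvd (sg a * (2 * P r a - mid) - w) - (sg a * (2 * P r a - mid) - W r a)"
    using assms(3) W_dvd by (rule dvd_diff)
  then have "2 * N dvd W r a - w" by simp
  moreover have "\<bar>W r a - w\<bar> < 2 * N" using W_range[of r a] assms by linarith
  ultimately show ?thesis using small_multiple by fastforce
qed

lemma
  assumes al: "alive r" and a: "a \<in> C" and r: "9 * n \<le> r"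
  shows approach_W: "approach n (bearing n (vw r a) (st r a)) = (if \<bar>W r a\<bar> \<le> 1 then 0 else - sgn (W r a))"
    and departure_W: "departure n (bearing n (vw r a) (st r a)) =
      (if W r a = - 1 then - 1 else if \<bar>W r a\<bar> \<le> 1 then 1 else - sgn (W r a))"
proof -
  have "bearing n (vw r a) (st r a) = W r a mod (2 * N)"
    unfolding bearing_st[OF al a knows_late[OF a r] aperiodic] using W_dvd by (simp add: mod_eq_dvd_iff)
  also have "\<dots> = (if W r a < 0 then W r a + 2 * N else W r a)"
  proof (cases "W r a < 0")
    case True
    then have "(W r a + 2 * N) mod (2 * N) = W r a + 2 * N"
      using W_range[of r a] by (intro mod_pos_pos_trivial) auto
    then show ?thesis using True by simp
  next
    case False
    then show ?thesis using W_range[of r a] by simp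
  qed
  finally have b: "bearing n (vw r a) (st r a) = (if W r a < 0 then W r a + 2 * N else W r a)" .
  have N3: "N \<ge> 3" using n3 by simp
  show "approach n (bearing n (vw r a) (st r a)) = (if \<bar>W r a\<bar> \<le> 1 then 0 else - sgn (W r a))"
    "departure n (bearing n (vw r a) (st r a)) =
      (if W r a = - 1 then - 1 else if \<bar>W r a\<bar> \<le> 1 then 1 else - sgn (W r a))"
    unfolding b approach_def departure_def using W_range[of r a] N3 by (auto simp: sgn_if)
qed

lemma approaching:
  assumes "Suc (9 * n) \<le> r"
  shows "r \<le> 10 * n \<longrightarrow> alive r \<and> (\<forall>a\<in>C. mode (st r a) = Approaching)"
  using assms
proof (induction r rule: dec_induct)
  case base
  then show ?case using mode_9 by (simp add: alive_def)
next
  case (step r)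
  show ?case
  proof
    assume r: "Suc r \<le> 10 * n"
    then have al: "alive r" and md: "\<forall>a\<in>C. mode (st r a) = Approaching" using step by auto
    have "\<not> united r" using not_united[of r] al md step(1) r by simp
    then have "mode (st (Suc r) a) = Approaching" if "a \<in> C" for a
      using late_mode[of r a] al md that step(1) r by simp
    then show "alive (Suc r) \<and> (\<forall>a\<in>C. mode (st (Suc r) a) = Approaching)"
      by (simp add: alive_def)
  qed
qed

lemma approaching_alive: "9 * n \<le> r \<Longrightarrow> r \<le> 10 * n \<Longrightarrow> alive r"
  using approaching[of r] alive_9 by (cases "r = 9 * n") auto

lemma D_approaching:
  assumes r: "9 * n \<le> r" "r < 10 * n" and a: "a \<in> C"
  shows "D r a = (if \<bar>W r a\<bar> \<le> 1 then 0 else - sg a * sgn (W r a))"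
proof -
  have al: "alive r" using approaching_alive r by simp
  have "mode (st (Suc r) a) = Approaching" using approaching[of "Suc r"] r a by simp
  moreover have "heading (st (Suc r) a) = (if \<bar>W r a\<bar> \<le> 1 then 0 else - sgn (W r a))"
    using heading_Suc[OF al a] clock_st[OF al a] approach_W[OF al a r(1)] r
    by (simp add: next_heading_def Let_def)
  ultimately show ?thesis by (simp add: D_def go_def)
qed

text \<open>Agents only move towards the center, so the representative stays in its interval and is
  never reduced modulo \<open>2 * N\<close>.\<close>

lemma W_step:
  assumes r: "9 * n \<le> r" "r < 10 * n" and a: "a \<in> C"
  shows "W (Suc r) a = W r a + 2 * (sg a * V r a)"
proof (rule W_unique)
  have "sg a * V r a = 0 \<or> \<bar>W r a\<bar> \<ge> 2 \<and> sg a * V r a = - sgn (W r a)"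
    using D_approaching[OF r a] V_cases[of r a] by (auto split: if_splits)
  then show "- N \<le> W r a + 2 * (sg a * V r a)" "W r a + 2 * (sg a * V r a) < N"
    using W_range[of r a] by (auto simp: sgn_if split: if_splits)
  show "2 * N dvd sg a * (2 * P (Suc r) a - mid) - (W r a + 2 * (sg a * V r a))"
    using W_dvd[of a r] by (simp add: P_Suc algebra_simps)
qed

text \<open>An agent stops on reaching the center and never passes it, so being far at the end means
  having been far on the same side all along.\<close>

lemma W_far:
  assumes "r \<le> 10 * n" "9 * n \<le> r" and a: "a \<in> C" and far: "\<bar>W (10 * n) a\<bar> \<ge> 2"
  shows "\<bar>W r a\<bar> \<ge> 2 \<and> sgn (W r a) = sgn (W (10 * n) a)"
  using assms(1,2)
proof (induction r rule: inc_induct)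
  case base
  then show ?case using far by simp
next
  case (step r)
  then have IH: "\<bar>W (Suc r) a\<bar> \<ge> 2" "sgn (W (Suc r) a) = sgn (W (10 * n) a)" by auto
  have r: "9 * n \<le> r" "r < 10 * n" using step by auto
  have "V r a = 0 \<or> \<bar>W r a\<bar> \<ge> 2 \<and> sg a * V r a = - sgn (W r a)"
    using D_approaching[OF r a] V_cases[of r a] by (auto split: if_splits)
  then show ?case using W_step[OF r a] IH by (auto simp: sgn_if split: if_splits)
qed

lemma W_progress:
  assumes "9 * n \<le> r" and a: "a \<in> C"
  shows "r \<le> 10 * n \<longrightarrow> W r a = W (9 * n) a + 2 * (sg a * (P r a - P (9 * n) a))"
  using assms(1)
proof (induction r rule: dec_induct)
  case (step r)
  then show ?case using W_step[of r a] a by (auto simp: P_Suc algebra_simps)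
qed simp

definition Z :: "nat \<Rightarrow> nat \<Rightarrow> int" where
  "Z r a = sg a * W r a"

lemma Z_dvd: "2 * N dvd 2 * P r a - mid - Z r a"
proof -
  have "2 * N dvd sg a * (sg a * (2 * P r a - mid) - W r a)" using W_dvd by (rule dvd_mult)
  then show ?thesis by (simp add: Z_def right_diff_distrib)
qed

lemma Z_range: "\<bar>Z r a\<bar> = \<bar>W r a\<bar>" "\<bar>Z r a\<bar> \<le> N"
  using sg[of a] W_range[of r a] by (auto simp: Z_def)

lemma Z_diff: "2 * N dvd 2 * (P r b - P r a) - (Z r b - Z r a)"
proof -
  have "2 * N dvd (2 * P r b - mid - Z r b) - (2 * P r a - mid - Z r a)" using Z_dvd Z_dvd by (rule dvd_diff)
  then show ?thesis by (simp add: algebra_simps)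
qed

lemma Z_cong:
  assumes "N dvd P r b - P r a - x"
  shows "2 * N dvd Z r b - Z r a - 2 * x"
proof -
  have "2 * N dvd 2 * (P r b - P r a - x)" using assms by (rule mult_dvd_mono[OF dvd_refl])
  then have "2 * N dvd 2 * (P r b - P r a - x) - (2 * (P r b - P r a) - (Z r b - Z r a))"
    using Z_diff by (rule dvd_diff)
  then show ?thesis by (simp add: algebra_simps)
qed

text \<open>Two agents that are still on their way are never blocked by the same edge unless they
  are together, so that a delay of \<open>n\<close> rounds suffices for one of them to arrive.\<close>

lemma late_agents_merged:
  assumes a: "a \<in> C" and b: "b \<in> C" and far: "\<bar>W (10 * n) a\<bar> \<ge> 2" "\<bar>W (10 * n) b\<bar> \<ge> 2"
  shows "N dvd P (10 * n) b - P (10 * n) a \<and> sg a * sgn (W (10 * n) a) = sg b * sgn (W (10 * n) b)"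
proof (rule ccontr)
  assume contra: "\<not> ?thesis"
  define d e where "d = - sg a * sgn (W (10 * n) a)" and "e = - sg b * sgn (W (10 * n) b)"
  have d: "d = 1 \<or> d = - 1" and e: "e = 1 \<or> e = - 1"
    using sg[of a] sg[of b] far by (auto simp: d_def e_def sgn_if)
  have D: "D r a = d" "D r b = e" if "9 * n \<le> r" "r < 10 * n" for r
    using D_approaching[OF that a] D_approaching[OF that b] W_far[OF _ that(1) a far(1)] W_far[OF _ that(1) b far(2)] that
    by (auto simp: d_def e_def)
  have ZD: "sgn (Z r a) = - d" "sgn (Z r b) = - e" "\<bar>Z r a\<bar> \<ge> 2" "\<bar>Z r b\<bar> \<ge> 2"
    if "9 * n \<le> r" "r < 10 * n" for r
    using W_far[OF _ that(1) a far(1)] W_far[OF _ that(1) b far(2)] that sg[of a] sg[of b] Z_range(1)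
    by (auto simp: Z_def d_def e_def sgn_mult)
  have free: "\<not> (V r a = 0 \<and> V r b = 0)" if r: "9 * n \<le> r" "r < 10 * n" for r
  proof
    assume "V r a = 0 \<and> V r b = 0"
    then consider "d = e" "N dvd P r b - P r a" | "e = - d" "N dvd P r b - P r a - d"
      using both_blocked[OF a b, of r] D[OF r] d e by auto
    then show False
    proof cases
      case 1
      then have "P (10 * n) b - P (10 * n) a = P r b - P r a"
        using merged_stays[OF a b, of r "10 * n"] D r by simp
      then have "N dvd P (10 * n) b - P (10 * n) a" using 1 by simp
      then show False using contra 1 by (simp add: d_def e_def)
    next
      case 2
      have dv: "2 * N dvd Z r b - Z r a - 2 * d" using Z_cong[OF 2(2)] .
      have "\<bar>Z r a\<bar> \<le> N" "\<bar>Z r b\<bar> \<le> N" using Z_range by auto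
      \<comment> \<open>For \<open>d = 1\<close>, \<open>a\<close> is at \<open>- 2\<close> or below
        and \<open>b\<close> at 2 or above. Their difference lies in \<open>4 .. 2 * N\<close> and
        is not congruent to 2; the case \<open>d = - 1\<close> is the mirror image.\<close>
      then have "\<bar>Z r b - Z r a - 2 * d\<bar> < 2 * N" "Z r b - Z r a - 2 * d \<noteq> 0"
        using ZD[OF r] 2(1) d by (auto simp: sgn_if split: if_splits)
      then show False using small_multiple[OF dv] by blast
    qed
  qed
  have "d * (P (10 * n) a - P (9 * n) a) + e * (P (10 * n) b - P (9 * n) b) \<ge> int (10 * n - 9 * n)"
    by (rule joint_progress[OF a b _ d e D free]) auto
  \<comment> \<open>The displacement goes down from at most \<open>N\<close> to at least 2 half
    edges, by two per step. The same holds for \<open>b\<close>, so together they make fewer than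
    \<open>n\<close> steps.\<close>
  moreover have "2 * (d * (P (10 * n) a - P (9 * n) a)) \<le> N - 2"
    using W_progress[OF _ a, of "10 * n"] W_far[of "9 * n" a] a far(1) W_range[of "9 * n" a]
    by (auto simp: d_def sgn_if algebra_simps split: if_splits)
  moreover have "2 * (e * (P (10 * n) b - P (9 * n) b)) \<le> N - 2"
    using W_progress[OF _ b, of "10 * n"] W_far[of "9 * n" b] b far(2) W_range[of "9 * n" b]
    by (auto simp: e_def sgn_if algebra_simps split: if_splits)
  ultimately show False by simp
qed

definition course :: "nat \<Rightarrow> int" where
  "course a = sg a * (if W (10 * n) a = - 1 then - 1 else if \<bar>W (10 * n) a\<bar> \<le> 1 then 1 else - sgn (W (10 * n) a))"

lemma course: "course a = 1 \<or> course a = - 1"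
  using sg[of a] by (auto simp: course_def sgn_if)

lemma turning:
  "alive (Suc (10 * n))" "\<not> united (10 * n)"
  "a \<in> C \<Longrightarrow> mode (st (Suc (10 * n)) a) = (if \<bar>W (10 * n) a\<bar> \<le> 1 then Mover else Waiter)"
  "a \<in> C \<Longrightarrow> sg a * heading (st (Suc (10 * n)) a) = course a"
proof -
  have al: "alive (10 * n)" and md: "\<And>a. a \<in> C \<Longrightarrow> mode (st (10 * n) a) = Approaching"
    using approaching[of "10 * n"] n by auto
  show nu: "\<not> united (10 * n)" using not_united[of "10 * n"] al md n by simp
  have m: "mode (st (Suc (10 * n)) a) = (if \<bar>W (10 * n) a\<bar> \<le> 1 then Mover else Waiter)" if a: "a \<in> C" for a
    using late_mode[OF _ al a] md[OF a] nu approach_W[OF al a] n by (simp add: sgn_if)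
  then show "a \<in> C \<Longrightarrow> mode (st (Suc (10 * n)) a) = (if \<bar>W (10 * n) a\<bar> \<le> 1 then Mover else Waiter)" .
  show "alive (Suc (10 * n))" using m by (simp add: alive_def)
  show "sg a * heading (st (Suc (10 * n)) a) = course a" if a: "a \<in> C"
    using heading_Suc[OF al a] clock_st[OF al a] departure_W[OF al a] n
    by (simp add: next_heading_def Let_def course_def)
qed

text \<open>All displacements in half edges have the parity of \<open>mid\<close>. By the choice of
  \<open>departure\<close>, those of central agents with the same course differ by at most 1, hence
  coincide.\<close>

lemma movers_merged:
  assumes a: "a \<in> C" "\<bar>W (10 * n) a\<bar> \<le> 1" and b: "b \<in> C" "\<bar>W (10 * n) b\<bar> \<le> 1" and ab: "course a = course b"
  shows "N dvd P (10 * n) b - P (10 * n) a"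
proof -
  have z: "\<bar>Z (10 * n) b - Z (10 * n) a\<bar> \<le> 1"
    using assms sg[of a] sg[of b] by (auto simp: course_def Z_def abs_if split: if_splits)
  obtain q where q: "2 * (P (10 * n) b - P (10 * n) a) - (Z (10 * n) b - Z (10 * n) a) = 2 * N * q"
    using Z_diff by (meson dvdE)
  have "Z (10 * n) b - Z (10 * n) a = 2 * (P (10 * n) b - P (10 * n) a - N * q)" using q by (simp add: algebra_simps)
  then have "Z (10 * n) b - Z (10 * n) a = 0" using z by presburger
  then have "P (10 * n) b - P (10 * n) a = N * q" using q by simp
  then show ?thesis by simp
qed

subsection \<open>Marching\<close>

lemma D_march:
  assumes "alive (Suc q)" "a \<in> C" "mode (st (Suc q) a) = Mover \<or> mode (st (Suc q) a) = Waiter \<and> 11 * n \<le> q"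
    "sg a * heading (st (Suc q) a) = d" "d = 1 \<or> d = - 1"
  shows "D q a = d"
proof -
  have "heading (st (Suc q) a) = sg a * d" using assms(4) sg_sq(2)[of a "heading (st (Suc q) a)"] by metis
  then show ?thesis
    using assms clock_st[OF assms(1,2)] sg[of a] by (auto simp: D_def go_def)
qed

text \<open>Nobody is idle, and a union would be a success; so would a crossing of two merged
  groups, while agents with a common direction cannot cross. So nothing changes modes or headings.
  Round \<open>13 n\<close> may only be an end of the interval, as agents may turn or finish
  there.\<close>

lemma march:
  assumes t: "10 * n \<le> t" and u: "t < u" "u \<le> 15 * n" "\<not> (t < 13 * n \<and> 13 * n < u)"
    and al: "alive (Suc t)"
    and state: "\<forall>a\<in>C. (M a = Mover \<or> M a = Waiter \<and> 11 * n \<le> t) \<and> mode (st (Suc t) a) = M a \<and>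
      sg a * heading (st (Suc t) a) = \<delta> a \<and> (\<delta> a = 1 \<or> \<delta> a = - 1)"
    and m: "(\<forall>a\<in>C. \<forall>b\<in>C. \<delta> a = \<delta> b \<longrightarrow> N dvd P t b - P t a) \<or> (\<forall>a\<in>C. \<forall>b\<in>C. \<delta> a = \<delta> b)"
    and r: "t < r" "r \<le> u"
  shows "alive r" "a \<in> C \<Longrightarrow> mode (st r a) = M a" "a \<in> C \<Longrightarrow> sg a * heading (st r a) = \<delta> a"
    "a \<in> C \<Longrightarrow> \<not> crosses (vw r a)" "\<not> united r" "a \<in> C \<Longrightarrow> t \<le> q \<Longrightarrow> q < u \<Longrightarrow> D q a = \<delta> a"
proof -
  have M: "M a = Mover \<or> M a = Waiter \<and> 11 * n \<le> t" and md: "mode (st (Suc t) a) = M a"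
    and hd: "sg a * heading (st (Suc t) a) = \<delta> a" and \<delta>: "\<delta> a = 1 \<or> \<delta> a = - 1" if "a \<in> C" for a
    using state that by blast+
  define Q where "Q r \<longleftrightarrow> alive r \<and> (\<forall>a\<in>C. mode (st r a) = M a \<and> sg a * heading (st r a) = \<delta> a)" for r
  have QD: "D q a = \<delta> a" if "Q (Suc q)" "t \<le> q" "a \<in> C" for q a
  proof (rule D_march[OF _ that(3)])
    show "mode (st (Suc q) a) = Mover \<or> mode (st (Suc q) a) = Waiter \<and> 11 * n \<le> q"
      using that M[OF that(3)] by (auto simp: Q_def)
  qed (use that \<delta> in \<open>auto simp: Q_def\<close>)
  have quiet: "(\<forall>a\<in>C. \<not> crosses (vw r a)) \<and> \<not> united r"
    if r: "t < r" "r \<le> u" and Q: "\<And>q. t < q \<Longrightarrow> q \<le> r \<Longrightarrow> Q q" for r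
  proof -
    obtain q where q: "r = Suc q" "t \<le> q" using r by (metis less_imp_Suc_add le_add1)
    have D: "D i a = \<delta> a" if "t \<le> i" "i < r" "a \<in> C" for i a
      using QD[OF Q, of i a] that by simp
    have ns: "mode (st r a) \<noteq> Symmetric" if "a \<in> C" for a
      using Q[of r] r M[OF that] that by (auto simp: Q_def)
    have alr: "alive r" using Q[of r] r by (simp add: Q_def)
    have r9: "9 * n < r" "10 * n < r" using r t by auto
    have nu: "\<not> united r" using not_united[OF r9(1) _ alr ns] r u by simp
    have "\<not> crosses (vw r a)" if a: "a \<in> C" for a
    proof
      assume cr: "crosses (vw r a)"
      from m show False
      proof
        assume m: "\<forall>a\<in>C. \<forall>b\<in>C. \<delta> a = \<delta> b \<longrightarrow> N dvd P t b - P t a"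
        have mq: "N dvd P q c - P q b" if "b \<in> C" "c \<in> C" "\<delta> b = \<delta> c" for b c
        proof (rule merged_classes[where \<delta> = \<delta>, OF q(2) _ _ that])
          show "D i a = \<delta> a" if "t \<le> i" "i < q" "a \<in> C" for i a
            by (rule D) (use that q in auto)
        qed (use m in blast)
        have "\<forall>c\<in>C. crosses (vw (Suc q) c)" "close (Suc q)"
        proof -
          have Dq: "D q c = \<delta> c" if "c \<in> C" for c by (rule D) (use that q in auto)
          have cr': "crosses (vw (Suc q) a)" using cr q(1) by simp
          show "\<forall>c\<in>C. crosses (vw (Suc q) c)"
            by (rule two_step(1)[where \<delta> = \<delta> and r = q and a = a]) (use Dq \<delta> mq a cr' in blast)+
          show "close (Suc q)"
            by (rule two_step(2)[where \<delta> = \<delta> and r = q and a = a]) (use Dq \<delta> mq a cr' in blast)+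
        qed
        then have cl: "\<forall>c\<in>C. crosses (vw r c)" "close r" using q by auto
        have "mode (st (Suc r) c) = Finished" if "c \<in> C" for c
          using late_mode[OF r9(1) alr that ns[OF that]] r9 cl(1) that by simp
        then have "success r" unfolding success_def using alr cl(2) by blast
        then show False using unsuccessful[of r] r u by simp
      next
        assume e: "\<forall>a\<in>C. \<forall>b\<in>C. \<delta> a = \<delta> b"
        obtain b where b: "b \<in> C" "V q a \<noteq> 0" "V q b = - V q a"
          using cr crosses_vw[OF a, of q] q by blast
        have "\<delta> b = \<delta> a" using e a b(1) by blast
        then have "D q a = \<delta> a" "D q b = \<delta> a" using D[of q a] D[of q b] q a b(1) by auto
        then show False using b V_cases[of q a] V_cases[of q b] by auto
      qed
    qed
    then show ?thesis using nu by blast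
  qed
  have "r \<le> u \<longrightarrow> (\<forall>q. t < q \<longrightarrow> q \<le> r \<longrightarrow> Q q)" if "Suc t \<le> r" for r
    using that
  proof (induction r rule: dec_induct)
    case base
    have "Q (Suc t)" using al md hd by (simp add: Q_def)
    then show ?case by (metis Suc_leI le_antisym)
  next
    case (step r)
    show ?case
    proof
      assume ru: "Suc r \<le> u"
      then have Qs: "\<And>q. t < q \<Longrightarrow> q \<le> r \<Longrightarrow> Q q" using step by simp
      have tr: "t < r" using step by simp
      have qr: "(\<forall>a\<in>C. \<not> crosses (vw r a)) \<and> \<not> united r" by (rule quiet) (use tr ru Qs in auto)
      have Qr: "Q r" using Qs[of r] tr by simp
      then have alr: "alive r" by (simp add: Q_def)
      obtain q where q: "r = Suc q" "t \<le> q" using tr by (metis less_imp_Suc_add le_add1)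
      have r9: "9 * n < r" "\<not> r < 10 * n" "r \<noteq> 10 * n" "r \<noteq> 13 * n" "r \<noteq> 15 * n" using tr t ru u by auto
      have idle: "idle (vw r a) = 0" if "a \<in> C" for a
      proof -
        have "D q b \<noteq> 0" if "b \<in> C" for b
          using QD[OF _ q(2) that] Qr q(1) \<delta>[OF that] by auto
        then have "{b \<in> mates (Suc q) a. D q b = 0} = {}" by (auto simp: mates_def)
        then show ?thesis unfolding q(1) idle_vw[OF that] by simp
      qed
      have "mode (st (Suc r) a) = M a \<and> sg a * heading (st (Suc r) a) = \<delta> a" if a: "a \<in> C" for a
      proof
        have mr: "mode (st r a) = M a" "sg a * heading (st r a) = \<delta> a" using Qr a by (auto simp: Q_def)
        have "mode (st r a) \<noteq> Symmetric" using mr M[OF a] by auto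
        then show "mode (st (Suc r) a) = M a"
          using late_mode[OF r9(1) alr a] r9 qr a idle[OF a] mr(1) by simp
        have "M a = Waiter \<Longrightarrow> \<not> r \<le> 11 * n" using M[OF a] tr by auto
        then have "heading (st (Suc r) a) = heading (st r a)"
          using heading_Suc[OF alr a] clock_st[OF alr a] r9 mr(1) by (auto simp: next_heading_def Let_def)
        then show "sg a * heading (st (Suc r) a) = \<delta> a" using mr by simp
      qed
      moreover from this have "alive (Suc r)" using M by (fastforce simp: alive_def)
      ultimately have "Q (Suc r)" by (simp add: Q_def)
      then show "\<forall>q. t < q \<longrightarrow> q \<le> Suc r \<longrightarrow> Q q" using Qs by (metis le_Suc_eq)
    qed
  qed
  then have Q: "Q q" if "t < q" "q \<le> u" for q using that u by (metis Suc_leI order_refl)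
  show "alive r" "a \<in> C \<Longrightarrow> mode (st r a) = M a" "a \<in> C \<Longrightarrow> sg a * heading (st r a) = \<delta> a"
    using Q[OF r] by (auto simp: Q_def)
  show "a \<in> C \<Longrightarrow> \<not> crosses (vw r a)" "\<not> united r"
    using quiet[OF r] Q r by auto
  show "a \<in> C \<Longrightarrow> t \<le> q \<Longrightarrow> q < u \<Longrightarrow> D q a = \<delta> a" using QD[of q a] Q[of "Suc q"] by simp
qed

lemma mark_late:
  assumes a: "a \<in> C" and r: "Suc (12 * n) \<le> r"
  shows "r \<le> 13 * n \<longrightarrow> alive r \<longrightarrow> mark (st r a) = sg a * (P (12 * n) a - int a)"
  using r
proof (induction r rule: dec_induct)
  case base
  show ?case
  proof (intro impI)
    assume "alive (Suc (12 * n))"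
    then have al: "alive (12 * n)" by (rule alive_Suc)
    then show "mark (st (Suc (12 * n)) a) = sg a * (P (12 * n) a - int a)"
      using mark_Suc[OF al a] clock_st[OF al a] next_offset_st[OF al a] by (simp add: next_mark_def)
  qed
next
  case (step r)
  show ?case
  proof (intro impI)
    assume "Suc r \<le> 13 * n" "alive (Suc r)"
    moreover from this have al: "alive r" by (simp add: alive_Suc)
    ultimately show "mark (st (Suc r) a) = sg a * (P (12 * n) a - int a)"
      using mark_Suc[OF al a] clock_st[OF al a] step by (simp add: next_mark_def)
  qed
qed

text \<open>Facing groups stand still from round \<open>t + n\<close> on. For
  \<open>u = 13 n\<close> this includes all rounds since \<open>12 n\<close>, so everybody finishes
  by the test on \<open>mark\<close>; in round \<open>15 n\<close> everybody finishes anyway. Either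
  way round \<open>u\<close> would be a success.\<close>

lemma no_two_groups:
  assumes t: "10 * n \<le> t" "t \<le> 11 * n \<and> u = 13 * n \<or> t = 13 * n \<and> u = 15 * n"
    and al: "alive (Suc t)"
    and M: "\<And>a. a \<in> C \<Longrightarrow> M a = Mover \<or> M a = Waiter \<and> 11 * n \<le> t"
    and md: "\<And>a. a \<in> C \<Longrightarrow> mode (st (Suc t) a) = M a"
    and hd: "\<And>a. a \<in> C \<Longrightarrow> sg a * heading (st (Suc t) a) = \<delta> a"
    and \<delta>: "\<And>a. a \<in> C \<Longrightarrow> \<delta> a = 1 \<or> \<delta> a = - 1"
    and m: "\<And>a b. a \<in> C \<Longrightarrow> b \<in> C \<Longrightarrow> \<delta> a = \<delta> b \<Longrightarrow> N dvd P t b - P t a"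
  shows False
proof -
  have u: "t < u" "u \<le> 15 * n" "\<not> (t < 13 * n \<and> 13 * n < u)" "t + n \<le> u" using t n by auto
  have m': "(\<forall>a\<in>C. \<forall>b\<in>C. \<delta> a = \<delta> b \<longrightarrow> N dvd P t b - P t a) \<or> (\<forall>a\<in>C. \<forall>b\<in>C. \<delta> a = \<delta> b)" using m by blast
  have state: "\<forall>a\<in>C. (M a = Mover \<or> M a = Waiter \<and> 11 * n \<le> t) \<and> mode (st (Suc t) a) = M a \<and>
      sg a * heading (st (Suc t) a) = \<delta> a \<and> (\<delta> a = 1 \<or> \<delta> a = - 1)"
    using M md hd \<delta> by blast
  note mar = march[of t u M \<delta>, OF t(1) u(1-3) al state m']
  have stuck: "close u" "\<And>a r. a \<in> C \<Longrightarrow> t + n \<le> r \<Longrightarrow> r \<le> u \<Longrightarrow> P r a = P u a"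
    by (rule two_groups_stuck[where \<delta> = \<delta> and t = t and u = u];
        use u(4) mar(6)[OF u(1) order_refl] mar(4,5) \<delta> m in blast)+
  have alu: "alive u" using mar(1)[OF u(1)] by simp
  have mu: "mode (st u a) = M a" if "a \<in> C" for a using mar(2)[OF u(1) _ that] by simp
  have nu: "\<not> united u" using mar(5)[OF u(1)] by simp
  have "mode (st (Suc u) a) = Finished" if a: "a \<in> C" for a
  proof -
    have "mode (st u a) \<noteq> Symmetric" using mu[OF a] M[OF a] by auto
    moreover have "u = 13 * n \<Longrightarrow> sg a * (P u a - int a) = mark (st u a)"
      using mark_late[OF a, of u] alu stuck(2)[OF a, of "12 * n"] t n by auto
    ultimately show ?thesis using late_mode[OF _ alu a] t n nu by auto
  qed
  then have "success u" unfolding success_def using alu stuck(1) by blast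
  then show False using unsuccessful u(2) by blast
qed

text \<open>Without late agents, all agents leave the center as at most two merged groups with
  opposite courses, as in \<open>no_two_groups\<close>.\<close>

lemma some_waiter: "\<exists>w\<in>C. \<bar>W (10 * n) w\<bar> \<ge> 2"
proof (rule ccontr)
  assume "\<not> ?thesis"
  then have W: "\<bar>W (10 * n) a\<bar> \<le> 1" if "a \<in> C" for a using that by force
  show False
  proof (rule no_two_groups[of "10 * n" "13 * n" "\<lambda>_. Mover" course])
    show "mode (st (Suc (10 * n)) a) = Mover" if "a \<in> C" for a using turning(3)[OF that] W[OF that] by simp
    show "N dvd P (10 * n) b - P (10 * n) a" if "a \<in> C" "b \<in> C" "course a = course b" for a b
      by (rule movers_merged[OF that(1) W[OF that(1)] that(2) W[OF that(2)] that(3)])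
  qed (use turning course in auto)
qed

end

subsection \<open>Searching for the late agents\<close>

locale chase = pursuit +
  fixes w :: nat
  assumes w: "w \<in> C" "\<bar>W (10 * n) w\<bar> \<ge> 2"
begin

definition m :: int where
  "m = P (10 * n) w"

definition arrived :: "nat \<Rightarrow> nat \<Rightarrow> bool" where
  "arrived r a \<longleftrightarrow> N dvd P r a - m"

text \<open>A mover is at most one half edge from the center and the late group between 2 and
  \<open>N\<close>, so their displacements differ modulo \<open>2 * N\<close>.\<close>

lemma arrived_start: "a \<in> C \<Longrightarrow> arrived (10 * n) a \<longleftrightarrow> \<bar>W (10 * n) a\<bar> \<ge> 2"
proof
  assume a: "a \<in> C" and "\<bar>W (10 * n) a\<bar> \<ge> 2"
  then show "arrived (10 * n) a" using late_agents_merged[OF w(1) a w(2)] by (simp add: arrived_def m_def)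
next
  assume a: "a \<in> C" and "arrived (10 * n) a"
  then have "2 * N dvd Z (10 * n) a - Z (10 * n) w"
    using Z_cong[of "10 * n" a w 0] by (simp add: arrived_def m_def)
  moreover have "\<bar>Z (10 * n) w\<bar> \<ge> 2" "\<bar>Z (10 * n) w\<bar> \<le> N" using w(2) Z_range by simp_all
  moreover have "N \<ge> 3" using n3 by simp
  ultimately have "\<bar>Z (10 * n) a\<bar> \<ge> 2"
    using small_multiple[of "2 * N" "Z (10 * n) a - Z (10 * n) w"] by linarith
  then show "\<bar>W (10 * n) a\<bar> \<ge> 2" using Z_range by simp
qed

lemma arrived_together: "arrived r a \<Longrightarrow> arrived r b \<Longrightarrow> N dvd P r b - P r a"
  unfolding arrived_def using dvd_diff[of N "P r b - m" "P r a - m"] by simp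

lemma arrived_cong: "N dvd P r b - P r a \<Longrightarrow> arrived r a \<longleftrightarrow> arrived r b"
  unfolding arrived_def using dvd_add_right_iff[of N "P r b - P r a" "P r a - m"] by simp

text \<open>Speaks of the motion only, so that the facts on positions are available inside the
  induction that establishes the modes.\<close>

definition search_law :: "nat \<Rightarrow> bool" where
  "search_law r \<longleftrightarrow> (\<forall>q a. 10 * n \<le> q \<longrightarrow> q < r \<longrightarrow> a \<in> C \<longrightarrow> D q a = (if arrived q a then 0 else course a))"

lemma arrived_fixed:
  assumes l: "search_law r" and a: "a \<in> C" and q: "10 * n \<le> q" "q \<le> q'" and arrived: "arrived q a"
  shows "q' \<le> r \<longrightarrow> P q' a = P q a"
  using q(2)
proof (induction q' rule: dec_induct)
  case (step i)
  show ?case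
  proof
    assume i: "Suc i \<le> r"
    then have e: "P i a = P q a" using step by simp
    then have "arrived i a" using arrived by (simp add: arrived_def)
    then have "D i a = 0" using l i step q a by (auto simp: search_law_def)
    then show "P (Suc i) a = P q a" using e V_cases[of i a] by (auto simp: P_Suc)
  qed
qed simp

lemma arrived_stays:
  "search_law r \<Longrightarrow> a \<in> C \<Longrightarrow> 10 * n \<le> q \<Longrightarrow> q \<le> q' \<Longrightarrow> q' \<le> r \<Longrightarrow> arrived q a \<Longrightarrow> arrived q' a"
  using arrived_fixed[of r a q q'] by (simp add: arrived_def)

lemma movers_together:
  assumes l: "search_law r" and a: "a \<in> C" "\<not> arrived (10 * n) a" and b: "b \<in> C" "\<not> arrived (10 * n) b"
    and ab: "course a = course b" and q: "10 * n \<le> q"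
  shows "q \<le> r \<longrightarrow> N dvd P q b - P q a"
  using q
proof (induction q rule: dec_induct)
  case base
  show ?case using movers_merged[OF a(1) _ b(1) _ ab] arrived_start a b by simp
next
  case (step i)
  show ?case
  proof
    assume i: "Suc i \<le> r"
    then have d: "N dvd P i b - P i a" using step by simp
    have "D i a = D i b"
      using l i step(1) a(1) b(1) ab arrived_cong[OF d] by (simp add: search_law_def)
    then have "V i a = V i b" using same_V[OF a(1) b(1) _ d] by simp
    then show "N dvd P (Suc i) b - P (Suc i) a" using d by (simp add: P_Suc)
  qed
qed

text \<open>\<open>x\<close> is the clockwise distance from the start of \<open>a\<close> to the
  waiting group and \<open>y\<close> the one from that group to the start of \<open>b\<close>. The
  agents leave the center on different sides or from the same node, so the searched arcs do not
  overlap and \<open>x + y \<le> N\<close>. The remaining distances stay positive because reaching 0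
  would be an arrival.\<close>

lemma gap:
  assumes l: "search_law r" and r: "10 * n \<le> r" and a: "a \<in> C" "\<not> arrived r a" "course a = 1"
    and b: "b \<in> C" "\<not> arrived r b" "course b = - 1"
  obtains x y where "x + y \<le> N" "\<And>q. 10 * n \<le> q \<Longrightarrow> q \<le> r \<Longrightarrow>
      1 \<le> x - (P q a - P (10 * n) a) \<and> P q a \<ge> P (10 * n) a \<and>
      1 \<le> y + (P q b - P (10 * n) b) \<and> P q b \<le> P (10 * n) b \<and>
      N dvd P q b - P q a - (x - (P q a - P (10 * n) a)) - (y + (P q b - P (10 * n) b))"
proof -
  let ?Z = "Z (10 * n)"
  have nat: "\<not> arrived q a" "\<not> arrived q b" if "10 * n \<le> q" "q \<le> r" for q
    using arrived_stays[OF l a(1) that(1,2)] arrived_stays[OF l b(1) that(1,2)] a(2) b(2) by auto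
  have Wab: "\<bar>W (10 * n) a\<bar> \<le> 1" "\<bar>W (10 * n) b\<bar> \<le> 1"
    using arrived_start[OF a(1)] arrived_start[OF b(1)] nat[of "10 * n"] r by auto
  have Zab: "?Z a = 0 \<or> ?Z a = 1" "?Z b = 0 \<or> ?Z b = - 1"
    using Wab a(3) b(3) sg[of a] sg[of b] by (auto simp: Z_def course_def abs_if split: if_splits)
  \<comment> \<open>The displacement of the waiting group counted clockwise from the center, which
    places it ahead of \<open>a\<close>.\<close>
  define z where "z = (if ?Z w > 0 then ?Z w else ?Z w + 2 * N)"
  have z: "2 \<le> z" "z \<le> 2 * N - 2" "2 * N dvd z - ?Z w"
    using w(2) Z_range[of "10 * n" w] n3 by (auto simp: z_def)
  have "2 * N dvd 2 * (m - P (10 * n) a) - (?Z w - ?Z a)" unfolding m_def by (rule Z_diff)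
  then have "2 * N dvd 2 * (m - P (10 * n) a) - (?Z w - ?Z a) - (z - ?Z w)" using z(3) by (rule dvd_diff)
  then obtain i where i: "2 * (m - P (10 * n) a) - (?Z w - ?Z a) - (z - ?Z w) = 2 * N * i" by (rule dvdE)
  have "2 * N dvd 2 * (P (10 * n) b - m) - (?Z b - ?Z w)" unfolding m_def by (rule Z_diff)
  then have "2 * N dvd 2 * (P (10 * n) b - m) - (?Z b - ?Z w) + (z - ?Z w)" using z(3) by (rule dvd_add)
  then obtain j where j: "2 * (P (10 * n) b - m) - (?Z b - ?Z w) + (z - ?Z w) = 2 * N * j" by (rule dvdE)
  \<comment> \<open>\<open>i\<close> and \<open>j\<close> select the lifts for which
    \<open>2 * x\<close> and \<open>2 * y\<close> are exactly \<open>z - ?Z a\<close> and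
    \<open>?Z b - z + 2 * N\<close>.\<close>
  define x y where "x = m - P (10 * n) a - N * i" and "y = P (10 * n) b - m - N * j + N"
  have "2 * x = z - ?Z a" "2 * y = ?Z b - z + 2 * N"
    using i j by (simp_all add: x_def y_def algebra_simps)
  then have xy: "1 \<le> x" "1 \<le> y" "x + y \<le> N" using z Zab by auto
  have "q \<le> r \<longrightarrow> 1 \<le> x - (P q a - P (10 * n) a) \<and> P q a \<ge> P (10 * n) a \<and>
      1 \<le> y + (P q b - P (10 * n) b) \<and> P q b \<le> P (10 * n) b" if "10 * n \<le> q" for q
    using that
  proof (induction q rule: dec_induct)
    case base
    then show ?case using xy by simp
  next
    case (step q)
    show ?case
    proof
      assume q: "Suc q \<le> r"
      then have "D q a = 1" "D q b = - 1"
        using l nat[of q] step(1) a b by (auto simp: search_law_def)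
      then have V: "V q a = 0 \<or> V q a = 1" "V q b = 0 \<or> V q b = - 1"
        using V_cases[of q a] V_cases[of q b] by auto
      have na: "\<not> N dvd P (Suc q) a - m" "\<not> N dvd P (Suc q) b - m"
        using nat[of "Suc q"] q step(1) by (auto simp: arrived_def)
      have "x - (P (Suc q) a - P (10 * n) a) \<noteq> 0"
      proof
        assume "x - (P (Suc q) a - P (10 * n) a) = 0"
        then have "P (Suc q) a - m = N * (- i)" by (simp add: x_def)
        then show False using na(1) by (metis dvd_triv_left)
      qed
      moreover have "y + (P (Suc q) b - P (10 * n) b) = (P (Suc q) b - m) - N * (j - 1)"
        by (simp add: y_def algebra_simps)
      then have "y + (P (Suc q) b - P (10 * n) b) \<noteq> 0"
        using na(2) by (metis dvd_triv_left eq_iff_diff_eq_0)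
      ultimately show "1 \<le> x - (P (Suc q) a - P (10 * n) a) \<and> P (Suc q) a \<ge> P (10 * n) a \<and>
          1 \<le> y + (P (Suc q) b - P (10 * n) b) \<and> P (Suc q) b \<le> P (10 * n) b"
        using step q V by (auto simp: P_Suc)
    qed
  qed
  moreover have "N dvd P q b - P q a - (x - (P q a - P (10 * n) a)) - (y + (P q b - P (10 * n) b))" for q
  proof -
    have "P q b - P q a - (x - (P q a - P (10 * n) a)) - (y + (P q b - P (10 * n) b)) = N * (i + j - 1)"
      by (simp add: x_def y_def algebra_simps)
    then show ?thesis by simp
  qed
  ultimately show thesis using that[of x y] xy(3) by blast
qed

text \<open>The waiting group lies strictly between \<open>a\<close> and \<open>b\<close>, so their
  clockwise distance is at least 2 and at most \<open>N\<close>. Hence they neither cross nor are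
  blocked at the two ends of one edge.\<close>

lemma never_adjacent:
  assumes l: "search_law r" and r: "10 * n \<le> r" and a: "a \<in> C" "\<not> arrived r a" "course a = 1"
    and b: "b \<in> C" "\<not> arrived r b" "course b = - 1"
  shows "\<not> N dvd P r b - P r a - 1"
proof
  assume h: "N dvd P r b - P r a - 1"
  obtain x y where xy: "x + y \<le> N" and g: "1 \<le> x - (P r a - P (10 * n) a)" "P r a \<ge> P (10 * n) a"
      "1 \<le> y + (P r b - P (10 * n) b)" "P r b \<le> P (10 * n) b"
      "N dvd P r b - P r a - (x - (P r a - P (10 * n) a)) - (y + (P r b - P (10 * n) b))"
    using gap[OF l r a b] r by (metis order_refl)
  define s where "s = (x - (P r a - P (10 * n) a)) + (y + (P r b - P (10 * n) b))"
  have s: "2 \<le> s" "s \<le> N" using g xy by (auto simp: s_def)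
  have "N dvd (P r b - P r a - 1) - (P r b - P r a - (x - (P r a - P (10 * n) a)) - (y + (P r b - P (10 * n) b)))"
    using h g(5) by (rule dvd_diff)
  moreover have "(P r b - P r a - 1) - (P r b - P r a - (x - (P r a - P (10 * n) a)) -
      (y + (P r b - P (10 * n) b))) = s - 1" by (simp add: s_def)
  ultimately have "N dvd s - 1" by metis
  then show False using small_multiple[of N "s - 1"] s by auto
qed

text \<open>\<open>\<eta>\<close> is the common direction of the waiters in the clockwise frame. It
  may change whenever agents join them.\<close>

definition searching :: "nat \<Rightarrow> bool" where
  "searching r \<longleftrightarrow> alive (Suc r) \<and> (\<exists>\<eta>. (\<eta> = 1 \<or> \<eta> = - 1) \<and> (\<forall>a\<in>C.
     mode (st (Suc r) a) = (if arrived r a then Waiter else Mover) \<and>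
     sg a * heading (st (Suc r) a) = (if arrived r a then \<eta> else course a)))"

lemma searching_start: "searching (10 * n)"
proof -
  have "course a = course w" if "a \<in> C" "arrived (10 * n) a" for a
  proof -
    have "\<bar>W (10 * n) a\<bar> \<ge> 2" using that arrived_start by simp
    then show ?thesis
      using late_agents_merged[OF that(1) w(1) _ w(2)] w(2) by (auto simp: course_def)
  qed
  then show ?thesis
    unfolding searching_def using turning(1,3,4) course[of w] arrived_start by (intro conjI exI[of _ "course w"]) auto
qed

lemma D_searching:
  assumes j: "searching q" and q: "10 * n \<le> q" "q < 11 * n" and a: "a \<in> C"
  shows "D q a = (if arrived q a then 0 else course a)"
proof (cases "arrived q a")
  case True
  then have "mode (st (Suc q) a) = Waiter" "clock (st (Suc q) a) = Suc q"
    using j a clock_st[of "Suc q" a] by (auto simp: searching_def)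
  then show ?thesis using True q by (simp add: D_def go_def)
next
  case False
  have "D q a = course a"
    by (rule D_march) (use j a False course[of a] in \<open>auto simp: searching_def\<close>)
  then show ?thesis using False by simp
qed

text \<open>Agents joining in the same round have the same course: with both courses among them,
  both searching groups would have arrived and everybody would be united. So the waiters that adopt
  the direction of the newcomers agree.\<close>

lemma searching_step:
  assumes r: "10 * n \<le> r" "r < 11 * n" and l: "search_law (Suc r)" and j: "searching r"
  shows "searching (Suc r)"
proof -
  let ?R = "Suc r"
  have al: "alive ?R" using j by (simp add: searching_def)
  obtain \<eta> where \<eta>: "\<eta> = 1 \<or> \<eta> = - 1"
    and md: "\<And>a. a \<in> C \<Longrightarrow> mode (st ?R a) = (if arrived r a then Waiter else Mover)"
    and hd: "\<And>a. a \<in> C \<Longrightarrow> sg a * heading (st ?R a) = (if arrived r a then \<eta> else course a)"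
    using j unfolding searching_def by blast
  have l': "search_law r" using l by (simp add: search_law_def)
  have D: "D r a = (if arrived r a then 0 else course a)" if "a \<in> C" for a
    using l r that by (simp add: search_law_def)
  have D0: "D r a = 0 \<longleftrightarrow> arrived r a" if "a \<in> C" for a using D[OF that] course[of a] by auto
  have stay: "arrived ?R a" if "a \<in> C" "arrived r a" for a by (rule arrived_stays[OF l that(1) r(1) _ _ that(2)]) auto
  have R: "9 * n < ?R" "?R \<le> 15 * n" "\<not> ?R < 10 * n" "?R \<noteq> 10 * n" "?R \<noteq> 13 * n" "?R \<noteq> 15 * n" "?R \<le> 11 * n"
    using r by auto
  have ns: "mode (st ?R a) \<noteq> Symmetric" if "a \<in> C" for a using md[OF that] by simp
  have nu: "\<not> united ?R" by (rule not_united[OF R(1,2) al ns])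
  have nc: "\<not> crosses (vw ?R a)" if a: "a \<in> C" for a
  proof
    assume "crosses (vw ?R a)"
    then obtain b where b: "b \<in> C" "V r a \<noteq> 0" "V r b = - V r a" "N dvd P r b - P r a - V r a"
      using crosses_vw[OF a] by blast
    then have V: "V r a = D r a" "V r b = D r b" using V_cases[of r a] V_cases[of r b] by auto
    then have na: "\<not> arrived r a" "\<not> arrived r b" using D0[OF a] D0[OF b(1)] b by auto
    then have d: "V r a = course a" "course b = - course a" using V D[OF a] D[OF b(1)] b by auto
    show False
    proof (cases "course a = 1")
      case True
      then show False using never_adjacent[OF l' r(1) a na(1) _ b(1) na(2)] b(4) d by simp
    next
      case False
      then have da: "course a = - 1" "course b = 1" using course[of a] d by auto
      have "N dvd P r a - P r b - 1"
        using b(4) d da dvd_diff_commute[of N "P r b - P r a" "- 1"] by (simp add: algebra_simps)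
      then show False using never_adjacent[OF l' r(1) b(1) na(2) da(2) a na(1) da(1)] by simp
    qed
  qed
  have mode: "mode (st (Suc ?R) a) = (if arrived ?R a then Waiter else Mover)" if a: "a \<in> C" for a
  proof -
    \<comment> \<open>An idle agent is one that had arrived before. As \<open>w\<close> is always
      among these, a mover that reaches the group notices it.\<close>
    have i: "idle (vw ?R a) > 0 \<or> arrived r a \<longleftrightarrow> arrived ?R a"
    proof
      assume "idle (vw ?R a) > 0 \<or> arrived r a"
      then show "arrived ?R a"
      proof
        assume "idle (vw ?R a) > 0"
        then obtain b where "b \<in> mates ?R a" "D r b = 0"
          unfolding idle_vw[OF a] by (auto simp: card_gt_0_iff)
        then have "b \<in> C" "N dvd P ?R b - P ?R a" "arrived r b" using D0 by (auto simp: mates_def)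
        then show ?thesis using stay arrived_cong by blast
      qed (use stay a in blast)
    next
      assume arrived: "arrived ?R a"
      show "idle (vw ?R a) > 0 \<or> arrived r a"
      proof (cases "arrived r a")
        case False
        have "arrived (10 * n) w" using arrived_start[OF w(1)] w(2) by simp
        then have wr: "arrived r w" by (intro arrived_stays[OF l' w(1) _ r(1)]) auto
        then have "w \<in> {b \<in> mates ?R a. D r b = 0}"
          using D0[OF w(1)] arrived_together[OF arrived stay[OF w(1) wr]] w(1) False by (auto simp: mates_def)
        then have "card {b \<in> mates ?R a. D r b = 0} > 0" by (auto simp: card_gt_0_iff)
        then show ?thesis unfolding idle_vw[OF a] by simp
      qed simp
    qed
    show ?thesis
      using late_mode[OF R(1) al a ns[OF a]] R nu nc[OF a] md[OF a] i by (auto split: if_splits)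
  qed
  have alive: "alive (Suc ?R)" using mode by (auto simp: alive_def)
  define arr where "arr = {b \<in> C. \<not> arrived r b \<and> arrived ?R b}"
  have uniform: "course b = course c" if bc: "b \<in> arr" "c \<in> arr" for b c
  proof (rule ccontr)
    assume ne: "course b \<noteq> course c"
    have nat: "\<not> arrived (10 * n) e" if "e \<in> C" "\<not> arrived r e" for e
      using arrived_stays[OF l' that(1) _ r(1)] that by auto
    have "arrived ?R e" if e: "e \<in> C" for e
    proof (cases "arrived r e")
      case True
      then show ?thesis using stay e by blast
    next
      case False
      have "course e = course b \<or> course e = course c" using ne course[of e] course[of b] course[of c] by auto
      then obtain f where f: "f \<in> arr" "course e = course f" using bc by blast
      then have "N dvd P ?R f - P ?R e"
        using movers_together[OF l e nat[OF e False] _ _ f(2), of ?R] nat[of f] r by (auto simp: arr_def)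
      then show ?thesis using arrived_cong f(1) by (auto simp: arr_def)
    qed
    then have "united ?R" unfolding united_def using arrived_together by blast
    then show False using nu by blast
  qed
  \<comment> \<open>The non-idle agents that a waiter sees are exactly the newcomers of this
    round.\<close>
  have seen: "{b \<in> mates ?R a. D r b = d} = {b \<in> arr. course b = d}" if a: "a \<in> C" "arrived r a" and d: "d \<noteq> 0" for a d
  proof (intro subset_antisym subsetI)
    fix b assume "b \<in> {b \<in> mates ?R a. D r b = d}"
    then have b: "b \<in> C" "N dvd P ?R b - P ?R a" "D r b = d" by (auto simp: mates_def)
    then show "b \<in> {b \<in> arr. course b = d}"
      using D[OF b(1)] d arrived_cong[OF b(2)] stay[OF a] by (auto simp: arr_def split: if_splits)
  next
    fix b assume "b \<in> {b \<in> arr. course b = d}"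
    then have b: "b \<in> C" "\<not> arrived r b" "arrived ?R b" "course b = d" by (auto simp: arr_def)
    then show "b \<in> {b \<in> mates ?R a. D r b = d}"
      using D[OF b(1)] arrived_together[OF stay[OF a] b(3)] a by (auto simp: mates_def)
  qed
  have farr: "finite arr" using C_fin by (simp add: arr_def)
  have heading: "heading (st (Suc ?R) a) =
      (if arrived r a \<and> along (vw ?R a) > 0 then 1 else if arrived r a \<and> against (vw ?R a) > 0 then - 1
       else heading (st ?R a))" if a: "a \<in> C" for a
    using heading_Suc[OF al a] clock_st[OF al a] R md[OF a] by (simp add: next_heading_def Let_def)
  \<comment> \<open>By \<open>uniform\<close>, every newcomer gives the same direction.\<close>
  define \<eta>' where "\<eta>' = (if arr = {} then \<eta> else course (SOME b. b \<in> arr))"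
  have \<eta>'1: "\<eta>' = 1 \<or> \<eta>' = - 1" using \<eta> course by (simp add: \<eta>'_def)
  have \<eta>'arr: "\<eta>' = course b" if "b \<in> arr" for b
    using uniform[of b "SOME b. b \<in> arr"] someI[of "\<lambda>b. b \<in> arr" b] that by (auto simp: \<eta>'_def)
  have hd': "sg a * heading (st (Suc ?R) a) = (if arrived ?R a then \<eta>' else course a)" if a: "a \<in> C" for a
  proof (cases "arrived r a")
    case False
    then have "sg a * heading (st (Suc ?R) a) = course a" using heading[OF a] hd[OF a] by simp
    then show ?thesis using \<eta>'arr[of a] a False by (auto simp: arr_def)
  next
    case arrived: True
    have al1: "along (vw ?R a) > 0 \<longleftrightarrow> (\<exists>b\<in>arr. course b = sg a)"
      unfolding along_vw[OF a] seen[OF a arrived sg_sq(3)] using farr by (auto simp: card_gt_0_iff)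
    have ag1: "against (vw ?R a) > 0 \<longleftrightarrow> (\<exists>b\<in>arr. course b = - sg a)"
      unfolding against_vw[OF a] using seen[OF a arrived, of "- sg a"] farr by (auto simp: card_gt_0_iff)
    have "sg a * heading (st (Suc ?R) a) = \<eta>'"
    proof (cases "arr = {}")
      case True
      then show ?thesis using al1 ag1 heading[OF a] hd[OF a] arrived by (simp add: \<eta>'_def)
    next
      case False
      then obtain b where b: "b \<in> arr" by blast
      then have d: "\<And>c. c \<in> arr \<Longrightarrow> course c = \<eta>'" "course b = \<eta>'" using \<eta>'arr by metis+
      show ?thesis
      proof (cases "sg a = \<eta>'")
        case True
        then have "along (vw ?R a) > 0" using al1 b d by auto
        then show ?thesis using heading[OF a] arrived True by simp
      next
        case False
        then have s: "- sg a = \<eta>'" using sg[of a] \<eta>'1 by auto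
        then have "against (vw ?R a) > 0" "\<not> along (vw ?R a) > 0" using al1 ag1 b d False by auto
        then show ?thesis using heading[OF a] arrived s by simp
      qed
    qed
    then show ?thesis using stay[OF a arrived] by simp
  qed
  show ?thesis unfolding searching_def using alive \<eta>'1 mode hd' by blast
qed

lemma searching_all:
  assumes "10 * n \<le> r"
  shows "r \<le> 11 * n \<longrightarrow> searching r \<and> search_law r"
  using assms
proof (induction r rule: dec_induct)
  case base
  show ?case using searching_start by (simp add: search_law_def)
next
  case (step r)
  show ?case
  proof
    assume r: "Suc r \<le> 11 * n"
    then have j: "searching r" "search_law r" using step by auto
    have l: "search_law (Suc r)"
      unfolding search_law_def
    proof (intro allI impI)
      fix q a assume q: "10 * n \<le> q" "q < Suc r" "a \<in> C"
      show "D q a = (if arrived q a then 0 else course a)"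
        using D_searching[OF j(1) step(1) _ q(3)] r q j(2) by (cases "q = r") (auto simp: search_law_def)
    qed
    then show "searching (Suc r) \<and> search_law (Suc r)" using searching_step[OF step(1) _ l j(1)] r by simp
  qed
qed

text \<open>Two groups still searching are never blocked together, so they jointly gain
  \<open>n\<close> steps in \<open>n\<close> rounds; but by \<open>gap\<close> they can make at most
  \<open>N - 2\<close> steps without an arrival.\<close>

lemma one_group_left:
  assumes a: "a \<in> C" "\<not> arrived (11 * n) a" and b: "b \<in> C" "\<not> arrived (11 * n) b"
  shows "course a = course b"
proof (rule ccontr)
  have aux: False if a: "a \<in> C" "\<not> arrived (11 * n) a" "course a = 1" and b: "b \<in> C" "\<not> arrived (11 * n) b" "course b = - 1" for a b
  proof -
    have l: "search_law (11 * n)" using searching_all[of "11 * n"] by simp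
    have nat: "\<not> arrived q a" "\<not> arrived q b" if "10 * n \<le> q" "q < 11 * n" for q
      using arrived_stays[OF l a(1) that(1)] arrived_stays[OF l b(1) that(1)] that a(2) b(2) by (auto dest: less_imp_le)
    have D: "D q a = 1" "D q b = - 1" if "10 * n \<le> q" "q < 11 * n" for q
      using l nat[OF that] that a b by (auto simp: search_law_def)
    have free: "\<not> (V q a = 0 \<and> V q b = 0)" if q: "10 * n \<le> q" "q < 11 * n" for q
    proof
      assume "V q a = 0 \<and> V q b = 0"
      then have "N dvd P q b - P q a - 1" using both_blocked[OF a(1) b(1), of q] D[OF q] by auto
      moreover have "search_law q" using l q by (simp add: search_law_def)
      ultimately show False using never_adjacent[OF _ q(1) a(1) nat(1)[OF q] a(3) b(1) nat(2)[OF q] b(3)] by blast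
    qed
    have "1 * (P (11 * n) a - P (10 * n) a) + - 1 * (P (11 * n) b - P (10 * n) b) \<ge> int (11 * n - 10 * n)"
      by (rule joint_progress[OF a(1) b(1) _ _ _ D free]) auto
    then have pr: "(P (11 * n) a - P (10 * n) a) - (P (11 * n) b - P (10 * n) b) \<ge> N" by simp
    obtain x y where "x + y \<le> N" "1 \<le> x - (P (11 * n) a - P (10 * n) a)" "1 \<le> y + (P (11 * n) b - P (10 * n) b)"
      by (rule gap[OF l _ a b]) auto
    then show False using pr by linarith
  qed
  assume "course a \<noteq> course b"
  then show False using aux[OF a _ b] aux[OF b _ a] course[of a] course[of b] by auto
qed

lemma contradiction: False
proof -
  define t u where "t = 11 * n" and "u = 13 * n"
  have searching: "searching t" and l: "search_law t" using searching_all[of t] by (auto simp: t_def)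
  have al: "alive (Suc t)" using searching by (simp add: searching_def)
  obtain \<eta> where \<eta>: "\<eta> = 1 \<or> \<eta> = - 1"
    and md: "\<And>a. a \<in> C \<Longrightarrow> mode (st (Suc t) a) = (if arrived t a then Waiter else Mover)"
    and hd: "\<And>a. a \<in> C \<Longrightarrow> sg a * heading (st (Suc t) a) = (if arrived t a then \<eta> else course a)"
    using searching unfolding searching_def by blast
  have nw: "arrived q w" if "10 * n \<le> q" "q \<le> t" for q
    using arrived_stays[OF l w(1) _ that] arrived_start[OF w(1)] w(2) by simp
  have nu: "\<not> united t"
  proof (rule not_united)
    have "searching (t - 1)" using searching_all[of "t - 1"] n3 by (simp add: t_def)
    then show "mode (st t a) \<noteq> Symmetric" if "a \<in> C" for a
      using that n3 by (fastforce simp: searching_def t_def split: if_splits)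
  qed (use n al alive_Suc in \<open>auto simp: t_def\<close>)
  have "\<exists>b\<in>C. \<not> arrived t b"
  proof (rule ccontr)
    assume "\<not> ?thesis"
    then have "united t" unfolding united_def using arrived_together by blast
    then show False using nu by blast
  qed
  then obtain b where b: "b \<in> C" "\<not> arrived t b" by blast
  define \<epsilon> where "\<epsilon> = course b"
  have \<epsilon>: "course a = \<epsilon>" if "a \<in> C" "\<not> arrived t a" for a
    using one_group_left[of a b] that b by (simp add: t_def \<epsilon>_def)
  have nat: "\<not> arrived (10 * n) a" if "a \<in> C" "\<not> arrived t a" for a
    using arrived_stays[OF l that(1), of "10 * n" t] that(2) by (auto simp: t_def)
  have merged: "N dvd P t d - P t c" if c: "c \<in> C" and d: "d \<in> C" and cd: "arrived t c = arrived t d" for c d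
  proof (cases "arrived t c")
    case True
    then show ?thesis using arrived_together cd by blast
  next
    case False
    have "10 * n \<le> t" by (simp add: t_def)
    then show ?thesis
      using movers_together[OF l c nat[OF c False] d nat[OF d], of t] \<epsilon>[OF c False] \<epsilon>[OF d] cd False by simp
  qed
  define M where "M a = (if arrived t a then Waiter else Mover)" for a
  define \<delta> where "\<delta> a = (if arrived t a then \<eta> else \<epsilon>)" for a
  have M: "M a = Mover \<or> M a = Waiter \<and> 11 * n \<le> t" for a by (simp add: M_def t_def)
  have md': "mode (st (Suc t) a) = M a" if "a \<in> C" for a using md[OF that] by (simp add: M_def)
  have hd': "sg a * heading (st (Suc t) a) = \<delta> a" if "a \<in> C" for a
    using hd[OF that] \<epsilon>[OF that] by (auto simp: \<delta>_def)
  have \<delta>: "\<delta> a = 1 \<or> \<delta> a = - 1" for a using \<eta> course[of b] by (simp add: \<delta>_def \<epsilon>_def)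
  have t10: "10 * n \<le> t" by (simp add: t_def)
  show False
  \<comment> \<open>Different directions lead to success by round \<open>13 n\<close>. With equal
    ones every agent fails the test of that round, and the turn of the movers yields facing groups
    for the rounds up to \<open>15 n\<close>.\<close>
  proof (cases "\<eta> = \<epsilon>")
    case False
    show False
    proof (rule no_two_groups[of t u M \<delta>])
      show "N dvd P t d - P t c" if "c \<in> C" "d \<in> C" "\<delta> c = \<delta> d" for c d
        by (rule merged[OF that(1,2)]) (use that False in \<open>auto simp: \<delta>_def split: if_splits\<close>)
    qed (use t10 al M md' hd' \<delta> in \<open>auto simp: t_def u_def\<close>)
  next
    case True
    then have \<delta>e: "\<delta> a = \<eta>" for a by (simp add: \<delta>_def)
    have tu: "t < u" "u \<le> 15 * n" "\<not> (t < 13 * n \<and> 13 * n < u)" using n by (auto simp: t_def u_def)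
    have m: "(\<forall>a\<in>C. \<forall>b\<in>C. \<delta> a = \<delta> b \<longrightarrow> N dvd P t b - P t a) \<or> (\<forall>a\<in>C. \<forall>b\<in>C. \<delta> a = \<delta> b)"
      unfolding \<delta>e by simp
    have state: "\<forall>a\<in>C. (M a = Mover \<or> M a = Waiter \<and> 11 * n \<le> t) \<and> mode (st (Suc t) a) = M a \<and>
        sg a * heading (st (Suc t) a) = \<delta> a \<and> (\<delta> a = 1 \<or> \<delta> a = - 1)"
      using M md' hd' \<delta> by blast
    note mar = march[of t u M \<delta>, OF t10 tu al state m tu(1) order_refl]
    have D: "D q a = \<eta>" if "t \<le> q" "q < u" "a \<in> C" for q a using mar(6)[OF that(3,1,2)] \<delta>e by simp
    have mu: "N dvd P u d - P u c" if "c \<in> C" "d \<in> C" "arrived t c = arrived t d" for c d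
    proof -
      have "P u d - P u c = P t d - P t c"
        using merged_stays[OF that(1,2) _ _ merged[OF that], of u] D that tu(1) by simp
      then show ?thesis using merged[OF that] by simp
    qed
    have apart: "\<not> N dvd P u d - P u c" if c: "c \<in> C" and d: "d \<in> C" and cd: "arrived t c \<noteq> arrived t d" for c d
    proof
      assume h: "N dvd P u d - P u c"
      have "N dvd P u e - P u c" if e: "e \<in> C" for e
      proof (cases "arrived t e = arrived t c")
        case True
        then show ?thesis using mu[OF c e] by simp
      next
        case False
        then have "N dvd P u e - P u d" using mu[OF d e] cd by simp
        then show ?thesis by (rule dvd_P_trans[OF h])
      qed
      then have "united u" by (rule unitedI)
      then show False using mar(5) by blast
    qed
    \<comment> \<open>Over \<open>n\<close> rounds, \<open>one_direction\<close> still gives twice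
      the progress at least 2, so every agent has moved since its mark was set.\<close>
    have moved: "P u c \<noteq> P (12 * n) c" if c: "c \<in> C" for c
    proof -
      obtain d where d: "d \<in> C" "arrived t c \<noteq> arrived t d" using w(1) nw[OF t10 order_refl] b by (cases "arrived t c") auto
      have "2 * (\<eta> * (P u c - P (12 * n) c)) \<ge> int (u - 12 * n) - N + 2"
        by (rule one_direction[OF c d(1) _ \<eta> _ _ apart[OF c d]]) (use D c d in \<open>auto simp: t_def u_def\<close>)
      then show ?thesis by (auto simp: u_def)
    qed
    have alu: "alive u" using mar(1) .
    have mark: "mark (st u a) = sg a * (P (12 * n) a - int a)" if "a \<in> C" for a
      using mark_late[OF that, of u] alu n by (simp add: u_def)
    have u9: "9 * n < u" "\<not> u < 10 * n" "u \<noteq> 10 * n" "u \<noteq> 15 * n" "\<not> u \<le> 11 * n" using n by (auto simp: u_def)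
    have mdu: "mode (st (Suc u) a) = M a" if a: "a \<in> C" for a
    proof -
      have "sg a * (P u a - int a) \<noteq> mark (st u a)"
        using moved[OF a] mark[OF a] by simp
      moreover have "mode (st u a) = M a" "mode (st u a) \<noteq> Symmetric" using mar(2)[OF a] M[of a] by auto
      ultimately show ?thesis
        using late_mode[OF u9(1) alu a] u9 mar(4)[OF a] mar(5) by simp
    qed
    define \<delta>' where "\<delta>' a = (if arrived t a then \<eta> else - \<eta>)" for a
    have hdu: "sg a * heading (st (Suc u) a) = \<delta>' a" if a: "a \<in> C" for a
    proof -
      have "heading (st (Suc u) a) = (if M a = Mover then - heading (st u a) else heading (st u a))"
        using heading_Suc[OF alu a] clock_st[OF alu a] u9 mar(2)[OF a]
        by (auto simp: next_heading_def Let_def u_def)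
      then show ?thesis using mar(3)[OF a] \<delta>e[of a] by (simp add: \<delta>'_def M_def)
    qed
    show False
    proof (rule no_two_groups[of u "15 * n" M \<delta>'])
      show "alive (Suc u)" unfolding alive_def using mdu by (simp add: M_def)
      show "N dvd P u d - P u c" if "c \<in> C" "d \<in> C" "\<delta>' c = \<delta>' d" for c d
        by (rule mu[OF that(1,2)]) (use that \<eta> in \<open>auto simp: \<delta>'_def split: if_splits\<close>)
      show "M a = Mover \<or> M a = Waiter \<and> 11 * n \<le> u" for a using M[of a] tu by auto
    qed (use mdu hdu \<eta> in \<open>auto simp: u_def \<delta>'_def\<close>)
  qed
qed

end

section \<open>Termination, awareness and detection of periodicity\<close>

context execution
begin

lemma aperiodic_success:
  assumes "C \<notin> periodic_configurations n"
  shows "\<exists>r\<le>15 * n. success r"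
proof (rule ccontr)
  assume "\<not> ?thesis"
  then interpret pursuit n C E using assms by unfold_locales auto
  obtain w where "w \<in> C" "\<bar>W (10 * n) w\<bar> \<ge> 2" using some_waiter by blast
  then interpret chase n C E w by unfold_locales
  show False by (rule contradiction)
qed

lemma finished_stays:
  assumes s: "success r" and q: "Suc r \<le> q"
  shows "(\<forall>a\<in>C. mode (st q a) = Finished \<and> P q a = P r a)"
  using q
proof (induction q rule: dec_induct)
  case base
  have "D r a = 0" if "a \<in> C" for a
    using s that by (simp add: success_def D_def go_def)
  then have "V r a = 0" if "a \<in> C" for a using V_cases[of r a] that by auto
  then show ?case using s by (simp add: success_def P_Suc)
next
  case (step q)
  have "mode (st (Suc q) a) = Finished" if "a \<in> C" for a
    using step that by (simp add: st_Suc)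
  moreover from this have "D q a = 0" if "a \<in> C" for a
    using that by (simp add: D_def go_def)
  then have "V q a = 0" if "a \<in> C" for a using V_cases[of q a] that by auto
  ultimately show ?case using step by (simp add: P_Suc)
qed

lemma close_gathered:
  assumes "close r"
  shows "gathered n C (glob r)"
proof -
  obtain v where v: "\<And>a. a \<in> C \<Longrightarrow> N dvd P r a - v \<or> N dvd P r a - v - 1"
    using assms unfolding close_def by blast
  define x where "x = nat (v mod N)"
  have x: "x < n" "int x = v mod N" using n by (auto simp: x_def nat_less_iff)
  have "node (glob r a) \<in> {x, (x + 1) mod n}" if a: "a \<in> C" for a
    using v[OF a]
  proof
    assume "N dvd P r a - v"
    then have "P r a mod N = v mod N" by (simp add: mod_eq_dvd_iff)
    then have "int (node (glob r a)) = int x" using node_eq[OF a] x by simp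
    then show ?thesis by simp
  next
    assume "N dvd P r a - v - 1"
    then have "P r a mod N = (v + 1) mod N" by (simp add: mod_eq_dvd_iff diff_diff_eq)
    then have "int (node (glob r a)) = (int x + 1) mod N" using node_eq[OF a] x(2) by (simp add: mod_simps)
    also have "\<dots> = int ((x + 1) mod n)" by (simp add: of_nat_mod add.commute)
    finally show ?thesis by (metis insertCI of_nat_eq_iff)
  qed
  then show ?thesis unfolding gathered_def using x(1) by blast
qed

text \<open>Nobody is terminal before round \<open>Suc r\<close> and nobody moves from round
  \<open>r\<close> on, so terminal states occur in gathered positions only.\<close>

lemma success_outcome:
  assumes s: "success r"
  shows "all_terminal (encode (gathering n)) C (run (encode (gathering n)) n C E (Suc r))"
    "gathered n C (run (encode (gathering n)) n C E (Suc r))"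
    "aware (encode (gathering n)) n C E"
proof -
  have fin: "terminal (encode (gathering n)) (mem (run (encode (gathering n)) n C E q a)) \<longleftrightarrow> mode (st q a) = Finished" for q a
    unfolding run_encode by (simp add: encode_def gathering_def st_def glob_def)
  have gath: "gathered n C (run (encode (gathering n)) n C E q) \<longleftrightarrow> gathered n C (glob q)" for q
    unfolding run_encode gathered_def glob_def by simp
  have later: "gathered n C (glob q)" if "Suc r \<le> q" for q
  proof -
    have "P q a = P r a" if "a \<in> C" for a using finished_stays[OF s \<open>Suc r \<le> q\<close>] that by blast
    then have "close q" using s unfolding success_def close_def by simp
    then show ?thesis by (rule close_gathered)
  qed
  show "all_terminal (encode (gathering n)) C (run (encode (gathering n)) n C E (Suc r))"
    using s unfolding all_terminal_def fin success_def by blast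
  show "gathered n C (run (encode (gathering n)) n C E (Suc r))" unfolding gath by (rule later) simp
  show "aware (encode (gathering n)) n C E"
    unfolding aware_def fin gath
  proof (intro allI impI)
    fix q assume "\<exists>a\<in>C. mode (st q a) = Finished"
    then have "\<not> alive q" by (auto simp: alive_def)
    then have "Suc r \<le> q" using s alive_mono[of r q] unfolding success_def by (meson not_less_eq_eq)
    then show "gathered n C (glob q)" by (rule later)
  qed
qed

text \<open>\<open>Symmetric\<close> is entered in round \<open>9 n\<close> only, and there, unless
  a success has occurred, every agent knows the configuration by
  \<open>exploration_outcome\<close>.\<close>

lemma never_symmetric:
  assumes np: "C \<notin> periodic_configurations n" and a: "a \<in> C"
  shows "mode (st r a) \<noteq> Symmetric"
proof -
  have late: "alive r \<longrightarrow> mode (st r a) \<noteq> Symmetric" if "Suc (9 * n) \<le> r" for r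
    using that
  proof (induction r rule: dec_induct)
    case base
    show ?case
    proof
      assume al: "alive (Suc (9 * n))"
      have "\<not> (\<exists>r\<le>9 * n. success r)"
      proof
        assume "\<exists>r\<le>9 * n. success r"
        then obtain r where "r \<le> 9 * n" "success r" by blast
        then have "\<not> alive (Suc r)" using C_ne by (auto simp: success_def alive_def)
        then show False using alive_mono[OF al] \<open>r \<le> 9 * n\<close> by simp
      qed
      then show "mode (st (Suc (9 * n)) a) \<noteq> Symmetric" using exploration_outcome np a by auto
    qed
  next
    case (step r)
    show ?case
    proof
      assume al: "alive (Suc r)"
      then have al': "alive r" by (rule alive_Suc)
      then show "mode (st (Suc r) a) \<noteq> Symmetric"
        using step mode_Suc[OF al' a] clock_st[OF al' a] by (auto simp: next_mode_def Let_def)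
    qed
  qed
  show ?thesis
  proof (cases "alive r")
    case True
    consider "r \<le> 6 * n" | "Suc (6 * n) \<le> r" "r \<le> 9 * n" | "Suc (9 * n) \<le> r" by linarith
    then show ?thesis
    proof cases
      case 1
      then show ?thesis using walking a by simp
    next
      case 2
      then show ?thesis using exploring[OF a] True by simp
    next
      case 3
      then show ?thesis using late True by blast
    qed
  next
    case False
    obtain q where q: "success q" using aperiodic_success[OF np] by blast
    then have "Suc q \<le> r" using False alive_mono[of q r] unfolding success_def by (meson not_less_eq_eq)
    then show ?thesis using finished_stays[OF q] a by simp
  qed
qed

lemma symmetric_stays:
  assumes s: "\<And>a. a \<in> C \<Longrightarrow> mode (st (Suc (9 * n)) a) = Symmetric" and r: "Suc (9 * n) \<le> r"
  shows "alive r \<and> (\<forall>a\<in>C. mode (st r a) = Symmetric)"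
  using r
proof (induction r rule: dec_induct)
  case base
  then show ?case using s by (simp add: alive_def)
next
  case (step r)
  then have "mode (st (Suc r) a) = Symmetric" if "a \<in> C" for a
    using mode_Suc[of r a] clock_st[of r a] that by (simp add: next_mode_def Let_def)
  then show ?case by (simp add: alive_def)
qed

end

text \<open>A decision taken in round \<open>15 * n\<close> shows in the memory one round later,
  hence \<open>15 * n + 1\<close>.\<close>

lemma gathering_solves:
  assumes "n \<ge> 3" "C \<in> configurations n - periodic_configurations n"
  shows "solves_gathering (encode (gathering n)) n C" "never_detects_periodicity (encode (gathering n)) n C"
    "terminates_within (encode (gathering n)) n C (15 * n + 1)"
proof -
  have ex: "\<exists>r\<le>15 * n. execution.success n C E r" if "admissible n C E" for E
    using execution.aperiodic_success[of n C E] assms that by (simp add: execution_def)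
  show "solves_gathering (encode (gathering n)) n C"
    unfolding solves_gathering_def
  proof (intro allI impI)
    fix E assume E: "admissible n C E"
    then interpret execution n C E using assms by unfold_locales auto
    show "(\<exists>r. all_terminal (encode (gathering n)) C (run (encode (gathering n)) n C E r) \<and>
        gathered n C (run (encode (gathering n)) n C E r)) \<and> aware (encode (gathering n)) n C E"
      using ex[OF E] success_outcome by blast
  qed
  show "terminates_within (encode (gathering n)) n C (15 * n + 1)"
    unfolding terminates_within_def
  proof (intro allI impI)
    fix E assume E: "admissible n C E"
    then interpret execution n C E using assms by unfold_locales auto
    obtain r where "r \<le> 15 * n" "success r" using ex[OF E] by blast
    then show "\<exists>r\<le>15 * n + 1. all_terminal (encode (gathering n)) C (run (encode (gathering n)) n C E r)"
      using success_outcome(1) by (intro exI[of _ "Suc r"]) auto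
  qed
  show "never_detects_periodicity (encode (gathering n)) n C"
    unfolding never_detects_periodicity_def
  proof (intro allI impI ballI)
    fix E r a assume E: "admissible n C E" and a: "a \<in> C"
    then interpret execution n C E using assms by unfold_locales auto
    show "\<not> periodic_detected (encode (gathering n)) (mem (run (encode (gathering n)) n C E r a))"
      using never_symmetric[OF _ a, of r] assms
      unfolding run_encode by (simp add: encode_def gathering_def st_def glob_def)
  qed
qed

text \<open>If no round is a success, \<open>exploration_outcome\<close> makes all agents
  \<open>Symmetric\<close> in round \<open>9 n\<close>. Then nobody ever terminates and awareness
  holds vacuously.\<close>

lemma gathering_detects:
  assumes "n \<ge> 3" "C \<in> periodic_configurations n"
  shows "detects_periodicity (encode (gathering n)) n C"
  unfolding detects_periodicity_def
proof (intro allI impI)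
  fix E assume E: "admissible n C E"
  have "C \<in> configurations n" using assms by (simp add: periodic_configurations_def)
  then interpret execution n C E using assms E by unfold_locales auto
  show "(\<exists>r. (\<forall>a\<in>C. periodic_detected (encode (gathering n)) (mem (run (encode (gathering n)) n C E r a))) \<or>
      all_terminal (encode (gathering n)) C (run (encode (gathering n)) n C E r) \<and>
      gathered n C (run (encode (gathering n)) n C E r)) \<and> aware (encode (gathering n)) n C E"
  proof (cases "\<exists>r. success r")
    case True
    then show ?thesis using success_outcome by blast
  next
    case False
    then have al: "alive (9 * n)" and s: "\<And>a. a \<in> C \<Longrightarrow> mode (st (Suc (9 * n)) a) = Symmetric"
      using exploration_outcome assms(2) by auto
    have "alive r" for r
    proof (cases "Suc (9 * n) \<le> r")
      case True
      then show ?thesis using symmetric_stays[OF s] by blast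
    next
      case False
      then show ?thesis using alive_mono[OF al] by simp
    qed
    then have "aware (encode (gathering n)) n C E"
      unfolding aware_def run_encode
      by (auto simp: encode_def gathering_def st_def glob_def alive_def)
    moreover have "\<forall>a\<in>C. periodic_detected (encode (gathering n)) (mem (run (encode (gathering n)) n C E (Suc (9 * n)) a))"
      unfolding run_encode using s by (simp add: encode_def gathering_def st_def glob_def del: run.simps)
    ultimately show ?thesis by blast
  qed
qed

theorem theorem1:
  "(\<exists>A :: nat \<Rightarrow> nat protocol.
      \<forall>n\<ge>3. \<forall>C \<in> configurations n - periodic_configurations n. solves_gathering (A n) n C) \<and>
   (\<exists>A :: nat \<Rightarrow> nat protocol.
      (\<forall>n\<ge>3. \<forall>C \<in> configurations n - periodic_configurations n.
          solves_gathering (A n) n C \<and> never_detects_periodicity (A n) n C) \<and>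
      (\<exists>T :: nat \<Rightarrow> nat. (\<lambda>n. real (T n)) \<in> O(\<lambda>n. real n) \<and>
          (\<forall>n\<ge>3. \<forall>C \<in> configurations n - periodic_configurations n.
             terminates_within (A n) n C (T n))) \<and>
      (\<forall>n\<ge>3. \<forall>C \<in> periodic_configurations n. detects_periodicity (A n) n C))"
proof -
  have T: "(\<lambda>n. real (15 * n + 1)) \<in> O(\<lambda>n. real n)"
    by (rule bigoI[of _ 16]) (auto intro!: eventually_at_top_linorderI[of 1])
  show ?thesis
    by (intro conjI exI[of _ "\<lambda>n. encode (gathering n)"] exI[of _ "\<lambda>n. 15 * n + 1"] T)
      (use gathering_solves gathering_detects in blast)+
qed

end
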